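(* Let $(s_n)$ stand for the Kolmogorov numbers $(d_n)$ or for the dyadic entropy numbers $(e_n)$. Let $0<\tau\le\frac12$, $\beta,\gamma\in\mathbb R$, $c_0>0$, and let $$k(x)=x^{-\tau}(c_0-\ln x)^{-\beta}(c_0+\ln(c_0-\ln x))^{-\gamma},\quad x\in(0,1],$$ where it is assumed that $k:(0,1]\to\mathbb R$ is a well-defined non-negative, continuous, strictly decreasing function with $\lim_{x\to0}k(x)=\infty$ and $k\in L_2[0,1]$. Let $(T_Kf)(t)=\int_0^1K(t,x)f(x)\,dx$, $t\in[0,1]$, with kernel $K$ given either by (WS) $K(t,x)=k(|t-x|)$, or by (VO) $K(t,x)=k(t-x)$ for $x<t$ and $K(t,x)=0$ for $x\ge t$. Then in both cases (WS) and (VO) there is a constant $c=c(\beta,\gamma)>0$ ($\tau$ and $c_0$ being fixed), independent of $n$ and $q$, such that for all $1\le q<\infty$ and all $n\in\mathbb N$ $$s_n(T_K:L_2[0,1]\to L_q[0,1])\le c(\beta,\gamma)\sqrt q\,f(n,\tau,\beta,\gamma),$$ where $f(n,\tau,\beta,\gamma)=$ $$\begin{cases}n^{\tau-1}(\log(n+1))^{-\beta}(\log\log(n+3))^{-\gamma},&0<\tau<1/2,\ \beta\in\mathbb R,\ \gamma\in\mathbb R,\\ n^{-1/2}(\log(n+1))^{1/2-\beta}(\log\log(n+3))^{-\gamma},&\tau=1/2,\ 1/2<\beta<\infty,\ \gamma\in\mathbb R,\\ n^{-1/2}(\log\log(n+3))^{1/2-\gamma},&\tau=\beta=1/2,\ 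1/2<\gamma<\infty.\end{cases}$$
   Context: $\log$ is the logarithm to base 2 and $\ln$ the natural logarithm. Entropy numbers: for a bounded subset $A$ of a metric space $M$, $\varepsilon_n(A)=\inf\{\varepsilon\ge0:\exists x_1,\dots,x_n\in M,\ A\subset\bigcup_{i=1}^n B_M(x_i,\varepsilon)\}$ with closed balls, $e_n(A)=\varepsilon_{2^{n-1}}(A)$; for a bounded linear operator $T:X\to Y$ between Banach spaces, $e_n(T)=e_n(T(B_X))$ with $B_X$ the closed unit ball of $X$. The $n$-th Kolmogorov number of $T$ is $d_n(T)=\inf\{\|Q_F^YT\|:F\text{ subspace of }Y,\ \dim F<n\}$, where $Q_F^Y:Y\to Y/F$ is the quotient map. *)

theory Defs
  imports "HOL-Analysis.Analysis"
begin

section \<open>Entropy and Kolmogorov numbers\<close>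

text \<open>
  Since the exponent \<open>q\<close> is a real parameter, the spaces \<open>L\<^sub>q\<close> cannot be types of their own.
  A normed space is therefore given by a carrier (a subspace of an ambient real vector space)
  together with a norm on this carrier.
\<close>

definition entropy_eps :: "'a set \<Rightarrow> ('a \<Rightarrow> 'a \<Rightarrow> real) \<Rightarrow> nat \<Rightarrow> 'a set \<Rightarrow> real" where
  "entropy_eps M d n A = Inf {\<epsilon>. \<epsilon> \<ge> 0 \<and>
     (\<exists>x. (\<forall>i\<in>{1..n}. x i \<in> M) \<and> A \<subseteq> (\<Union>i\<in>{1..n::nat}. Metric_space.mcball M d (x i) \<epsilon>))}"

definition unit_ball :: "'a set \<Rightarrow> ('a \<Rightarrow> real) \<Rightarrow> 'a set" where
  "unit_ball X nX = {f \<in> X. nX f \<le> 1}"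

definition entropy_number ::
  "'a set \<Rightarrow> ('a \<Rightarrow> real) \<Rightarrow> 'b::real_vector set \<Rightarrow> ('b \<Rightarrow> real) \<Rightarrow> ('a \<Rightarrow> 'b) \<Rightarrow> nat \<Rightarrow> real" where
  "entropy_number X nX Y nY T n =
     entropy_eps Y (\<lambda>f g. nY (f - g)) (2 ^ (n - 1)) (T ` unit_ball X nX)"

definition operator_norm :: "'a set \<Rightarrow> ('a \<Rightarrow> real) \<Rightarrow> ('b \<Rightarrow> real) \<Rightarrow> ('a \<Rightarrow> 'b) \<Rightarrow> real" where
  "operator_norm X nX nY T = (SUP f\<in>unit_ball X nX. nY (T f))"

text \<open>The quotient map onto \<open>Y/F\<close>, whose elements are the cosets of \<open>F\<close>, and the quotient norm.\<close>

definition quotient_map :: "'b::real_vector set \<Rightarrow> 'b \<Rightarrow> 'b set" where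
  "quotient_map F y = (\<lambda>g. y + g) ` F"

definition quotient_norm :: "('b \<Rightarrow> real) \<Rightarrow> 'b set \<Rightarrow> real" where
  "quotient_norm nY C = (INF y\<in>C. nY y)"

text \<open>
  The condition that \<open>F\<close> is spanned by a finite set is needed because \<^const>\<open>dim\<close> is \<open>0\<close> on
  infinite-dimensional subspaces.
\<close>

definition kolmogorov_number ::
  "'a set \<Rightarrow> ('a \<Rightarrow> real) \<Rightarrow> 'b::real_vector set \<Rightarrow> ('b \<Rightarrow> real) \<Rightarrow> ('a \<Rightarrow> 'b) \<Rightarrow> nat \<Rightarrow> real" where
  "kolmogorov_number X nX Y nY T n =
     Inf {operator_norm X nX (quotient_norm nY) (quotient_map F \<circ> T) | F.
            subspace F \<and> F \<subseteq> Y \<and> (\<exists>B. finite B \<and> F = span B) \<and> dim F < n}"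

definition bounded_operator ::
  "'a::real_vector set \<Rightarrow> ('a \<Rightarrow> real) \<Rightarrow> 'b::real_vector set \<Rightarrow> ('b \<Rightarrow> real) \<Rightarrow> ('a \<Rightarrow> 'b) \<Rightarrow> bool"
  where
  "bounded_operator X nX Y nY T \<longleftrightarrow>
     T ` X \<subseteq> Y \<and>
     (\<forall>f\<in>X. \<forall>g\<in>X. T (f + g) = T f + T g) \<and>
     (\<forall>a. \<forall>f\<in>X. T (a *\<^sub>R f) = a *\<^sub>R T f) \<and>
     (\<exists>C. \<forall>f\<in>X. nY (T f) \<le> C * nX f)"


section \<open>The real Banach spaces \<open>L\<^sub>p[0,1]\<close>\<close>

abbreviation leb01 :: "real measure" where
  "leb01 \<equiv> restrict_space lborel {0..1}"

text \<open>
  Classes of measurable functions on \<open>[0,1]\<close> modulo equality almost everywhere. The values of a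
  representative outside \<open>[0,1]\<close> are irrelevant. As every Lebesgue measurable function agrees
  almost everywhere with a Borel measurable one, Borel representatives suffice.
\<close>

definition ae_equal :: "(real \<Rightarrow> real) \<Rightarrow> (real \<Rightarrow> real) \<Rightarrow> bool" where
  "ae_equal f g \<longleftrightarrow>
     f \<in> borel_measurable leb01 \<and> g \<in> borel_measurable leb01 \<and> (AE x in leb01. f x = g x)"

quotient_type aefun = "real \<Rightarrow> real" / partial: ae_equal
proof (rule part_equivpI)
  show "\<exists>f. ae_equal f f"
    by (rule exI[of _ "\<lambda>_. 0"]) (simp add: ae_equal_def)
  show "symp ae_equal"
    by (rule sympI) (auto simp: ae_equal_def elim: eventually_mono)
  show "transp ae_equal"
  proof (rule transpI)
    fix f g h assume fg: "ae_equal f g" and gh: "ae_equal g h"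
    have "AE x in leb01. f x = g x" "AE x in leb01. g x = h x"
      using fg gh unfolding ae_equal_def by blast+
    then have "AE x in leb01. f x = h x"
      by eventually_elim simp
    with fg gh show "ae_equal f h"
      unfolding ae_equal_def by blast
  qed
qed

instantiation aefun :: real_vector
begin

lift_definition zero_aefun :: aefun is "\<lambda>_. 0"
  by (simp add: ae_equal_def)

lift_definition plus_aefun :: "aefun \<Rightarrow> aefun \<Rightarrow> aefun" is "\<lambda>f g x. f x + g x"
  unfolding ae_equal_def by (auto elim: eventually_elim2)

lift_definition minus_aefun :: "aefun \<Rightarrow> aefun \<Rightarrow> aefun" is "\<lambda>f g x. f x - g x"
  unfolding ae_equal_def by (auto elim: eventually_elim2)

lift_definition uminus_aefun :: "aefun \<Rightarrow> aefun" is "\<lambda>f x. - f x"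
  unfolding ae_equal_def by (auto elim: eventually_mono)

lift_definition scaleR_aefun :: "real \<Rightarrow> aefun \<Rightarrow> aefun" is "\<lambda>a f x. a * f x"
  unfolding ae_equal_def by (auto elim: eventually_mono)

instance
  by standard (transfer; auto simp: ae_equal_def algebra_simps)+

end

lift_definition in_Lp :: "real \<Rightarrow> aefun \<Rightarrow> bool" is
  "\<lambda>p f. integrable leb01 (\<lambda>x. \<bar>f x\<bar> powr p)"
proof -
  fix p :: real and f g :: "real \<Rightarrow> real"
  assume "ae_equal f g"
  then show "integrable leb01 (\<lambda>x. \<bar>f x\<bar> powr p) = integrable leb01 (\<lambda>x. \<bar>g x\<bar> powr p)"
    unfolding ae_equal_def by (intro integrable_cong_AE) (auto elim: eventually_mono)
qed

definition Lp :: "real \<Rightarrow> aefun set" where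
  "Lp p = {f. in_Lp p f}"

lift_definition Lp_norm :: "real \<Rightarrow> aefun \<Rightarrow> real" is
  "\<lambda>p f. (LINT x|leb01. \<bar>f x\<bar> powr p) powr (1 / p)"
proof -
  fix p :: real and f g :: "real \<Rightarrow> real"
  assume "ae_equal f g"
  then have "(LINT x|leb01. \<bar>f x\<bar> powr p) = (LINT x|leb01. \<bar>g x\<bar> powr p)"
    unfolding ae_equal_def by (intro integral_cong_AE) (auto elim: eventually_mono)
  then show "(LINT x|leb01. \<bar>f x\<bar> powr p) powr (1 / p) = (LINT x|leb01. \<bar>g x\<bar> powr p) powr (1 / p)"
    by simp
qed


section \<open>The integral operators\<close>

text \<open>
  Changing the representative of \<open>f\<close> does not change the integral.
\<close>

definition integral_operator :: "(real \<Rightarrow> real \<Rightarrow> real) \<Rightarrow> aefun \<Rightarrow> aefun" where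
  "integral_operator K f = abs_aefun (\<lambda>t. LINT x|leb01. K t x * rep_aefun f x)"

text \<open>
  \<open>0 powr 0 = 0\<close> in the library, and \<open>powr\<close> is total. The third factor of the kernel function
  may have a nonpositive base for small \<open>c\<^sub>0\<close>, so the zeroth power is set to \<open>1\<close> for every base,
  and well-definedness of the power is made explicit.
\<close>

definition rpow :: "real \<Rightarrow> real \<Rightarrow> real" where
  "rpow b a = (if a = 0 then 1 else b powr a)"

definition rpow_defined :: "real \<Rightarrow> real \<Rightarrow> bool" where
  "rpow_defined b a \<longleftrightarrow> b > 0 \<or> (b = 0 \<and> a > 0) \<or> a = 0"

definition kern :: "real \<Rightarrow> real \<Rightarrow> real \<Rightarrow> real \<Rightarrow> real \<Rightarrow> real" where
  "kern \<tau> c0 \<beta> \<gamma> x =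
     x powr (- \<tau>) * (c0 - ln x) powr (- \<beta>) * rpow (c0 + ln (c0 - ln x)) (- \<gamma>)"

text \<open>
  The weakly singular kernel is evaluated at \<open>k 0\<close> on the diagonal, which for each \<open>t\<close> is a
  single point \<open>x\<close> and does not affect the operator.
\<close>

definition kernel_WS :: "(real \<Rightarrow> real) \<Rightarrow> real \<Rightarrow> real \<Rightarrow> real" where
  "kernel_WS k t x = k \<bar>t - x\<bar>"

definition kernel_VO :: "(real \<Rightarrow> real) \<Rightarrow> real \<Rightarrow> real \<Rightarrow> real" where
  "kernel_VO k t x = (if x < t then k (t - x) else 0)"

text \<open>
  The three cases cover all parameters for which the kernel function is square integrable;
  the final branch is never reached.
\<close>

definition rate :: "nat \<Rightarrow> real \<Rightarrow> real \<Rightarrow> real \<Rightarrow> real" where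
  "rate n \<tau> \<beta> \<gamma> =
    (if 0 < \<tau> \<and> \<tau> < 1/2 then
       real n powr (\<tau> - 1) * log 2 (real n + 1) powr (- \<beta>) * log 2 (log 2 (real n + 3)) powr (- \<gamma>)
     else if \<tau> = 1/2 \<and> \<beta> > 1/2 then
       real n powr (- 1/2) * log 2 (real n + 1) powr (1/2 - \<beta>) * log 2 (log 2 (real n + 3)) powr (- \<gamma>)
     else if \<tau> = 1/2 \<and> \<beta> = 1/2 \<and> \<gamma> > 1/2 then
       real n powr (- 1/2) * log 2 (log 2 (real n + 3)) powr (1/2 - \<gamma>)
     else 0)"

end

theory Submission
  imports Defs "HOL-Real_Asymp.Real_Asymp"
begin

text \<open>
  Write \<open>K\<^sub>t = K(t, _)\<close>, so that \<open>(T f)(t)\<close> is the inner product of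
  \<open>f\<close> with \<open>K\<^sub>t\<close>, and let \<open>\<omega>(h)\<close> dominate the
  \<open>L\<^sub>2\<close> distances between \<open>K\<^sub>s\<close> and \<open>K\<^sub>t\<close> for
  \<open>\<bar>s - t\<bar> \<le> h\<close>. The claim splits into an operator theoretic half, which
  bounds both kinds of numbers by a multiple of \<open>\<surd>q \<omega>(1/n) / \<surd>n\<close>, and a
  computation of \<open>\<omega>\<close>.

  Kolmogorov numbers. Replacing \<open>(T f)(t)\<close> by the value of \<open>T f\<close> at the left
  end of the cell of length \<open>1/n\<close> that contains \<open>t\<close> costs \<open>n + 1\<close>
  dimensions. The remainder is again an integral operator, whose kernel now has \<open>L\<^sub>2\<close>
  norm at most \<open>\<omega>(1/n)\<close> in every \<open>t\<close>. The remaining factor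
  \<open>\<surd>q / \<surd>n\<close> comes from the theorem of Pajor and Tomczak-Jaegermann: an operator
  \<open>R\<close> from a Hilbert space to \<open>Y\<close> has Kolmogorov numbers at most a constant
  times \<open>1/\<surd>n\<close> times the mean norm of the image of a random vector. It holds in the
  form \<open>low_dimensional_approximation\<close> for vectors with random signs as coordinates; the
  approximating subspace is spanned by the images of \<open>n\<close> such vectors. By duality one has
  to show that a functional which vanishes on that subspace has a small adjoint image, and this follows
  from symmetrization and contraction together with the lower Khintchine inequality. In
  \<open>L\<^sub>q\<close> the mean norm is at most \<open>3 \<surd>q\<close> times the bound on the
  kernel (\<open>sign_rows_mean_Lp_norm\<close>). Random signs need a finite basis, which Gram-Schmidt
  orthonormalization supplies once \<open>T\<close> is sampled on a much finer grid.

  Entropy numbers. These follow from the Kolmogorov approximations by Carl's argument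
  (\<open>carl_covering\<close>): chain approximations from spaces of dimension \<open>2\<^sup>j\<close>
  and cover the differences by nets. The nets are small because a \<open>t\<close>-separated subset of a
  \<open>d\<close>-dimensional unit ball has at most \<open>(4/t)\<^sup>d\<close> points
  (\<open>packing_bound\<close>).

  The modulus. For a decreasing \<open>k\<close> the inequality \<open>(a - b)\<^sup>2 \<le> a\<^sup>2 -
  b\<^sup>2\<close>, valid for \<open>a \<ge> b \<ge> 0\<close>, makes the integral of the squared
  difference of two translates telescope. Thus \<open>\<omega>(h)\<^sup>2 = 8 \<Psi>(h)\<close> with
  \<open>\<Psi>(h) = \<integral>\<^sub>0\<^sup>h k\<^sup>2\<close> is admissible in both cases (WS) and
  (VO), and \<open>\<Psi>\<close> is estimated by comparing \<open>k\<^sup>2\<close> with the derivative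
  of a product of powers of \<open>x\<close>, \<open>c\<^sub>0 - ln x\<close> and \<open>c\<^sub>0 + ln
  (c\<^sub>0 - ln x)\<close>. The three cases of the rate are the three ways in which such a product can
  be chosen.
\<close>

section \<open>Sublinear functionals on finite sequences\<close>

text \<open>
  The dimension \<open>m\<close> of the sequence space varies inside the main proofs, so a vector is a
  function on \<^typ>\<open>nat\<close> of which only the first \<open>m\<close> values matter.
\<close>

definition sublinear :: "((nat \<Rightarrow> real) \<Rightarrow> real) \<Rightarrow> bool" where
  "sublinear p \<longleftrightarrow> (\<forall>b c. p (\<lambda>k. b k + c k) \<le> p b + p c) \<and>
     (\<forall>t\<ge>0. \<forall>b. p (\<lambda>k. t * b k) = t * p b)"

lemma sublinear_add: "sublinear p \<Longrightarrow> p (\<lambda>k. b k + c k) \<le> p b + p c"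
  and sublinear_scale: "sublinear p \<Longrightarrow> 0 \<le> t \<Longrightarrow> p (\<lambda>k. t * b k) = t * p b"
  by (simp_all add: sublinear_def)

lemma sublinear_zero: "sublinear p \<Longrightarrow> p (\<lambda>_. 0) = 0"
  using sublinear_scale[of p 0 "\<lambda>_. 0"] by simp

lemma sublinear_neg: "sublinear p \<Longrightarrow> - p (\<lambda>k. - b k) \<le> p b"
  using sublinear_add[of p b "\<lambda>k. - b k"] sublinear_zero[of p] by simp

lemma sublinear_below_linear:
  assumes "sublinear q" "\<And>b. q b \<le> p b" "p (\<lambda>k. - w k) = - p w"
  shows "q w = p w" "q (\<lambda>k. - w k) = - q w"
  using sublinear_neg[OF assms(1), of w] assms(2)[of w] assms(2)[of "\<lambda>k. - w k"] assms(3)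
  by linarith+

text \<open>
  One step of the Hahn-Banach theorem. The functional that takes \<open>b\<close> to the infimum of
  \<open>p (b + t v) - t p(v)\<close> over \<open>t \<ge> 0\<close> is sublinear and lies below
  \<open>p\<close>. The choice \<open>t = 1\<close> shows that its value at \<open>- v\<close> is at
  most \<open>- p(v)\<close>, which makes it odd along \<open>v\<close>.
\<close>

lemma sublinear_linear_along:
  assumes p: "sublinear p"
  obtains q where "sublinear q" "\<And>b. q b \<le> p b" "q (\<lambda>k. - v k) = - q v" "q v = p v"
proof -
  define r where "r b t = p (\<lambda>k. b k + t * v k) - t * p v" for b t
  define q where "q b = (INF t\<in>{0..}. r b t)" for b
  have low: "- p (\<lambda>k. - b k) \<le> r b t" if "t \<ge> 0" for b t
    using sublinear_add[OF p, of "\<lambda>k. b k + t * v k" "\<lambda>k. - b k"] sublinear_scale[OF p that, of v]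
    by (simp add: r_def)
  have bdd: "bdd_below (r b ` {0..})" for b
    using low by (intro bdd_belowI2) auto
  have q_le: "q b \<le> r b t" if "t \<ge> 0" for b t
    unfolding q_def using bdd that by (intro cINF_lower) auto
  have q_ge: "x \<le> q b" if "\<And>t. t \<ge> 0 \<Longrightarrow> x \<le> r b t" for b x
    unfolding q_def using that by (intro cINF_greatest) auto
  have add: "q (\<lambda>k. b k + c k) \<le> q b + q c" for b c
  proof -
    have 1: "q (\<lambda>k. b k + c k) \<le> r b s + r c t" if "s \<ge> 0" "t \<ge> 0" for s t
    proof -
      have "q (\<lambda>k. b k + c k) \<le> r (\<lambda>k. b k + c k) (s + t)" using that by (intro q_le) auto
      also have "\<dots> \<le> r b s + r c t"
        using sublinear_add[OF p, of "\<lambda>k. b k + s * v k" "\<lambda>k. c k + t * v k"]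
        by (simp add: r_def algebra_simps)
      finally show ?thesis .
    qed
    have 2: "q (\<lambda>k. b k + c k) - r b s \<le> q c" if "s \<ge> 0" for s
      using 1[OF that] by (intro q_ge) (simp add: algebra_simps)
    have "q (\<lambda>k. b k + c k) - q c \<le> q b"
      using 2 by (intro q_ge) (simp add: algebra_simps)
    then show ?thesis by simp
  qed
  have zero: "q (\<lambda>_. 0) = 0"
    using sublinear_scale[OF p, of _ v] by (simp add: q_def r_def)
  have scale_le: "q (\<lambda>k. t * b k) \<le> t * q b" if "t > 0" for t b
  proof -
    have "q (\<lambda>k. t * b k) / t \<le> r b s" if "s \<ge> 0" for s
    proof -
      have "q (\<lambda>k. t * b k) \<le> r (\<lambda>k. t * b k) (t * s)" using that \<open>t > 0\<close> by (intro q_le) auto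
      also have "\<dots> = t * r b s"
        using sublinear_scale[OF p, of t "\<lambda>k. b k + s * v k"] \<open>t > 0\<close>
        by (simp add: r_def algebra_simps)
      finally show ?thesis using \<open>t > 0\<close> by (simp add: field_simps)
    qed
    then have "q (\<lambda>k. t * b k) / t \<le> q b" by (rule q_ge)
    then show ?thesis using that by (simp add: field_simps)
  qed
  have scale: "q (\<lambda>k. t * b k) = t * q b" if "t \<ge> 0" for t b
  proof (cases "t = 0")
    case True
    then show ?thesis using zero by simp
  next
    case False
    then have "t > 0" using that by simp
    moreover have "q b \<le> q (\<lambda>k. t * b k) / t"
      using scale_le[of "1 / t" "\<lambda>k. t * b k"] \<open>t > 0\<close> by simp
    ultimately show ?thesis using scale_le[of t b] by (simp add: field_simps)
  qed
  have q: "sublinear q" unfolding sublinear_def using add scale by blast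
  have le: "q b \<le> p b" for b using q_le[of 0 b] by (simp add: r_def)
  have "q (\<lambda>k. - v k) \<le> - p v"
    using q_le[of 1 "\<lambda>k. - v k"] sublinear_zero[OF p] by (simp add: r_def)
  then have "q v = p v" "q (\<lambda>k. - v k) = - q v"
    using sublinear_neg[OF q, of v] le[of v] by linarith+
  with q le that show ?thesis by blast
qed

text \<open>
  Making \<open>p\<close> odd first along \<open>a\<close>, which fixes the value there, and then along
  the unit vectors leaves a sublinear functional that is odd along each unit vector. Such a functional
  is linear, and its values at the unit vectors are the coordinates \<open>x\<close>.
\<close>

lemma hahn_banach_coordinates:
  assumes p: "sublinear p"
  obtains x where "\<And>b. (\<Sum>k<m. b k * x k) \<le> p (\<lambda>k. if k < m then b k else 0)"
    "(\<Sum>k<m. a k * x k) = p (\<lambda>k. if k < m then a k else 0)"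
proof -
  define a' where "a' = (\<lambda>k. if k < m then a k else 0)"
  define e :: "nat \<Rightarrow> nat \<Rightarrow> real" where "e i = (\<lambda>k. if k = i then 1 else 0)" for i
  obtain q0 where q0: "sublinear q0" "\<And>b. q0 b \<le> p b" "q0 (\<lambda>k. - a' k) = - q0 a'" "q0 a' = p a'"
    using sublinear_linear_along[OF p] by blast
  have "\<exists>q. sublinear q \<and> (\<forall>b. q b \<le> q0 b) \<and> (\<forall>i<j. q (\<lambda>k. - e i k) = - q (e i))" for j
  proof (induction j)
    case 0
    show ?case using q0(1) by auto
  next
    case (Suc j)
    then obtain q where q: "sublinear q" "\<And>b. q b \<le> q0 b" "\<And>i. i < j \<Longrightarrow> q (\<lambda>k. - e i k) = - q (e i)"
      by blast
    obtain q' where q': "sublinear q'" "\<And>b. q' b \<le> q b" "q' (\<lambda>k. - e j k) = - q' (e j)"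
      using sublinear_linear_along[OF q(1), of "e j"] by blast
    have "q' (\<lambda>k. - e i k) = - q' (e i)" if "i < Suc j" for i
      using sublinear_below_linear(2)[OF q'(1,2) q(3)] q'(3) that by (cases "i = j") auto
    then show ?case using q'(1,2) q(2) order_trans by blast
  qed
  then obtain q where q: "sublinear q" "\<And>b. q b \<le> q0 b" "\<And>i. i < m \<Longrightarrow> q (\<lambda>k. - e i k) = - q (e i)"
    by blast
  have sc: "q (\<lambda>k. c * e i k) = c * q (e i)" if "i < m" for c i
  proof (cases "c \<ge> 0")
    case False
    have "q (\<lambda>k. (- c) * (- e i k)) = (- c) * q (\<lambda>k. - e i k)"
      using False by (intro sublinear_scale[OF q(1)]) simp
    then show ?thesis using q(3)[OF that] by simp
  qed (simp add: sublinear_scale[OF q(1)])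
  have lin: "q (\<lambda>k. if k < j then b k else 0) = (\<Sum>k<j. b k * q (e k))" if "j \<le> m" for j b
    using that
  proof (induction j)
    case 0
    then show ?case using sublinear_zero[OF q(1)] by simp
  next
    case (Suc j)
    define w where "w = (\<lambda>k. if k < j then b k else 0)"
    have eq: "(\<lambda>k. if k < Suc j then b k else 0) = (\<lambda>k. w k + b j * e j k)"
      by (auto simp: w_def e_def fun_eq_iff less_Suc_eq)
    have w: "w = (\<lambda>k. (w k + b j * e j k) + (- b j) * e j k)" by (auto simp: fun_eq_iff)
    have "q w \<le> q (\<lambda>k. w k + b j * e j k) + (- b j) * q (e j)"
      using sublinear_add[OF q(1), of "\<lambda>k. w k + b j * e j k" "\<lambda>k. (- b j) * e j k"] w sc[of j "- b j"] Suc.prems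
      by simp
    moreover have "q (\<lambda>k. w k + b j * e j k) \<le> q w + b j * q (e j)"
      using sublinear_add[OF q(1), of w "\<lambda>k. b j * e j k"] sc[of j "b j"] Suc.prems by simp
    ultimately have "q (\<lambda>k. w k + b j * e j k) = q w + b j * q (e j)" by simp
    then show ?case using Suc by (simp add: eq w_def)
  qed
  have "q a' = p a'" using sublinear_below_linear(1)[OF q(1,2) q0(3)] q0(4) by simp
  show ?thesis
  proof
    fix b :: "nat \<Rightarrow> real"
    show "(\<Sum>k<m. b k * q (e k)) \<le> p (\<lambda>k. if k < m then b k else 0)"
      using lin[of m b] q(2)[of "\<lambda>k. if k < m then b k else 0"] q0(2)[of "\<lambda>k. if k < m then b k else 0"]
      by simp
  next
    show "(\<Sum>k<m. a k * q (e k)) = p (\<lambda>k. if k < m then a k else 0)"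
      using lin[of m a] \<open>q a' = p a'\<close> by (simp add: a'_def)
  qed
qed

section \<open>Averages over signs\<close>

abbreviation dot :: "nat \<Rightarrow> (nat \<Rightarrow> real) \<Rightarrow> (nat \<Rightarrow> real) \<Rightarrow> real" where
  "dot m \<phi> x \<equiv> \<Sum>k<m. \<phi> k * x k"

text \<open>
  The expectation over independent random signs in the first \<open>m\<close> coordinates, the others
  being \<open>0\<close>; \<open>sign_rows_mean\<close> is the expectation over lists of
  \<open>n\<close> independent such vectors. The recursion turns statements about expectations into
  inductions that treat one sign at a time.
\<close>

primrec sign_mean :: "nat \<Rightarrow> ((nat \<Rightarrow> real) \<Rightarrow> real) \<Rightarrow> real" where
  "sign_mean 0 F = F (\<lambda>_. 0)"
| "sign_mean (Suc m) F =
     (sign_mean m (\<lambda>\<phi>. F (\<phi>(m := 1))) + sign_mean m (\<lambda>\<phi>. F (\<phi>(m := -1)))) / 2"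

primrec sign_rows_mean :: "nat \<Rightarrow> nat \<Rightarrow> ((nat \<Rightarrow> real) list \<Rightarrow> real) \<Rightarrow> real" where
  "sign_rows_mean m 0 F = F []"
| "sign_rows_mean m (Suc n) F = sign_mean m (\<lambda>\<phi>. sign_rows_mean m n (\<lambda>l. F (\<phi> # l)))"

lemma sign_mean_add: "sign_mean m (\<lambda>\<phi>. F \<phi> + G \<phi>) = sign_mean m F + sign_mean m G"
  by (induction m arbitrary: F G) (simp_all add: field_simps)

lemma sign_mean_cmult: "sign_mean m (\<lambda>\<phi>. c * F \<phi>) = c * sign_mean m F"
  by (induction m arbitrary: F) (simp_all add: field_simps)

lemma sign_mean_const: "sign_mean m (\<lambda>\<phi>. c) = c"
  by (induction m) (simp_all add: field_simps)

lemma sign_mean_mono: "(\<And>\<phi>. F \<phi> \<le> G \<phi>) \<Longrightarrow> sign_mean m F \<le> sign_mean m G"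
  by (induction m arbitrary: F G) (simp_all add: add_mono divide_right_mono)

lemma sign_mean_diff: "sign_mean m (\<lambda>\<phi>. F \<phi> - G \<phi>) = sign_mean m F - sign_mean m G"
  using sign_mean_add[of m F "\<lambda>\<phi>. (-1) * G \<phi>"] sign_mean_cmult[of m "-1" G] by simp

lemma sign_mean_half: "sign_mean m (\<lambda>\<phi>. F \<phi> / 2) = sign_mean m F / 2"
  using sign_mean_cmult[of m "1/2" F] by simp

lemma sign_mean_uminus: "sign_mean m (\<lambda>\<phi>. F (\<lambda>k. - \<phi> k)) = sign_mean m F"
proof (induction m arbitrary: F)
  case (Suc m)
  have "(\<lambda>k. - (\<phi>(m := c)) k) = (\<lambda>k. - \<phi> k)(m := - c)" for \<phi> :: "nat \<Rightarrow> real" and c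
    by auto
  then show ?case using Suc[of "\<lambda>\<phi>. F (\<phi>(m := 1))"] Suc[of "\<lambda>\<phi>. F (\<phi>(m := -1))"] by simp
qed simp

lemma sign_mean_swap:
  "sign_mean m (\<lambda>\<phi>. sign_mean m' (\<lambda>\<psi>. F \<phi> \<psi>)) = sign_mean m' (\<lambda>\<psi>. sign_mean m (\<lambda>\<phi>. F \<phi> \<psi>))"
  by (induction m arbitrary: F) (simp_all add: sign_mean_add sign_mean_half)

lemma sign_rows_mean_swap:
  "sign_mean m (\<lambda>\<phi>. sign_rows_mean m n (\<lambda>l. F \<phi> l)) = sign_rows_mean m n (\<lambda>l. sign_mean m (\<lambda>\<phi>. F \<phi> l))"
proof (induction n arbitrary: F)
  case (Suc n)
  have "sign_mean m (\<lambda>\<phi>. sign_rows_mean m (Suc n) (F \<phi>))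
      = sign_mean m (\<lambda>\<psi>. sign_mean m (\<lambda>\<phi>. sign_rows_mean m n (\<lambda>l. F \<phi> (\<psi> # l))))"
    unfolding sign_rows_mean.simps by (rule sign_mean_swap)
  then show ?case by (simp add: Suc)
qed simp

lemma sign_rows_mean_mono: "(\<And>l. F l \<le> G l) \<Longrightarrow> sign_rows_mean m n F \<le> sign_rows_mean m n G"
  by (induction n arbitrary: F G) (simp_all add: sign_mean_mono)

lemma sign_rows_mean_add: "sign_rows_mean m n (\<lambda>l. F l + G l) = sign_rows_mean m n F + sign_rows_mean m n G"
  by (induction n arbitrary: F G) (simp_all add: sign_mean_add)

lemma sign_rows_mean_cmult: "sign_rows_mean m n (\<lambda>l. c * F l) = c * sign_rows_mean m n F"
  by (induction n arbitrary: F) (simp_all add: sign_mean_cmult)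

lemma sign_rows_mean_const: "sign_rows_mean m n (\<lambda>l. c) = c"
  by (induction n) (simp_all add: sign_mean_const)

lemma sign_mean_attained: "\<exists>\<phi>. F \<phi> \<le> sign_mean m F"
proof (induction m arbitrary: F)
  case (Suc m)
  show ?case
  proof (cases "sign_mean m (\<lambda>\<phi>. F (\<phi>(m := 1))) \<le> sign_mean m (\<lambda>\<phi>. F (\<phi>(m := -1)))")
    case True
    obtain \<phi> where "F (\<phi>(m := 1)) \<le> sign_mean m (\<lambda>\<phi>. F (\<phi>(m := 1)))" using Suc[of "\<lambda>\<phi>. F (\<phi>(m := 1))"] by blast
    then show ?thesis using True by (intro exI[of _ "\<phi>(m := 1)"]) (simp del: fun_upd_apply)
  next
    case False
    obtain \<phi> where "F (\<phi>(m := -1)) \<le> sign_mean m (\<lambda>\<phi>. F (\<phi>(m := -1)))" using Suc[of "\<lambda>\<phi>. F (\<phi>(m := -1))"] by blast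
    then show ?thesis using False by (intro exI[of _ "\<phi>(m := -1)"]) (simp del: fun_upd_apply)
  qed
qed auto

lemma sign_rows_mean_attained: "\<exists>l. length l = n \<and> F l \<le> sign_rows_mean m n F"
proof (induction n arbitrary: F)
  case (Suc n)
  obtain \<phi> where \<phi>: "sign_rows_mean m n (\<lambda>l. F (\<phi> # l)) \<le> sign_rows_mean m (Suc n) F"
    using sign_mean_attained[of "\<lambda>\<phi>. sign_rows_mean m n (\<lambda>l. F (\<phi> # l))" m] by auto
  obtain l where "length l = n" "F (\<phi> # l) \<le> sign_rows_mean m n (\<lambda>l. F (\<phi> # l))"
    using Suc[of "\<lambda>l. F (\<phi> # l)"] by auto
  then show ?case using \<phi> by (intro exI[of _ "\<phi> # l"]) auto
qed simp

section \<open>Moments of sign sums\<close>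

lemma sign_mean_square: "sign_mean m (\<lambda>\<phi>. (dot m \<phi> x)\<^sup>2) = (\<Sum>k<m. (x k)\<^sup>2)"
proof (induction m)
  case (Suc m)
  define X where "X = (\<lambda>\<phi>. dot m \<phi> x)"
  have "sign_mean (Suc m) (\<lambda>\<phi>. (\<Sum>k<Suc m. \<phi> k * x k)\<^sup>2)
     = (sign_mean m (\<lambda>\<phi>. (X \<phi> + x m)\<^sup>2) + sign_mean m (\<lambda>\<phi>. (X \<phi> - x m)\<^sup>2)) / 2"
    by (simp add: X_def)
  also have "\<dots> = sign_mean m (\<lambda>\<phi>. (X \<phi>)\<^sup>2 + (x m)\<^sup>2)"
    unfolding sign_mean_add[symmetric] sign_mean_half[symmetric]
    by (rule arg_cong[where f = "sign_mean m"]) (auto simp: fun_eq_iff power2_eq_square field_simps)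
  finally show ?case using Suc by (simp add: sign_mean_add sign_mean_const X_def)
qed simp

lemma sign_mean_fourth: "sign_mean m (\<lambda>\<phi>. (dot m \<phi> x)^4) \<le> 3 * (\<Sum>k<m. (x k)\<^sup>2)\<^sup>2"
proof (induction m)
  case (Suc m)
  define X where "X = (\<lambda>\<phi>. dot m \<phi> x)"
  define s where "s = (\<Sum>k<m. (x k)\<^sup>2)"
  have "sign_mean (Suc m) (\<lambda>\<phi>. (\<Sum>k<Suc m. \<phi> k * x k)^4)
     = (sign_mean m (\<lambda>\<phi>. (X \<phi> + x m)^4) + sign_mean m (\<lambda>\<phi>. (X \<phi> - x m)^4)) / 2"
    by (simp add: X_def)
  also have "\<dots> = sign_mean m (\<lambda>\<phi>. (X \<phi>)^4 + (6 * (x m)\<^sup>2 * (X \<phi>)\<^sup>2 + (x m)^4))"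
    unfolding sign_mean_add[symmetric] sign_mean_half[symmetric]
    by (rule arg_cong[where f = "sign_mean m"]) (auto simp: fun_eq_iff power2_eq_square power4_eq_xxxx field_simps)
  also have "\<dots> = sign_mean m (\<lambda>\<phi>. (X \<phi>)^4) + 6 * (x m)\<^sup>2 * s + (x m)^4"
    using sign_mean_square[of m x]
    by (simp add: sign_mean_add sign_mean_const sign_mean_cmult X_def s_def)
  also have "\<dots> \<le> 3 * s\<^sup>2 + 6 * (x m)\<^sup>2 * s + 3 * (x m)^4"
    using Suc zero_le_even_power[of 4 "x m"] unfolding X_def s_def
    by (intro add_mono) auto
  also have "\<dots> = 3 * (s + (x m)\<^sup>2)\<^sup>2"
    by (simp add: power2_eq_square power4_eq_xxxx algebra_simps)
  finally show ?case by (simp add: s_def)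
qed simp

text \<open>
  The second moment is \<open>s\<^sup>2 = \<Sum>x\<^sub>k\<^sup>2\<close> and the fourth at most
  \<open>3 s\<^sup>4\<close>, so the first moment cannot be small: \<open>t\<^sup>2 - t\<^sup>4 \<le>
  t/2\<close> for \<open>t \<ge> 0\<close>, applied to the sum divided by \<open>\<surd>6 s\<close>.
\<close>

lemma khintchine_lower:
  "sqrt (\<Sum>k<m. (x k)\<^sup>2) \<le> 3 * sign_mean m (\<lambda>\<phi>. \<bar>dot m \<phi> x\<bar>)"
proof (cases "(\<Sum>k<m. (x k)\<^sup>2) = 0")
  case True
  have "0 \<le> sign_mean m (\<lambda>\<phi>. \<bar>dot m \<phi> x\<bar>)"
    using sign_mean_mono[of "\<lambda>_. 0"] by (simp add: sign_mean_const)
  then show ?thesis using True by simp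
next
  case False
  define S where "S = sqrt (\<Sum>k<m. (x k)\<^sup>2)"
  have S: "S > 0" using False sum_nonneg[of "{..<m}" "\<lambda>k. (x k)\<^sup>2"] by (simp add: S_def less_le)
  have S2: "S\<^sup>2 = (\<Sum>k<m. (x k)\<^sup>2)" by (simp add: S_def sum_nonneg)
  have 1: "t\<^sup>2 - t^4 \<le> t / 2" if "t \<ge> 0" for t :: real
  proof -
    have "0 \<le> (t - 1/2)\<^sup>2 * (t + 1)" using that by simp
    also have "(t - 1/2)\<^sup>2 * (t + 1) = t^3 - 3/4 * t + 1/4"
      by (simp add: power2_eq_square power3_eq_cube field_simps)
    finally have "0 \<le> t^3 - 3/4 * t + 1/4" .
    then have "t - t^3 \<le> 1/2 \<or> t > 1" by linarith
    then have "t - t^3 \<le> 1/2"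
    proof
      assume "t > 1"
      then have "t * 1 \<le> t * (t * t)" using mult_mono[of 1 t 1 t] by (intro mult_left_mono) auto
      then show ?thesis by (simp add: power3_eq_cube)
    qed
    then have "t * (t - t^3) \<le> t * (1/2)" using that by (intro mult_left_mono)
    then show ?thesis by (simp add: power2_eq_square power3_eq_cube power4_eq_xxxx algebra_simps)
  qed
  have 2: "u\<^sup>2 / (6 * S\<^sup>2) - u^4 / (36 * S^4) \<le> \<bar>u\<bar> / (2 * (sqrt 6 * S))" for u
  proof -
    have "sqrt 6 ^ 4 = (36::real)"
      using real_sqrt_pow2[of 6] by (simp add: power4_eq_xxxx power2_eq_square)
    then show ?thesis
      using 1[of "\<bar>u\<bar> / (sqrt 6 * S)"] S by (simp add: power_divide power_mult_distrib)
  qed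
  have "1 / 12 \<le> sign_mean m (\<lambda>\<phi>. (dot m \<phi> x)\<^sup>2) / (6 * S\<^sup>2) - sign_mean m (\<lambda>\<phi>. (dot m \<phi> x)^4) / (36 * S^4)"
  proof -
    have "sign_mean m (\<lambda>\<phi>. (dot m \<phi> x)^4) / (36 * S^4) \<le> (3 * S^4) / (36 * S^4)"
      using sign_mean_fourth[of m x] S2[symmetric] S
      by (intro divide_right_mono) (simp_all flip: power_mult)
    also have "\<dots> = 1 / 12" using S by simp
    also have "(1::real) / 12 = S\<^sup>2 / (6 * S\<^sup>2) - 1 / 12" using S by simp
    finally show ?thesis unfolding sign_mean_square S2[symmetric] by linarith
  qed
  also have "\<dots> = sign_mean m (\<lambda>\<phi>. (1 / (6 * S\<^sup>2)) * (dot m \<phi> x)\<^sup>2 - (1 / (36 * S^4)) * (dot m \<phi> x)^4)"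
    by (simp only: sign_mean_diff sign_mean_cmult) simp
  also have "\<dots> \<le> sign_mean m (\<lambda>\<phi>. (1 / (2 * (sqrt 6 * S))) * \<bar>dot m \<phi> x\<bar>)"
    using 2 by (intro sign_mean_mono) simp
  also have "\<dots> = sign_mean m (\<lambda>\<phi>. \<bar>dot m \<phi> x\<bar>) / (2 * (sqrt 6 * S))"
    by (simp only: sign_mean_cmult) simp
  finally have "sqrt 6 * S \<le> 6 * sign_mean m (\<lambda>\<phi>. \<bar>dot m \<phi> x\<bar>)"
    using S by (simp add: field_simps)
  moreover have "2 * S \<le> sqrt 6 * S" using S by (intro mult_right_mono) (auto intro: real_le_rsqrt)
  ultimately show ?thesis unfolding S_def[symmetric] by linarith
qed

text \<open>
  Comparison of power series, since \<open>2\<^sup>n n! \<le> (2n)!\<close>.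
\<close>

lemma cosh_le_exp_half_square: "cosh x \<le> exp (x\<^sup>2 / 2)" for x :: real
proof -
  have f: "2 ^ n * fact n \<le> (fact (2 * n) :: real)" for n
  proof (induction n)
    case (Suc n)
    have "2 ^ Suc n * fact (Suc n) = (2 * real (Suc n)) * (2 ^ n * fact n)" by simp
    also have "\<dots> \<le> (2 * real (Suc n)) * ((2 * n + 1) * fact (2 * n))"
      using Suc mult_mono[of 1 "2 * real n + 1" "2 ^ n * fact n" "fact (2 * n)"]
      by (intro mult_left_mono) (auto simp: algebra_simps)
    also have "\<dots> = fact (2 * Suc n)" by (simp add: algebra_simps)
    finally show ?case .
  qed simp
  have "(\<lambda>n. if even n then x ^ n /\<^sub>R fact n else 0) sums cosh x" by (rule cosh_converges)
  then have c: "(\<lambda>n. x ^ (2 * n) /\<^sub>R fact (2 * n)) sums cosh x"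
    using sums_mono_reindex[of "\<lambda>n. 2 * n" "\<lambda>n. if even n then x ^ n /\<^sub>R fact n else 0" "cosh x"]
    by (simp add: strict_mono_def image_iff) (metis dvdE)
  have e: "(\<lambda>n. (x\<^sup>2 / 2) ^ n /\<^sub>R fact n) sums exp (x\<^sup>2 / 2)" by (rule exp_converges)
  have "x ^ (2 * n) /\<^sub>R fact (2 * n) \<le> (x\<^sup>2 / 2) ^ n /\<^sub>R fact n" for n
  proof -
    have "(x\<^sup>2) ^ n / fact (2 * n) \<le> (x\<^sup>2) ^ n / (2 ^ n * fact n)"
      using f[of n] by (intro divide_left_mono) auto
    moreover have "x ^ (2 * n) /\<^sub>R fact (2 * n) = (x\<^sup>2) ^ n / fact (2 * n)"
      by (simp only: power_mult[of x 2 n] real_scaleR_def divide_inverse mult.commute[of "inverse _"])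
    moreover have "(x\<^sup>2 / 2) ^ n /\<^sub>R fact n = (x\<^sup>2) ^ n / (2 ^ n * fact n)"
      unfolding power_divide by (simp add: divide_inverse)
    ultimately show ?thesis by simp
  qed
  then show ?thesis by (rule sums_le[OF _ c e])
qed

lemma sign_mean_exp:
  "sign_mean m (\<lambda>\<phi>. exp (dot m \<phi> x)) \<le> exp ((\<Sum>k<m. (x k)\<^sup>2) / 2)"
proof (induction m)
  case (Suc m)
  define X where "X = (\<lambda>\<phi>. dot m \<phi> x)"
  have "sign_mean (Suc m) (\<lambda>\<phi>. exp (\<Sum>k<Suc m. \<phi> k * x k))
     = (sign_mean m (\<lambda>\<phi>. exp (X \<phi> + x m)) + sign_mean m (\<lambda>\<phi>. exp (X \<phi> - x m))) / 2"
    by (simp add: X_def)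
  also have "\<dots> = sign_mean m (\<lambda>\<phi>. cosh (x m) * exp (X \<phi>))"
    unfolding sign_mean_add[symmetric] sign_mean_half[symmetric]
    by (rule arg_cong[where f = "sign_mean m"]) (auto simp: fun_eq_iff cosh_field_def exp_add exp_diff exp_minus field_simps)
  also have "\<dots> = cosh (x m) * sign_mean m (\<lambda>\<phi>. exp (X \<phi>))" by (rule sign_mean_cmult)
  also have "\<dots> \<le> exp ((x m)\<^sup>2 / 2) * exp ((\<Sum>k<m. (x k)\<^sup>2) / 2)"
    using Suc cosh_le_exp_half_square[of "x m"] sign_mean_mono[of "\<lambda>_. 0" "\<lambda>\<phi>. exp (X \<phi>)" m]
    by (intro mult_mono) (auto simp: X_def sign_mean_const)
  finally show ?case by (simp add: exp_add[symmetric] add_divide_distrib add.commute)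
qed simp

lemma sign_mean_nonneg: "(\<And>\<phi>. 0 \<le> F \<phi>) \<Longrightarrow> 0 \<le> sign_mean m F"
  using sign_mean_mono[of "\<lambda>_. 0" F m] by (simp add: sign_mean_const)

lemma sign_rows_mean_exp:
  "sign_rows_mean m n (\<lambda>l. exp (\<Sum>\<phi>\<leftarrow>l. dot m \<phi> x)) \<le> exp (n * (\<Sum>k<m. (x k)\<^sup>2) / 2)"
proof (induction n)
  case (Suc n)
  define R where "R = sign_rows_mean m n (\<lambda>l. exp (\<Sum>\<phi>\<leftarrow>l. dot m \<phi> x))"
  have "sign_rows_mean m (Suc n) (\<lambda>l. exp (\<Sum>\<phi>\<leftarrow>l. dot m \<phi> x))
     = sign_mean m (\<lambda>\<phi>. R * exp (dot m \<phi> x))"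
    unfolding R_def sign_rows_mean.simps list.map sum_list.Cons exp_add sign_rows_mean_cmult
    by (rule arg_cong[where f = "sign_mean m"]) (rule ext, rule mult.commute)
  also have "\<dots> = R * sign_mean m (\<lambda>\<phi>. exp (dot m \<phi> x))" by (rule sign_mean_cmult)
  also have "\<dots> \<le> exp (n * (\<Sum>k<m. (x k)\<^sup>2) / 2) * exp ((\<Sum>k<m. (x k)\<^sup>2) / 2)"
    using Suc sign_mean_exp[of m x] by (intro mult_mono sign_mean_nonneg) (simp_all add: R_def)
  also have "\<dots> = exp (Suc n * (\<Sum>k<m. (x k)\<^sup>2) / 2)"
    unfolding exp_add[symmetric] by (simp add: add_divide_distrib distrib_right)
  finally show ?case .
qed simp

section \<open>Symmetrization\<close>

text \<open>
  With \<open>\<psi>\<close> an independent copy of \<open>\<phi>\<close>, the left side is at most the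
  mean of the supremum of \<open>\<bar>u(\<psi>, x)\<bar> - \<bar>u(\<phi>, x)\<bar> + h(x)\<close>.
  Averaging this with the same expression for \<open>\<phi>\<close> and \<open>\<psi>\<close> exchanged
  gives a supremum over two points \<open>x\<close> and \<open>y\<close> that separates the two sign
  vectors: the contribution of \<open>\<phi>\<close> is \<open>\<bar>u(\<phi>, y)\<bar> -
  \<bar>u(\<phi>, x)\<bar>\<close>, at most \<open>\<bar>u(\<phi>, y - x)\<bar>\<close>, and since
  \<open>x\<close> and \<open>y\<close> enter symmetrically through \<open>h(x) + h(y)\<close>, the
  outer absolute value can be dropped as well. The arbitrary function \<open>h\<close> allows the step
  to be iterated over the rows of a sign matrix.
\<close>

lemma sign_symmetrization_row:
  fixes X :: "(nat \<Rightarrow> real) set" and h :: "(nat \<Rightarrow> real) \<Rightarrow> real" and m :: nat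
  defines "u \<equiv> \<lambda>\<phi> x. dot m \<phi> x"
  assumes ne: "X \<noteq> {}" and bX: "\<And>x k. x \<in> X \<Longrightarrow> k < m \<Longrightarrow> \<bar>x k\<bar> \<le> R"
    and bh: "\<And>x. x \<in> X \<Longrightarrow> h x \<le> H"
  shows "sign_mean m (\<lambda>\<phi>. SUP x\<in>X. sign_mean m (\<lambda>\<psi>. \<bar>u \<psi> x\<bar>) - \<bar>u \<phi> x\<bar> + h x)
    \<le> sign_mean m (\<lambda>\<phi>. SUP x\<in>X. 2 * u \<phi> x + h x)"
proof -
  define \<theta> where "\<theta> x = sign_mean m (\<lambda>\<psi>. \<bar>u \<psi> x\<bar>)" for x
  define b where "b \<phi> = (\<Sum>k<m. \<bar>\<phi> k\<bar> * R)" for \<phi> :: "nat \<Rightarrow> real"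
  define A where "A \<phi> = (SUP x\<in>X. 2 * u \<phi> x + h x)" for \<phi>
  define S where "S \<phi> \<psi> = (SUP x\<in>X. \<bar>u \<psi> x\<bar> - \<bar>u \<phi> x\<bar> + h x)" for \<phi> \<psi>
  have ub: "\<bar>u \<phi> x\<bar> \<le> b \<phi>" if "x \<in> X" for \<phi> x
    unfolding u_def b_def
    by (rule order_trans[OF sum_abs]) (auto intro!: sum_mono mult_left_mono bX that simp: abs_mult)
  have A_ge: "2 * u \<phi> x + h x \<le> A \<phi>" if "x \<in> X" for \<phi> x
    unfolding A_def
  proof (rule cSUP_upper[OF that], rule bdd_aboveI2)
    fix y assume "y \<in> X"
    then show "2 * u \<phi> y + h y \<le> 2 * b \<phi> + H" using ub[of y \<phi>] bh[of y] by linarith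
  qed
  have S_ge: "\<bar>u \<psi> x\<bar> - \<bar>u \<phi> x\<bar> + h x \<le> S \<phi> \<psi>" if "x \<in> X" for \<phi> \<psi> x
    unfolding S_def
  proof (rule cSUP_upper[OF that], rule bdd_aboveI2)
    fix y assume "y \<in> X"
    then show "\<bar>u \<psi> y\<bar> - \<bar>u \<phi> y\<bar> + h y \<le> b \<psi> + H" using ub[of y \<psi>] bh[of y] by linarith
  qed
  have "sign_mean m (\<lambda>\<phi>. SUP x\<in>X. \<theta> x - \<bar>u \<phi> x\<bar> + h x) \<le> sign_mean m (\<lambda>\<phi>. sign_mean m (\<lambda>\<psi>. S \<phi> \<psi>))"
  proof (intro sign_mean_mono cSUP_least ne)
    fix \<phi> x assume x: "x \<in> X"
    have "\<theta> x - \<bar>u \<phi> x\<bar> + h x = sign_mean m (\<lambda>\<psi>. \<bar>u \<psi> x\<bar> + (h x - \<bar>u \<phi> x\<bar>))"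
      by (simp add: sign_mean_add sign_mean_const \<theta>_def)
    also have "\<dots> \<le> sign_mean m (\<lambda>\<psi>. S \<phi> \<psi>)"
    proof (rule sign_mean_mono)
      fix \<psi>
      show "\<bar>u \<psi> x\<bar> + (h x - \<bar>u \<phi> x\<bar>) \<le> S \<phi> \<psi>" using S_ge[OF x, of \<psi> \<phi>] by simp
    qed
    finally show "\<theta> x - \<bar>u \<phi> x\<bar> + h x \<le> sign_mean m (\<lambda>\<psi>. S \<phi> \<psi>)" .
  qed
  also have "\<dots> = sign_mean m (\<lambda>\<phi>. sign_mean m (\<lambda>\<psi>. (S \<phi> \<psi> + S \<psi> \<phi>) / 2))"
    using sign_mean_swap[of m m S] by (simp add: sign_mean_half sign_mean_add)
  also have "\<dots> \<le> sign_mean m (\<lambda>\<phi>. sign_mean m (\<lambda>\<psi>.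
      (A \<psi> + A (\<lambda>k. - \<psi> k)) / 4 + (A \<phi> + A (\<lambda>k. - \<phi> k)) / 4))"
  proof (intro sign_mean_mono)
    fix \<phi> \<psi>
    let ?B = "(A \<psi> + A (\<lambda>k. - \<psi> k)) / 2 + (A \<phi> + A (\<lambda>k. - \<phi> k)) / 2"
    \<comment> \<open>The contraction step, by the two possible signs of \<open>u \<phi> x - u \<phi> y\<close>.\<close>
    have contr: "2 * (\<bar>u \<phi> x\<bar> - \<bar>u \<phi> y\<bar>) + h x + h y \<le> A \<phi> + A (\<lambda>k. - \<phi> k)"
      if "x \<in> X" "y \<in> X" for x y \<phi>
    proof -
      have neg: "u (\<lambda>k. - \<phi> k) z = - u \<phi> z" for z by (simp add: u_def sum_negf)
      show ?thesis
        using A_ge[OF that(1), of \<phi>] A_ge[OF that(2), of \<phi>]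
          A_ge[OF that(1), of "\<lambda>k. - \<phi> k"] A_ge[OF that(2), of "\<lambda>k. - \<phi> k"]
        unfolding neg by (cases "u \<phi> x \<ge> 0"; cases "u \<phi> y \<ge> 0"; cases "u \<phi> x \<ge> u \<phi> y") simp_all
    qed
    have 1: "(\<bar>u \<psi> x\<bar> - \<bar>u \<phi> x\<bar> + h x) + (\<bar>u \<phi> y\<bar> - \<bar>u \<psi> y\<bar> + h y) \<le> ?B"
      if "x \<in> X" "y \<in> X" for x y
      using contr[OF that(1) that(2), of \<psi>] contr[OF that(2) that(1), of \<phi>] by (simp add: field_simps)
    have "S \<psi> \<phi> \<le> ?B - (\<bar>u \<psi> x\<bar> - \<bar>u \<phi> x\<bar> + h x)" if "x \<in> X" for x
      unfolding S_def[of \<psi>]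
    proof (rule cSUP_least[OF ne])
      fix y assume "y \<in> X"
      then show "\<bar>u \<phi> y\<bar> - \<bar>u \<psi> y\<bar> + h y \<le> ?B - (\<bar>u \<psi> x\<bar> - \<bar>u \<phi> x\<bar> + h x)"
        using 1[OF that, of y] by linarith
    qed
    then have "S \<phi> \<psi> \<le> ?B - S \<psi> \<phi>"
      unfolding S_def[of \<phi>] by (intro cSUP_least[OF ne]) (simp add: algebra_simps)
    moreover have "?B / 2 = (A \<psi> + A (\<lambda>k. - \<psi> k)) / 4 + (A \<phi> + A (\<lambda>k. - \<phi> k)) / 4"
      by (simp add: add_divide_distrib)
    ultimately show "(S \<phi> \<psi> + S \<psi> \<phi>) / 2 \<le> (A \<psi> + A (\<lambda>k. - \<psi> k)) / 4 + (A \<phi> + A (\<lambda>k. - \<phi> k)) / 4"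
      by simp
  qed
  also have "\<dots> = sign_mean m A"
  proof -
    have "sign_mean m (\<lambda>\<phi>. (A \<phi> + A (\<lambda>k. - \<phi> k)) / 4) = sign_mean m (\<lambda>\<phi>. (1/4) * A \<phi> + (1/4) * A (\<lambda>k. - \<phi> k))"
      by (simp add: add_divide_distrib)
    also have "\<dots> = sign_mean m A / 2"
      by (simp only: sign_mean_add sign_mean_cmult sign_mean_uminus)
    finally show ?thesis by (simp add: sign_mean_add sign_mean_const)
  qed
  finally show ?thesis unfolding \<theta>_def A_def[abs_def] .
qed

text \<open>
  The rows are replaced one after the other; the terms of all other rows are part of \<open>h\<close>.
\<close>

lemma sign_symmetrization:
  fixes X :: "(nat \<Rightarrow> real) set" and h :: "(nat \<Rightarrow> real) \<Rightarrow> real" and m n :: nat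
  defines "u \<equiv> \<lambda>\<phi> x. dot m \<phi> x"
  assumes ne: "X \<noteq> {}" and bX: "\<And>x k. x \<in> X \<Longrightarrow> k < m \<Longrightarrow> \<bar>x k\<bar> \<le> R"
    and bh: "\<And>x. x \<in> X \<Longrightarrow> h x \<le> H"
  shows "sign_rows_mean m n (\<lambda>l. SUP x\<in>X. (\<Sum>\<phi>\<leftarrow>l. sign_mean m (\<lambda>\<psi>. \<bar>u \<psi> x\<bar>) - \<bar>u \<phi> x\<bar>) + h x)
    \<le> sign_rows_mean m n (\<lambda>l. SUP x\<in>X. 2 * (\<Sum>\<phi>\<leftarrow>l. u \<phi> x) + h x)"
  using bh
proof (induction n arbitrary: h H)
  case 0
  show ?case by simp
next
  case (Suc n)
  define \<theta> where "\<theta> x = sign_mean m (\<lambda>\<psi>. \<bar>u \<psi> x\<bar>)" for x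
  define b where "b \<phi> = (\<Sum>k<m. \<bar>\<phi> k\<bar> * R)" for \<phi> :: "nat \<Rightarrow> real"
  have ub: "\<bar>u \<phi> x\<bar> \<le> b \<phi>" if "x \<in> X" for \<phi> x
    unfolding u_def b_def
    by (rule order_trans[OF sum_abs]) (auto intro!: sum_mono mult_left_mono bX that simp: abs_mult)
  have \<theta>b: "\<theta> x \<le> sign_mean m b" if "x \<in> X" for x
    unfolding \<theta>_def by (intro sign_mean_mono ub that)
  have "sign_rows_mean m (Suc n) (\<lambda>l. SUP x\<in>X. (\<Sum>\<phi>\<leftarrow>l. \<theta> x - \<bar>u \<phi> x\<bar>) + h x)
      = sign_mean m (\<lambda>\<phi>. sign_rows_mean m n (\<lambda>l. SUP x\<in>X. (\<Sum>\<phi>\<leftarrow>l. \<theta> x - \<bar>u \<phi> x\<bar>) + (\<theta> x - \<bar>u \<phi> x\<bar> + h x)))"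
    by (simp add: algebra_simps)
  also have "\<dots> \<le> sign_mean m (\<lambda>\<phi>. sign_rows_mean m n (\<lambda>l. SUP x\<in>X. 2 * (\<Sum>\<phi>\<leftarrow>l. u \<phi> x) + (\<theta> x - \<bar>u \<phi> x\<bar> + h x)))"
  proof (rule sign_mean_mono)
    fix \<phi>
    have "\<theta> x - \<bar>u \<phi> x\<bar> + h x \<le> sign_mean m b + H" if "x \<in> X" for x
      using \<theta>b[OF that] Suc.prems[OF that] by linarith
    then show "sign_rows_mean m n (\<lambda>l. SUP x\<in>X. (\<Sum>\<phi>\<leftarrow>l. \<theta> x - \<bar>u \<phi> x\<bar>) + (\<theta> x - \<bar>u \<phi> x\<bar> + h x))
      \<le> sign_rows_mean m n (\<lambda>l. SUP x\<in>X. 2 * (\<Sum>\<phi>\<leftarrow>l. u \<phi> x) + (\<theta> x - \<bar>u \<phi> x\<bar> + h x))"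
      unfolding \<theta>_def by (rule Suc.IH)
  qed
  also have "\<dots> = sign_rows_mean m n (\<lambda>l. sign_mean m (\<lambda>\<phi>. SUP x\<in>X. \<theta> x - \<bar>u \<phi> x\<bar> + (2 * (\<Sum>\<phi>\<leftarrow>l. u \<phi> x) + h x)))"
    by (subst sign_rows_mean_swap) (simp add: algebra_simps)
  also have "\<dots> \<le> sign_rows_mean m n (\<lambda>l. sign_mean m (\<lambda>\<phi>. SUP x\<in>X. 2 * u \<phi> x + (2 * (\<Sum>\<phi>\<leftarrow>l. u \<phi> x) + h x)))"
  proof (rule sign_rows_mean_mono)
    fix l :: "(nat \<Rightarrow> real) list"
    have bl: "(\<Sum>\<phi>\<leftarrow>l. u \<phi> x) \<le> (\<Sum>\<phi>\<leftarrow>l. b \<phi>)" if "x \<in> X" for x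
      using ub[OF that] by (intro sum_list_mono) (auto intro: order_trans[OF abs_ge_self])
    have "2 * (\<Sum>\<phi>\<leftarrow>l. u \<phi> x) + h x \<le> 2 * (\<Sum>\<phi>\<leftarrow>l. b \<phi>) + H" if "x \<in> X" for x
      using bl[OF that] Suc.prems[OF that] by linarith
    then show "sign_mean m (\<lambda>\<phi>. SUP x\<in>X. \<theta> x - \<bar>u \<phi> x\<bar> + (2 * (\<Sum>\<phi>\<leftarrow>l. u \<phi> x) + h x))
      \<le> sign_mean m (\<lambda>\<phi>. SUP x\<in>X. 2 * u \<phi> x + (2 * (\<Sum>\<phi>\<leftarrow>l. u \<phi> x) + h x))"
      unfolding \<theta>_def u_def using bX ne by (intro sign_symmetrization_row[where R = R and H = "2 * (\<Sum>\<phi>\<leftarrow>l. b \<phi>) + H"]) auto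
  qed
  also have "\<dots> = sign_rows_mean m (Suc n) (\<lambda>l. SUP x\<in>X. 2 * (\<Sum>\<phi>\<leftarrow>l. u \<phi> x) + h x)"
    by (subst sign_rows_mean_swap[symmetric]) (simp add: algebra_simps)
  finally show ?case by (simp add: \<theta>_def)
qed

section \<open>Approximation from random subspaces\<close>

text \<open>
  A seminorm on a carrier, since the \<open>L\<^sub>q\<close> spaces are subspaces of one type of
  functions.
\<close>

definition seminorm_on :: "'b::real_vector set \<Rightarrow> ('b \<Rightarrow> real) \<Rightarrow> bool" where
  "seminorm_on Y nY \<longleftrightarrow> subspace Y \<and> (\<forall>x\<in>Y. 0 \<le> nY x) \<and>
     (\<forall>x\<in>Y. \<forall>y\<in>Y. nY (x + y) \<le> nY x + nY y) \<and> (\<forall>a. \<forall>x\<in>Y. nY (a *\<^sub>R x) = \<bar>a\<bar> * nY x)"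

lemma seminorm_onD:
  assumes "seminorm_on Y nY"
  shows "subspace Y" "x \<in> Y \<Longrightarrow> 0 \<le> nY x" "x \<in> Y \<Longrightarrow> y \<in> Y \<Longrightarrow> nY (x + y) \<le> nY x + nY y"
    "x \<in> Y \<Longrightarrow> nY (a *\<^sub>R x) = \<bar>a\<bar> * nY x" "nY 0 = 0" "x \<in> Y \<Longrightarrow> nY (- x) = nY x"
proof -
  show "subspace Y" "x \<in> Y \<Longrightarrow> 0 \<le> nY x" "x \<in> Y \<Longrightarrow> y \<in> Y \<Longrightarrow> nY (x + y) \<le> nY x + nY y"
    and h: "\<And>x a. x \<in> Y \<Longrightarrow> nY (a *\<^sub>R x) = \<bar>a\<bar> * nY x"
    using assms by (auto simp: seminorm_on_def)
  then show "nY 0 = 0" using h[of 0 0] by (simp add: subspace_0)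
  show "nY (- x) = nY x" if "x \<in> Y" using h[OF that, of "-1"] by simp
qed

text \<open>
  The theorem of Pajor and Tomczak-Jaegermann for the operator \<open>a \<mapsto> L a = \<Sum>a\<^sub>k
  H\<^sub>k\<close>. Let \<open>X\<close> be the polar of the seminorm \<open>nY (L b)\<close>, and let
  \<open>\<theta>(x)\<close> be the mean of \<open>\<bar>u(\<phi>, x)\<bar>\<close>. By symmetrization
  there are \<open>n\<close> vectors \<open>\<phi>\<close> with \<open>n \<theta>(x) \<le>
  \<Sum>\<^sub>\<phi> \<bar>u(\<phi>, x)\<bar> + 2 M\<close> for all \<open>x\<close> in
  \<open>X\<close> at once. The distance of \<open>L a\<close> to the span of the \<open>L
  \<phi>\<close> is \<open>u(a, x)\<close> for some \<open>x\<close> in \<open>X\<close> that vanishes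
  on these \<open>\<phi>\<close>, by the Hahn-Banach theorem; hence \<open>\<theta>(x) \<le> 2 M /
  n\<close>, and the Euclidean norm of \<open>x\<close> is at most \<open>3 \<theta>(x)\<close>. The
  infimum that defines the distance is approached up to \<open>\<eta>\<close>.
\<close>
theorem low_dimensional_approximation:
  fixes H :: "nat \<Rightarrow> 'b::real_vector"
  assumes N: "seminorm_on Y nY" and H: "\<And>k. k < m \<Longrightarrow> H k \<in> Y" and n: "n \<ge> 1" and \<eta>: "\<eta> > 0"
    and M: "sign_rows_mean m n (\<lambda>l. nY (\<Sum>\<phi>\<leftarrow>l. \<Sum>k<m. \<phi> k *\<^sub>R H k)) \<le> M"
  obtains B where "finite B" "card B \<le> n" "B \<subseteq> Y"
    "\<And>a. (\<Sum>k<m. (a k)\<^sup>2) \<le> 1 \<Longrightarrow> \<exists>g\<in>span B. nY ((\<Sum>k<m. a k *\<^sub>R H k) - g) \<le> 6 * M / n + \<eta>"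
proof -
  define u where "u \<phi> x = (dot m \<phi> x)" for \<phi> x :: "nat \<Rightarrow> real"
  define \<theta> where "\<theta> x = sign_mean m (\<lambda>\<psi>. \<bar>u \<psi> x\<bar>)" for x
  define L where "L b = (\<Sum>k<m. b k *\<^sub>R H k)" for b :: "nat \<Rightarrow> real"
  define X where "X = {x. \<forall>b. u b x \<le> nY (L b)}"
  note Y = seminorm_onD[OF N]
  have LY: "L b \<in> Y" for b
    unfolding L_def by (intro subspace_sum subspace_scale Y(1) H) auto
  have L_add: "L (\<lambda>k. b k + c k) = L b + L c" for b c
    by (simp add: L_def scaleR_add_left sum.distrib)
  have L_scale: "L (\<lambda>k. t * b k) = t *\<^sub>R L b" for b t
    by (simp add: L_def scaleR_sum_right)
  have L_neg: "L (\<lambda>k. - b k) = - L b" for b using L_scale[of "-1" b] by simp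
  have L_list: "(\<Sum>\<phi>\<leftarrow>l. L \<phi>) = L (\<lambda>k. \<Sum>\<phi>\<leftarrow>l. \<phi> k)" for l
    by (induction l) (auto simp: L_add, simp add: L_def)
  have u_list: "(\<Sum>\<phi>\<leftarrow>l. u \<phi> x) = u (\<lambda>k. \<Sum>\<phi>\<leftarrow>l. \<phi> k) x" for l x
    by (induction l) (auto simp: u_def sum.distrib distrib_right)
  have X0: "(\<lambda>_. 0) \<in> X" using Y(2)[OF LY] by (simp add: X_def u_def)
  define R where "R = (\<Sum>k<m. nY (H k))"
  have bX: "\<bar>x k\<bar> \<le> R" if x: "x \<in> X" and k: "k < m" for x k
  proof -
    have un: "u (\<lambda>i. if i = k then c else 0) x = c * x k" "L (\<lambda>i. if i = k then c else 0) = c *\<^sub>R H k" for c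
      using k by (auto simp: u_def L_def if_distrib if_distribR cong: if_cong)
    have "c * x k \<le> \<bar>c\<bar> * nY (H k)" for c
    proof -
      have "u (\<lambda>i. if i = k then c else 0) x \<le> nY (L (\<lambda>i. if i = k then c else 0))"
        using x unfolding X_def by blast
      then show ?thesis unfolding un Y(4)[OF H[OF k]] .
    qed
    from this[of 1] this[of "-1"] have "\<bar>x k\<bar> \<le> nY (H k)" by simp
    also have "\<dots> \<le> R" unfolding R_def using k by (intro member_le_sum) (auto intro: Y(2) H)
    finally show ?thesis .
  qed
  have "sign_rows_mean m n (\<lambda>l. SUP x\<in>X. (\<Sum>\<phi>\<leftarrow>l. \<theta> x - \<bar>u \<phi> x\<bar>) + 0)
    \<le> sign_rows_mean m n (\<lambda>l. SUP x\<in>X. 2 * (\<Sum>\<phi>\<leftarrow>l. u \<phi> x) + 0)"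
    unfolding \<theta>_def u_def using X0 bX by (intro sign_symmetrization[where R = R]) auto
  also have "\<dots> \<le> sign_rows_mean m n (\<lambda>l. 2 * nY (\<Sum>\<phi>\<leftarrow>l. L \<phi>))"
    using X0 by (intro sign_rows_mean_mono cSUP_least) (auto simp: X_def u_list L_list)
  also have "\<dots> \<le> 2 * M" using M by (simp add: sign_rows_mean_cmult L_def)
  finally obtain l where l: "length l = n" "(SUP x\<in>X. (\<Sum>\<phi>\<leftarrow>l. \<theta> x - \<bar>u \<phi> x\<bar>)) \<le> 2 * M"
    using sign_rows_mean_attained[of n "\<lambda>l. SUP x\<in>X. (\<Sum>\<phi>\<leftarrow>l. \<theta> x - \<bar>u \<phi> x\<bar>)" m] by auto
  have bdd: "bdd_above ((\<lambda>x. \<Sum>\<phi>\<leftarrow>l. \<theta> x - \<bar>u \<phi> x\<bar>) ` X)"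
  proof (rule bdd_aboveI2)
    fix x assume x: "x \<in> X"
    have "\<theta> x \<le> sign_mean m (\<lambda>\<phi>. \<Sum>k<m. \<bar>\<phi> k\<bar> * R)"
      unfolding \<theta>_def u_def
      by (intro sign_mean_mono order_trans[OF sum_abs])
        (auto intro!: sum_mono mult_left_mono bX x simp: abs_mult)
    then have "\<theta> x - \<bar>u \<phi> x\<bar> \<le> sign_mean m (\<lambda>\<phi>. \<Sum>k<m. \<bar>\<phi> k\<bar> * R)" for \<phi>
      using abs_ge_zero[of "u \<phi> x"] by linarith
    then show "(\<Sum>\<phi>\<leftarrow>l. \<theta> x - \<bar>u \<phi> x\<bar>) \<le> (\<Sum>\<phi>\<leftarrow>l. sign_mean m (\<lambda>\<phi>. \<Sum>k<m. \<bar>\<phi> k\<bar> * R))"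
      by (intro sum_list_mono)
  qed
  define B where "B = L ` set l"
  have BY: "B \<subseteq> Y" using LY by (auto simp: B_def)
  have spanY: "span B \<subseteq> Y" using BY Y(1) by (simp add: span_minimal)
  have spanL: "\<exists>s. g = L s" if "g \<in> span B" for g
    using that
  proof (induction rule: span_induct_alt)
    case base
    show ?case by (rule exI[of _ "\<lambda>_. 0"]) (simp add: L_def)
  next
    case (step c x y)
    then obtain s \<phi> where "y = L s" "x = L \<phi>" by (auto simp: B_def)
    then have "c *\<^sub>R x + y = L (\<lambda>k. c * \<phi> k + s k)" by (simp add: L_add L_scale)
    then show ?case by blast
  qed
  \<comment> \<open>The seminorm of the quotient by the random subspace; its dominated functionals vanish on the \<open>\<phi>\<close>.\<close>
  define p where "p b = (INF g\<in>span B. nY (L b - g))" for b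
  have LgY: "L b - g \<in> Y" if "g \<in> span B" for b g
    using LY spanY that Y(1) by (intro subspace_diff) auto
  have bddp: "bdd_below ((\<lambda>g. nY (L b - g)) ` span B)" for b
    by (intro bdd_belowI2[of _ 0] Y(2) LgY)
  have p_le: "p b \<le> nY (L b - g)" if "g \<in> span B" for b g
    unfolding p_def by (rule cINF_lower[OF bddp that])
  have ne: "span B \<noteq> {}" using span_zero by auto
  have p_ge: "r \<le> p b" if "\<And>g. g \<in> span B \<Longrightarrow> r \<le> nY (L b - g)" for b r
    unfolding p_def using that ne by (intro cINF_greatest) auto
  have p_near: "\<exists>g\<in>span B. nY (L b - g) \<le> p b + \<eta>'" if "\<eta>' > 0" for b \<eta>'
  proof (rule ccontr)
    assume "\<not> ?thesis"
    then have "p b + \<eta>' \<le> p b" by (intro p_ge) (auto simp: not_le less_imp_le)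
    then show False using that by simp
  qed
  have p_nonneg: "0 \<le> p b" for b by (intro p_ge Y(2) LgY)
  have p_scale_le: "p (\<lambda>k. t * b k) \<le> t * p b" if t0: "t \<ge> 0" for t b
  proof (rule field_le_epsilon)
    fix e :: real assume e: "e > 0"
    obtain g where g: "g \<in> span B" "nY (L b - g) \<le> p b + e / (t + 1)"
      using p_near[of "e / (t + 1)" b] divide_pos_pos[of e "t + 1"] e t0 by auto
    have "p (\<lambda>k. t * b k) \<le> nY (L (\<lambda>k. t * b k) - t *\<^sub>R g)" using g by (intro p_le span_scale)
    also have "\<dots> = t * nY (L b - g)"
      using Y(4)[OF LgY[OF g(1), of b], of t] t0 by (simp add: L_scale scaleR_diff_right)
    also have "\<dots> \<le> t * (p b + e / (t + 1))" using g(2) t0 by (intro mult_left_mono)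
    also have "\<dots> \<le> t * p b + e" using t0 e by (simp add: field_simps)
    finally show "p (\<lambda>k. t * b k) \<le> t * p b + e" .
  qed
  have p_sub: "sublinear p"
    unfolding sublinear_def
  proof (intro conjI allI impI)
    fix b c
    show "p (\<lambda>k. b k + c k) \<le> p b + p c"
    proof (rule field_le_epsilon)
      fix e :: real assume e: "e > 0"
      obtain g where g: "g \<in> span B" "nY (L b - g) \<le> p b + e / 2"
        using p_near[of "e / 2" b] e by auto
      obtain g' where g': "g' \<in> span B" "nY (L c - g') \<le> p c + e / 2"
        using p_near[of "e / 2" c] e by auto
      have "p (\<lambda>k. b k + c k) \<le> nY (L (\<lambda>k. b k + c k) - (g + g'))"
        using g g' by (intro p_le span_add)
      also have "L (\<lambda>k. b k + c k) - (g + g') = (L b - g) + (L c - g')" by (simp add: L_add)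
      also have "nY \<dots> \<le> nY (L b - g) + nY (L c - g')" by (intro Y(3) LgY g g')
      finally show "p (\<lambda>k. b k + c k) \<le> p b + p c + e" using g g' by simp
    qed
  next
    fix t :: real and b assume t: "0 \<le> t"
    show "p (\<lambda>k. t * b k) = t * p b"
    proof (cases "t = 0")
      case True
      then show ?thesis using p_scale_le[of 0 b] p_nonneg[of "\<lambda>k. t * b k"] by simp
    next
      case False
      then have "t > 0" using t by simp
      moreover have "p b \<le> (1 / t) * p (\<lambda>k. t * b k)"
        using p_scale_le[of "1 / t" "\<lambda>k. t * b k"] \<open>t > 0\<close> by simp
      ultimately show ?thesis using p_scale_le[OF t, of b] by (simp add: field_simps)
    qed
  qed
  have L_restr: "L (\<lambda>k. if k < m then b k else 0) = L b" for b by (simp add: L_def)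
  then have p_restr: "p (\<lambda>k. if k < m then b k else 0) = p b" for b by (simp add: p_def)
  have main: "p a \<le> 6 * M / n" if a: "(\<Sum>k<m. (a k)\<^sup>2) \<le> 1" for a
  proof -
    obtain x where x: "\<And>b. u b x \<le> p b" "u a x = p a"
      using hahn_banach_coordinates[OF p_sub, of m a, unfolded p_restr] unfolding u_def by blast
    have xX: "x \<in> X"
      unfolding X_def using x(1) p_le[OF span_zero] by (auto intro: order_trans)
    have zero: "u \<phi> x = 0" if "\<phi> \<in> set l" for \<phi>
    proof -
      have in_span: "L \<phi> \<in> span B" using that by (auto simp: B_def intro: span_base)
      have "u \<phi> x \<le> 0" using x(1)[of \<phi>] p_le[OF in_span, of \<phi>] Y(5) by simp
      moreover have "u (\<lambda>k. - \<phi> k) x \<le> 0"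
        using x(1)[of "\<lambda>k. - \<phi> k"] p_le[OF span_neg[OF in_span], of "\<lambda>k. - \<phi> k"] Y(5) by (simp add: L_neg)
      ultimately show ?thesis by (simp add: u_def sum_negf)
    qed
    have "n * \<theta> x = (\<Sum>\<phi>\<leftarrow>l. \<theta> x - \<bar>u \<phi> x\<bar>)"
    proof -
      have "(\<Sum>\<phi>\<leftarrow>l. \<theta> x - \<bar>u \<phi> x\<bar>) = (\<Sum>\<phi>\<leftarrow>l. \<theta> x)" using zero by (intro arg_cong[where f = sum_list] map_cong) auto
      then show ?thesis using l(1) by (simp add: sum_list_triv)
    qed
    also have "\<dots> \<le> 2 * M" using cSUP_upper[OF xX bdd] l(2) by simp
    finally have \<theta>: "\<theta> x \<le> 2 * M / n" using n by (simp add: field_simps)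
    have "p a = u a x" using x(2) by simp
    also have "\<dots> \<le> L2_set a {..<m} * L2_set x {..<m}"
      unfolding u_def
      by (rule order_trans[OF _ L2_set_mult_ineq]) (auto intro!: sum_mono simp: abs_mult[symmetric])
    also have "\<dots> \<le> 1 * L2_set x {..<m}"
      using a by (intro mult_right_mono) (auto simp: L2_set_def intro: sum_nonneg)
    also have "\<dots> \<le> 3 * \<theta> x" using khintchine_lower[of x m] by (simp add: \<theta>_def u_def L2_set_def)
    finally show ?thesis using \<theta> by simp
  qed
  show ?thesis
  proof
    show "finite B" "card B \<le> n" "B \<subseteq> Y"
      using BY l(1) card_image_le[of "set l" L] card_length[of l] by (auto simp: B_def)
    fix a :: "nat \<Rightarrow> real" assume a: "(\<Sum>k<m. (a k)\<^sup>2) \<le> 1"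
    obtain g where "g \<in> span B" "nY (L a - g) \<le> p a + \<eta>" using p_near[OF \<eta>, of a] by blast
    then show "\<exists>g\<in>span B. nY ((\<Sum>k<m. a k *\<^sub>R H k) - g) \<le> 6 * M / n + \<eta>"
      using main[OF a] by (intro bexI[of _ g]) (simp_all add: L_def)
  qed
qed

section \<open>Square integrable functions\<close>

definition square_integrable :: "'a measure \<Rightarrow> ('a \<Rightarrow> real) \<Rightarrow> bool" where
  "square_integrable M f \<longleftrightarrow> f \<in> borel_measurable M \<and> integrable M (\<lambda>x. (f x)\<^sup>2)"

definition L2_inner :: "'a measure \<Rightarrow> ('a \<Rightarrow> real) \<Rightarrow> ('a \<Rightarrow> real) \<Rightarrow> real" where
  "L2_inner M f g = (LINT x|M. f x * g x)"

lemma square_integrable_mult: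
  assumes "square_integrable M f" "square_integrable M g"
  shows "integrable M (\<lambda>x. f x * g x)"
proof (rule Bochner_Integration.integrable_bound)
  show "integrable M (\<lambda>x. (f x)\<^sup>2 + (g x)\<^sup>2)"
    using assms by (auto simp: square_integrable_def)
  show "(\<lambda>x. f x * g x) \<in> borel_measurable M"
    using assms by (auto simp: square_integrable_def)
  have "\<bar>f x * g x\<bar> \<le> (f x)\<^sup>2 + (g x)\<^sup>2" for x
  proof -
    have "2 * (\<bar>f x\<bar> * \<bar>g x\<bar>) \<le> (f x)\<^sup>2 + (g x)\<^sup>2"
      using sum_squares_bound[of "\<bar>f x\<bar>" "\<bar>g x\<bar>"] by (simp only: power2_abs mult.assoc)
    moreover have "0 \<le> \<bar>f x\<bar> * \<bar>g x\<bar>" by simp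
    ultimately show ?thesis unfolding abs_mult by linarith
  qed
  then show "AE x in M. norm (f x * g x) \<le> norm ((f x)\<^sup>2 + (g x)\<^sup>2)" by simp
qed

lemma square_integrable_scale:
  "square_integrable M f \<Longrightarrow> square_integrable M (\<lambda>x. c * f x)"
  by (auto simp: square_integrable_def power_mult_distrib)

lemma square_integrable_add:
  assumes "square_integrable M f" "square_integrable M g"
  shows "square_integrable M (\<lambda>x. f x + g x)"
proof -
  have "(f x + g x)\<^sup>2 = (f x)\<^sup>2 + (g x)\<^sup>2 + 2 * (f x * g x)" for x
    by (simp add: power2_eq_square algebra_simps)
  then show ?thesis
    using assms square_integrable_mult[OF assms] by (auto simp: square_integrable_def)
qed

lemma square_integrable_diff:
  assumes "square_integrable M f" "square_integrable M g"
  shows "square_integrable M (\<lambda>x. f x - g x)"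
  using square_integrable_add[OF assms(1) square_integrable_scale[OF assms(2), of "-1"]] by simp

lemma square_integrable_sum:
  fixes m :: nat
  assumes "\<And>k. k < m \<Longrightarrow> square_integrable M (f k)"
  shows "square_integrable M (\<lambda>x. \<Sum>k<m. f k x)"
  using assms
proof (induction m)
  case 0
  show ?case by (simp add: square_integrable_def)
next
  case (Suc m)
  have "square_integrable M (\<lambda>x. (\<Sum>k<m. f k x) + f m x)"
    using Suc by (intro square_integrable_add) auto
  then show ?case by simp
qed

lemma L2_inner_commute: "L2_inner M f g = L2_inner M g f"
  by (simp add: L2_inner_def mult.commute)

lemma L2_inner_scale: "L2_inner M f (\<lambda>x. c * g x) = c * L2_inner M f g"
  by (simp add: L2_inner_def mult.left_commute)

lemma L2_inner_add:
  assumes "square_integrable M f" "square_integrable M g" "square_integrable M h"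
  shows "L2_inner M f (\<lambda>x. g x + h x) = L2_inner M f g + L2_inner M f h"
  using assms by (simp add: L2_inner_def distrib_left square_integrable_mult)

lemma L2_inner_diff:
  assumes "square_integrable M f" "square_integrable M g" "square_integrable M h"
  shows "L2_inner M f (\<lambda>x. g x - h x) = L2_inner M f g - L2_inner M f h"
  using assms by (simp add: L2_inner_def right_diff_distrib square_integrable_mult)

lemma L2_inner_sum:
  fixes m :: nat
  assumes "square_integrable M f" "\<And>k. k < m \<Longrightarrow> square_integrable M (e k)"
  shows "L2_inner M f (\<lambda>x. \<Sum>k<m. c k * e k x) = (\<Sum>k<m. c k * L2_inner M f (e k))"
  using assms(2)
proof (induction m)
  case 0
  then show ?case by (simp add: L2_inner_def)
next
  case (Suc m)
  then show ?case
    by (simp add: L2_inner_add L2_inner_scale assms(1) square_integrable_sum square_integrable_scale)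
qed

lemma L2_inner_self: "L2_inner M f f = (LINT x|M. (f x)\<^sup>2)" "0 \<le> L2_inner M f f"
  by (simp_all add: L2_inner_def power2_eq_square)

lemma L2_inner_diff_self:
  assumes f: "square_integrable M f" and g: "square_integrable M g"
  shows "L2_inner M (\<lambda>x. f x - g x) (\<lambda>x. f x - g x)
    = L2_inner M f f - 2 * L2_inner M f g + L2_inner M g g"
proof -
  define w where "w = (\<lambda>x. f x - g x)"
  have w: "square_integrable M w" unfolding w_def by (intro square_integrable_diff f g)
  have "L2_inner M w w = L2_inner M w f - L2_inner M w g"
    by (subst (2) w_def) (rule L2_inner_diff[OF w f g])
  moreover have "L2_inner M w f = L2_inner M f f - L2_inner M f g"
    by (subst L2_inner_commute, unfold w_def) (rule L2_inner_diff[OF f f g])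
  moreover have "L2_inner M w g = L2_inner M g f - L2_inner M g g"
    by (subst L2_inner_commute, unfold w_def) (rule L2_inner_diff[OF g f g])
  ultimately show ?thesis using L2_inner_commute[of M f g] by (simp add: w_def)
qed

lemma L2_cauchy_schwarz:
  assumes f: "square_integrable M f" and g: "square_integrable M g"
  shows "(L2_inner M f g)\<^sup>2 \<le> L2_inner M f f * L2_inner M g g"
proof -
  define a b c where "a = L2_inner M f f" and "b = L2_inner M f g" and "c = L2_inner M g g"
  have q: "0 \<le> a - 2 * t * b + t\<^sup>2 * c" for t
  proof -
    have "0 \<le> L2_inner M (\<lambda>x. f x - t * g x) (\<lambda>x. f x - t * g x)" by (rule L2_inner_self)
    also have "\<dots> = L2_inner M f f - 2 * L2_inner M f (\<lambda>x. t * g x) + L2_inner M (\<lambda>x. t * g x) (\<lambda>x. t * g x)"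
      by (intro L2_inner_diff_self f square_integrable_scale g)
    also have "L2_inner M (\<lambda>x. t * g x) (\<lambda>x. t * g x) = t\<^sup>2 * c"
      using L2_inner_commute[of M "\<lambda>x. t * g x" g]
      by (simp add: L2_inner_scale c_def power2_eq_square)
    also have "L2_inner M f (\<lambda>x. t * g x) = t * b" by (simp add: L2_inner_scale b_def)
    also have "L2_inner M f f - 2 * (t * b) + t\<^sup>2 * c = a - 2 * t * b + t\<^sup>2 * c" by (simp add: a_def)
    finally show ?thesis .
  qed
  show ?thesis
  proof (cases "c = 0")
    case True
    have "b = 0"
    proof (rule ccontr)
      assume "b \<noteq> 0"
      then show False using q[of "(a + 1) / (2 * b)"] True by simp
    qed
    then show ?thesis using True by (simp add: a_def b_def c_def)
  next
    case False
    then have c: "c > 0" using L2_inner_self(2)[of M g] by (simp add: c_def)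
    have "0 \<le> c * (a - 2 * (b / c) * b + (b / c)\<^sup>2 * c)" using q[of "b / c"] c by simp
    also have "\<dots> = a * c - b\<^sup>2" using c by (simp add: power2_eq_square field_simps)
    finally show ?thesis by (simp add: a_def b_def c_def)
  qed
qed

lemma L2_bessel:
  fixes m :: nat
  assumes f: "square_integrable M f" and e: "\<And>k. k < m \<Longrightarrow> square_integrable M (e k)"
    and on: "\<And>k l. k < m \<Longrightarrow> l < m \<Longrightarrow> L2_inner M (e k) (e l) = (if k = l then 1 else 0)"
  shows "(\<Sum>k<m. (L2_inner M f (e k))\<^sup>2) \<le> L2_inner M f f"
proof -
  define c where "c k = L2_inner M f (e k)" for k
  define s where "s = (\<lambda>x. \<Sum>k<m. c k * e k x)"
  have s: "square_integrable M s"
    unfolding s_def by (intro square_integrable_sum square_integrable_scale e)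
  have fs: "L2_inner M f s = (\<Sum>k<m. (c k)\<^sup>2)"
    unfolding s_def by (subst L2_inner_sum[OF f e]) (auto simp: c_def power2_eq_square)
  have se: "L2_inner M s (e k) = c k" if "k < m" for k
    unfolding L2_inner_commute[of M s "e k"]
    unfolding s_def
    using that L2_inner_sum[where f = "e k" and e = e and M = M and m = m and c = c] e
    by (simp add: on if_distrib cong: if_cong)
  have ss: "L2_inner M s s = (\<Sum>k<m. (c k)\<^sup>2)"
    by (subst (2) s_def, subst L2_inner_sum[OF s e]) (auto simp: se power2_eq_square)
  have "0 \<le> L2_inner M (\<lambda>x. f x - s x) (\<lambda>x. f x - s x)" by (rule L2_inner_self)
  also have "\<dots> = L2_inner M f f - 2 * L2_inner M f s + L2_inner M s s"
    by (rule L2_inner_diff_self[OF f s])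
  finally show ?thesis by (simp add: fs ss c_def)
qed

text \<open>
  Only the inner products with the \<open>u\<^sub>j\<close> matter later, so the expansion of
  \<open>u\<^sub>j\<close> is stated weakly, as an identity for all \<open>f\<close>. A residual of norm
  \<open>0\<close> contributes no basis vector.
\<close>

lemma L2_gram_schmidt:
  fixes n :: nat
  assumes "\<And>j. j < n \<Longrightarrow> square_integrable M (u j)"
  shows "\<exists>e (m::nat). (\<forall>k<m. square_integrable M (e k)) \<and>
    (\<forall>k<m. \<forall>l<m. L2_inner M (e k) (e l) = (if k = l then 1 else 0)) \<and>
    (\<forall>f. square_integrable M f \<longrightarrow>
      (\<forall>j<n. L2_inner M f (u j) = (\<Sum>k<m. L2_inner M f (e k) * L2_inner M (u j) (e k))))"
  using assms
proof (induction n)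
  case 0
  show ?case by (rule exI, rule exI[of _ 0]) simp
next
  case (Suc n)
  obtain e and m :: nat where e: "\<And>k. k < m \<Longrightarrow> square_integrable M (e k)"
    and on: "\<And>k l. k < m \<Longrightarrow> l < m \<Longrightarrow> L2_inner M (e k) (e l) = (if k = l then 1 else 0)"
    and exp: "\<And>f j. square_integrable M f \<Longrightarrow> j < n \<Longrightarrow>
      L2_inner M f (u j) = (\<Sum>k<m. L2_inner M f (e k) * L2_inner M (u j) (e k))"
  proof -
    have "\<exists>e (m::nat). (\<forall>k<m. square_integrable M (e k)) \<and>
      (\<forall>k<m. \<forall>l<m. L2_inner M (e k) (e l) = (if k = l then 1 else 0)) \<and>
      (\<forall>f. square_integrable M f \<longrightarrow>
        (\<forall>j<n. L2_inner M f (u j) = (\<Sum>k<m. L2_inner M f (e k) * L2_inner M (u j) (e k))))"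
      by (rule Suc.IH) (simp add: Suc.prems)
    then show thesis using that by blast
  qed
  define v where "v = u n"
  have v: "square_integrable M v" using Suc.prems by (simp add: v_def)
  define s where "s = (\<lambda>x. \<Sum>k<m. L2_inner M v (e k) * e k x)"
  define r where "r = (\<lambda>x. v x - s x)"
  have s: "square_integrable M s"
    unfolding s_def by (intro square_integrable_sum square_integrable_scale e)
  have r: "square_integrable M r" unfolding r_def by (intro square_integrable_diff v s)
  have fr: "L2_inner M f v = (\<Sum>k<m. L2_inner M f (e k) * L2_inner M v (e k)) + L2_inner M f r"
    if "square_integrable M f" for f
  proof -
    have "L2_inner M f s = (\<Sum>k<m. L2_inner M v (e k) * L2_inner M f (e k))"
      unfolding s_def using that e by (rule L2_inner_sum)
    then show ?thesis
      unfolding r_def using that v s by (simp add: L2_inner_diff mult.commute)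
  qed
  have er: "L2_inner M (e k) r = 0" if "k < m" for k
    using fr[OF e[OF that]] that on by (simp add: if_distrib if_distribR L2_inner_commute[of M _ v] cong: if_cong)
  show ?case
  proof (cases "L2_inner M r r = 0")
    case True
    have "L2_inner M f r = 0" if "square_integrable M f" for f
      using L2_cauchy_schwarz[OF that r] True by simp
    then have "L2_inner M f (u j) = (\<Sum>k<m. L2_inner M f (e k) * L2_inner M (u j) (e k))"
      if "square_integrable M f" "j < Suc n" for f j
      using fr[OF that(1)] exp[OF that(1)] that by (cases "j = n") (auto simp: v_def)
    then show ?thesis using e on by blast
  next
    case False
    define R where "R = sqrt (L2_inner M r r)"
    have R: "R > 0" "R * R = L2_inner M r r"
      using False L2_inner_self(2)[of M r] by (auto simp: R_def)
    define e' where "e' = e(m := (\<lambda>x. (1 / R) * r x))"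
    have e'_less: "e' k = e k" if "k < m" for k using that by (simp add: e'_def)
    have e'_m: "e' m = (\<lambda>x. (1 / R) * r x)" by (simp add: e'_def)
    have sq: "square_integrable M (e' k)" if "k < Suc m" for k
      using that e r by (cases "k = m") (auto simp: e'_def intro: square_integrable_scale[of M r "1/R", simplified])
    have inner_m: "L2_inner M f (e' m) = L2_inner M f r / R" for f
      unfolding e'_m by (subst L2_inner_scale) simp
    have em: "L2_inner M (e k) (e' m) = 0" if "k < m" for k
      using er[OF that] by (simp add: inner_m)
    have mm: "L2_inner M (e' m) (e' m) = 1"
      unfolding inner_m L2_inner_commute[of M "e' m"] using R False by (simp add: field_simps)
    have on': "L2_inner M (e' k) (e' l) = (if k = l then 1 else 0)" if "k < Suc m" "l < Suc m" for k l
      using that on em mm L2_inner_commute[of M "e' m" "e l"] by (auto simp: less_Suc_eq e'_less)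
    have um: "L2_inner M (u j) (e' m) = 0" if "j < n" for j
    proof -
      have "L2_inner M (e' m) (e k) = 0" if "k < m" for k
        using em[OF that] L2_inner_commute[of M "e' m" "e k"] by simp
      then have "L2_inner M (e' m) (u j) = 0" using exp[OF sq[of m] that] by simp
      then show ?thesis using L2_inner_commute[of M "u j" "e' m"] by simp
    qed
    have vr: "L2_inner M v r = R * R"
    proof -
      have "L2_inner M r (e k) = 0" if "k < m" for k
        using er[OF that] L2_inner_commute[of M r "e k"] by simp
      then have "L2_inner M r v = L2_inner M r r" using fr[OF r] by simp
      then show ?thesis using L2_inner_commute[of M v r] R by simp
    qed
    have vm: "L2_inner M v (e' m) = R" unfolding inner_m vr using R(1) by simp
    have "L2_inner M f (u j) = (\<Sum>k<Suc m. L2_inner M f (e' k) * L2_inner M (u j) (e' k))"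
      if f: "square_integrable M f" and j: "j < Suc n" for f j
    proof (cases "j = n")
      case True
      then show ?thesis using fr[OF f] vm R by (simp add: e'_less inner_m v_def)
    next
      case False
      then have "j < n" using j by simp
      then show ?thesis using exp[OF f] um by (simp add: e'_less)
    qed
    then show ?thesis using sq on' by blast
  qed
qed

section \<open>The inequality of Minkowski\<close>

lemma powr_convex_nonneg:
  fixes x y q :: real
  assumes "q \<ge> 1" "x \<ge> 0" "y \<ge> 0" "s \<ge> 0" "t \<ge> 0" "s + t = 1"
  shows "(s * x + t * y) powr q \<le> s * x powr q + t * y powr q"
proof -
  have aux: "(c * z) powr q \<le> c * z powr q" if "0 \<le> c" "c \<le> 1" "z \<ge> 0" for c z :: real
  proof (cases "c = 0")
    case False
    have "c powr q \<le> c powr 1" using that False assms(1) by (intro powr_mono') auto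
    then show ?thesis using that False by (simp add: powr_mult mult_right_mono)
  qed simp
  show ?thesis
  proof (cases "x = 0 \<or> y = 0")
    case True
    then show ?thesis using aux[of t y] aux[of s x] assms by auto
  next
    case False
    have "convex_on {0<..} (\<lambda>x::real. x powr q)" using assms(1) by (rule powr_convex)
    then show ?thesis
      using assms False unfolding convex_on_def by (auto simp: less_le)
  qed
qed

lemma powr_add_le:
  fixes x y q :: real
  assumes "q \<ge> 0"
  shows "\<bar>x + y\<bar> powr q \<le> 2 powr q * (\<bar>x\<bar> powr q + \<bar>y\<bar> powr q)"
proof -
  have "\<bar>x + y\<bar> powr q \<le> (2 * max \<bar>x\<bar> \<bar>y\<bar>) powr q"
    using assms by (intro powr_mono2) auto
  also have "\<dots> = 2 powr q * (max \<bar>x\<bar> \<bar>y\<bar>) powr q" by (simp add: powr_mult)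
  also have "\<dots> \<le> 2 powr q * (\<bar>x\<bar> powr q + \<bar>y\<bar> powr q)"
    by (intro mult_left_mono) (auto simp: max_def)
  finally show ?thesis .
qed

lemma integrable_powr_add:
  assumes "q \<ge> 0" and [measurable]: "f \<in> borel_measurable M" "g \<in> borel_measurable M"
    and "integrable M (\<lambda>x. \<bar>f x\<bar> powr q)" "integrable M (\<lambda>x. \<bar>g x\<bar> powr q)"
  shows "integrable M (\<lambda>x. \<bar>f x + g x :: real\<bar> powr q)"
proof (rule Bochner_Integration.integrable_bound)
  show "integrable M (\<lambda>x. 2 powr q * (\<bar>f x\<bar> powr q + \<bar>g x\<bar> powr q))" using assms by simp
  show "AE x in M. norm (\<bar>f x + g x\<bar> powr q) \<le> norm (2 powr q * (\<bar>f x\<bar> powr q + \<bar>g x\<bar> powr q))"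
    using powr_add_le[OF assms(1)] by (intro AE_I2) (simp add: abs_mult)
qed simp

text \<open>
  With \<open>a\<close> and \<open>b\<close> slightly larger than the two norms, write
  \<open>\<bar>f\<bar> + \<bar>g\<bar>\<close> as \<open>a + b\<close> times the convex combination of
  \<open>\<bar>f\<bar>/a\<close> and \<open>\<bar>g\<bar>/b\<close> with weights \<open>a/(a+b)\<close>
  and \<open>b/(a+b)\<close>, and use the convexity of the power function. The slack \<open>e\<close>
  avoids division by \<open>0\<close>.
\<close>

lemma minkowski_inequality:
  assumes q: "q \<ge> 1" and [measurable]: "f \<in> borel_measurable M" "g \<in> borel_measurable M"
    and f: "integrable M (\<lambda>x. \<bar>f x\<bar> powr q)" and g: "integrable M (\<lambda>x. \<bar>g x\<bar> powr q)"
  shows "(LINT x|M. \<bar>f x + g x :: real\<bar> powr q) powr (1/q)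
    \<le> (LINT x|M. \<bar>f x\<bar> powr q) powr (1/q) + (LINT x|M. \<bar>g x\<bar> powr q) powr (1/q)"
proof (rule field_le_epsilon)
  fix e :: real assume e: "e > 0"
  define F G where "F = (LINT x|M. \<bar>f x\<bar> powr q)" and "G = (LINT x|M. \<bar>g x\<bar> powr q)"
  have FG: "F \<ge> 0" "G \<ge> 0" by (simp_all add: F_def G_def)
  define a b where "a = F powr (1/q) + e / 2" and "b = G powr (1/q) + e / 2"
  have ab: "a > 0" "b > 0" using e by (simp_all add: a_def b_def add_nonneg_pos)
  have le: "F \<le> a powr q" "G \<le> b powr q"
  proof -
    have "(F powr (1/q)) powr q \<le> a powr q" "(G powr (1/q)) powr q \<le> b powr q"
      using q e by (intro powr_mono2; simp add: a_def b_def)+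
    then show "F \<le> a powr q" "G \<le> b powr q" using q FG by (auto simp: powr_powr)
  qed
  have pt: "\<bar>f x + g x\<bar> powr q \<le> (a + b) powr q * (a / (a + b) / a powr q * \<bar>f x\<bar> powr q + b / (a + b) / b powr q * \<bar>g x\<bar> powr q)" for x
  proof -
    have "\<bar>f x + g x\<bar> powr q \<le> ((a + b) * (a / (a + b) * (\<bar>f x\<bar> / a) + b / (a + b) * (\<bar>g x\<bar> / b))) powr q"
    proof (rule powr_mono2)
      have "(a + b) * (a / (a + b) * (\<bar>f x\<bar> / a) + b / (a + b) * (\<bar>g x\<bar> / b)) = \<bar>f x\<bar> + \<bar>g x\<bar>"
        using ab by (simp add: distrib_left)
      then show "\<bar>f x + g x\<bar> \<le> (a + b) * (a / (a + b) * (\<bar>f x\<bar> / a) + b / (a + b) * (\<bar>g x\<bar> / b))"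
        by simp
    qed (use q in auto)
    also have "\<dots> = (a + b) powr q * (a / (a + b) * (\<bar>f x\<bar> / a) + b / (a + b) * (\<bar>g x\<bar> / b)) powr q"
      using ab by (intro powr_mult)
    also have "\<dots> \<le> (a + b) powr q * (a / (a + b) * (\<bar>f x\<bar> / a) powr q + b / (a + b) * (\<bar>g x\<bar> / b) powr q)"
      using q ab by (intro mult_left_mono powr_convex_nonneg) (auto simp: add_divide_distrib[symmetric])
    finally show ?thesis using ab by (simp add: powr_divide)
  qed
  have "(LINT x|M. \<bar>f x + g x\<bar> powr q)
      \<le> (LINT x|M. (a + b) powr q * (a / (a + b) / a powr q * \<bar>f x\<bar> powr q + b / (a + b) / b powr q * \<bar>g x\<bar> powr q))"
    using q f g pt by (intro integral_mono integrable_powr_add) auto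
  also have "\<dots> = (a + b) powr q * (a / (a + b) * (F / a powr q) + b / (a + b) * (G / b powr q))"
    using f g by (simp add: F_def G_def)
  also have "\<dots> \<le> (a + b) powr q * (a / (a + b) * 1 + b / (a + b) * 1)"
    using le ab by (intro mult_left_mono add_mono) (auto simp: divide_le_eq)
  also have "\<dots> = (a + b) powr q" using ab by (simp add: add_divide_distrib[symmetric])
  finally have "(LINT x|M. \<bar>f x + g x\<bar> powr q) powr (1/q) \<le> ((a + b) powr q) powr (1/q)"
    using q by (intro powr_mono2) auto
  also have "\<dots> = a + b" using q ab by (simp add: powr_powr)
  finally show "(LINT x|M. \<bar>f x + g x\<bar> powr q) powr (1/q) \<le> F powr (1/q) + G powr (1/q) + e"
    by (simp add: a_def b_def)
qed

section \<open>The spaces \<open>L\<^sub>q[0,1]\<close>\<close>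

lemma space_leb01: "space leb01 = {0..1}" by (simp add: space_restrict_space)

lemma finite_measure_leb01: "finite_measure leb01"
  by (rule finite_measureI) (simp add: space_leb01 emeasure_restrict_space)

lemma integral_leb01_const: "(LINT x|leb01. c) = (c :: real)"
  by (subst integral_restrict_space) auto

lemma integrable_leb01_bounded:
  assumes "g \<in> borel_measurable leb01" "\<And>x. x \<in> {0..1} \<Longrightarrow> \<bar>g x\<bar> \<le> (c::real)"
  shows "integrable leb01 g"
  by (rule finite_measure.integrable_const_bound[OF finite_measure_leb01 _ assms(1), of c])
    (use assms(2) space_leb01 in \<open>auto intro!: AE_I2\<close>)

lemma ae_equal_self: "ae_equal f f \<longleftrightarrow> f \<in> borel_measurable leb01"
  by (simp add: ae_equal_def)

lemma abs_aefun_eqI: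
  assumes "f \<in> borel_measurable leb01" "g \<in> borel_measurable leb01" "AE x in leb01. f x = g x"
  shows "abs_aefun f = abs_aefun g"
  using Quotient3_rel_abs[OF Quotient3_aefun] assms by (simp add: ae_equal_def)

lemma rep_aefun_measurable: "rep_aefun f \<in> borel_measurable leb01"
  using Quotient3_rep_reflp[OF Quotient3_aefun] by (simp add: ae_equal_self)

lemma abs_rep_aefun: "abs_aefun (rep_aefun f) = f"
  by (rule Quotient3_abs_rep[OF Quotient3_aefun])

lemma rep_abs_aefun:
  assumes "f \<in> borel_measurable leb01"
  shows "AE x in leb01. rep_aefun (abs_aefun f) x = f x"
  using Quotient3_rep_abs[OF Quotient3_aefun, of f] assms by (simp add: ae_equal_def)

lemma abs_aefun_add:
  "f \<in> borel_measurable leb01 \<Longrightarrow> g \<in> borel_measurable leb01 \<Longrightarrow>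
    abs_aefun f + abs_aefun g = abs_aefun (\<lambda>x. f x + g x)"
  by (intro plus_aefun.abs_eq) (simp_all add: ae_equal_self)

lemma abs_aefun_diff:
  "f \<in> borel_measurable leb01 \<Longrightarrow> g \<in> borel_measurable leb01 \<Longrightarrow>
    abs_aefun f - abs_aefun g = abs_aefun (\<lambda>x. f x - g x)"
  by (intro minus_aefun.abs_eq) (simp_all add: ae_equal_self)

lemma abs_aefun_scale:
  "f \<in> borel_measurable leb01 \<Longrightarrow> a *\<^sub>R abs_aefun f = abs_aefun (\<lambda>x. a * f x)"
  by (intro scaleR_aefun.abs_eq) (simp_all add: ae_equal_self)

lemma abs_aefun_zero: "abs_aefun (\<lambda>_. 0) = 0"
  by (simp add: zero_aefun.abs_eq)

lemma abs_aefun_sum: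
  assumes "\<And>i. i \<in> I \<Longrightarrow> f i \<in> borel_measurable leb01"
  shows "(\<Sum>i\<in>I. abs_aefun (f i)) = abs_aefun (\<lambda>x. \<Sum>i\<in>I. f i x)"
  using assms
  by (induction I rule: infinite_finite_induct) (simp_all add: abs_aefun_zero abs_aefun_add)

lemma abs_aefun_in_Lp_iff:
  "f \<in> borel_measurable leb01 \<Longrightarrow> abs_aefun f \<in> Lp p \<longleftrightarrow> integrable leb01 (\<lambda>x. \<bar>f x\<bar> powr p)"
  by (simp add: Lp_def in_Lp.abs_eq ae_equal_self)

lemma Lp_norm_abs_aefun:
  "f \<in> borel_measurable leb01 \<Longrightarrow> Lp_norm p (abs_aefun f) = (LINT x|leb01. \<bar>f x\<bar> powr p) powr (1 / p)"
  by (simp add: Lp_norm.abs_eq ae_equal_self)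

lemma aefun_cases:
  obtains g where "g \<in> borel_measurable leb01" "f = abs_aefun g"
  using rep_aefun_measurable abs_rep_aefun by metis

lemma seminorm_on_Lp:
  assumes q: "q \<ge> 1"
  shows "seminorm_on (Lp q) (Lp_norm q)"
proof -
  have add: "f + g \<in> Lp q \<and> Lp_norm q (f + g) \<le> Lp_norm q f + Lp_norm q g"
    if "f \<in> Lp q" "g \<in> Lp q" for f g
  proof -
    obtain f' where f': "f' \<in> borel_measurable leb01" "f = abs_aefun f'" by (rule aefun_cases)
    obtain g' where g': "g' \<in> borel_measurable leb01" "g = abs_aefun g'" by (rule aefun_cases)
    have i: "integrable leb01 (\<lambda>x. \<bar>f' x\<bar> powr q)" "integrable leb01 (\<lambda>x. \<bar>g' x\<bar> powr q)"
      using that f' g' by (simp_all add: abs_aefun_in_Lp_iff)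
    have m: "(\<lambda>x. f' x + g' x) \<in> borel_measurable leb01" using f' g' by simp
    have "integrable leb01 (\<lambda>x. \<bar>f' x + g' x\<bar> powr q)"
      using q f'(1) g'(1) i by (intro integrable_powr_add) auto
    then show ?thesis
      using minkowski_inequality[OF q f'(1) g'(1) i] m f' g'
      by (simp add: abs_aefun_add abs_aefun_in_Lp_iff Lp_norm_abs_aefun)
  qed
  have scale: "a *\<^sub>R f \<in> Lp q \<and> Lp_norm q (a *\<^sub>R f) = \<bar>a\<bar> * Lp_norm q f" if "f \<in> Lp q" for f a
  proof -
    obtain f' where f': "f' \<in> borel_measurable leb01" "f = abs_aefun f'"
      by (rule aefun_cases)
    have i: "integrable leb01 (\<lambda>x. \<bar>f' x\<bar> powr q)"
      using that f' by (simp add: abs_aefun_in_Lp_iff)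
    have m: "(\<lambda>x. a * f' x) \<in> borel_measurable leb01" using f' by simp
    have eq: "(\<lambda>x. \<bar>a * f' x\<bar> powr q) = (\<lambda>x. \<bar>a\<bar> powr q * \<bar>f' x\<bar> powr q)"
      by (simp add: abs_mult powr_mult)
    have "(\<bar>a\<bar> powr q * (LINT x|leb01. \<bar>f' x\<bar> powr q)) powr (1 / q)
        = \<bar>a\<bar> * (LINT x|leb01. \<bar>f' x\<bar> powr q) powr (1 / q)"
      using q by (subst powr_mult) (simp_all add: powr_powr)
    then show ?thesis
      using i m f' by (simp add: abs_aefun_scale abs_aefun_in_Lp_iff Lp_norm_abs_aefun eq)
  qed
  have zero: "0 \<in> Lp q"
    using abs_aefun_in_Lp_iff[of "\<lambda>_. 0" q] q by (simp add: abs_aefun_zero)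
  have nonneg: "0 \<le> Lp_norm q f" for f
  proof -
    obtain f' where f': "f' \<in> borel_measurable leb01" "f = abs_aefun f'"
      by (rule aefun_cases)
    then show ?thesis by (simp add: Lp_norm_abs_aefun)
  qed
  show ?thesis
    unfolding seminorm_on_def subspace_def using add scale zero nonneg by blast
qed

lemma Lp_norm_eq_0:
  assumes q: "q \<ge> 1" and f: "f \<in> Lp q" and 0: "Lp_norm q f = 0"
  shows "f = 0"
proof -
  obtain f' where f': "f' \<in> borel_measurable leb01" "f = abs_aefun f'"
    by (rule aefun_cases)
  have i: "integrable leb01 (\<lambda>x. \<bar>f' x\<bar> powr q)"
    using f f' by (simp add: abs_aefun_in_Lp_iff)
  have "(LINT x|leb01. \<bar>f' x\<bar> powr q) = 0"
    using 0 f' by (simp add: Lp_norm_abs_aefun)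
  then have "AE x in leb01. \<bar>f' x\<bar> powr q = 0"
    using i by (subst (asm) integral_nonneg_eq_0_iff_AE) auto
  then have "AE x in leb01. f' x = 0" by (auto elim: eventually_mono)
  then have "abs_aefun f' = abs_aefun (\<lambda>_. 0)" using f' by (intro abs_aefun_eqI) auto
  then show ?thesis by (simp add: f' abs_aefun_zero)
qed

lemma Metric_space_Lp:
  assumes q: "q \<ge> 1"
  shows "Metric_space (Lp q) (\<lambda>f g. Lp_norm q (f - g))"
proof -
  note N = seminorm_onD[OF seminorm_on_Lp[OF q]]
  have nonneg: "0 \<le> Lp_norm q f" for f
  proof -
    obtain f' where f': "f' \<in> borel_measurable leb01" "f = abs_aefun f'"
      by (rule aefun_cases)
    then show ?thesis by (simp add: Lp_norm_abs_aefun)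
  qed
  have comm: "Lp_norm q (f - g) = Lp_norm q (g - f)" for f g
  proof -
    obtain f' where f': "f' \<in> borel_measurable leb01" "f = abs_aefun f'" by (rule aefun_cases)
    obtain g' where g': "g' \<in> borel_measurable leb01" "g = abs_aefun g'" by (rule aefun_cases)
    show ?thesis using f' g' by (simp add: abs_aefun_diff Lp_norm_abs_aefun abs_minus_commute)
  qed
  show ?thesis
  proof
    show "(Lp_norm q (f - g) = 0) = (f = g)" if "f \<in> Lp q" "g \<in> Lp q" for f g
      using Lp_norm_eq_0[OF q subspace_diff[OF N(1) that]] N(5) by auto
    show "Lp_norm q (f - h) \<le> Lp_norm q (f - g) + Lp_norm q (g - h)"
      if "f \<in> Lp q" "g \<in> Lp q" "h \<in> Lp q" for f g h
      using N(3)[OF subspace_diff[OF N(1) that(1,2)] subspace_diff[OF N(1) that(2,3)]] by simp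
  qed (use nonneg comm in auto)
qed

lemma Lp_norm_le_bound:
  assumes q: "q \<ge> 1" and g: "g \<in> borel_measurable leb01"
    and c: "0 \<le> c" "\<And>t. t \<in> {0..1} \<Longrightarrow> \<bar>g t\<bar> \<le> c"
  shows "abs_aefun g \<in> Lp q" "Lp_norm q (abs_aefun g) \<le> c"
proof -
  have b: "\<bar>g t\<bar> powr q \<le> c powr q" if "t \<in> {0..1}" for t
    using c(2)[OF that] q by (intro powr_mono2) auto
  have i: "integrable leb01 (\<lambda>x. \<bar>g x\<bar> powr q)"
    using g b by (intro integrable_leb01_bounded[where c = "c powr q"]) auto
  then show "abs_aefun g \<in> Lp q" using g by (simp add: abs_aefun_in_Lp_iff)
  have "(LINT x|leb01. \<bar>g x\<bar> powr q) \<le> (LINT x|leb01. c powr q)"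
    using i b by (intro integral_mono) (auto simp: space_leb01 intro!: integrable_leb01_bounded[where c = "c powr q"])
  then have "(LINT x|leb01. \<bar>g x\<bar> powr q) powr (1 / q) \<le> (c powr q) powr (1 / q)"
    unfolding integral_leb01_const using q by (intro powr_mono2) auto
  also have "\<dots> = c" using q c(1) by (simp add: powr_powr)
  finally show "Lp_norm q (abs_aefun g) \<le> c" using g by (simp add: Lp_norm_abs_aefun)
qed

lemma square_integrable_rep_aefun:
  assumes "f \<in> Lp 2"
  shows "square_integrable leb01 (rep_aefun f)"
    and "L2_inner leb01 (rep_aefun f) (rep_aefun f) = (Lp_norm 2 f)\<^sup>2"
proof -
  have eq: "\<bar>y\<bar> powr 2 = y\<^sup>2" for y :: real by (cases "y = 0") (auto simp: powr_numeral)
  have i: "integrable leb01 (\<lambda>x. (rep_aefun f x)\<^sup>2)"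
    using assms abs_aefun_in_Lp_iff[OF rep_aefun_measurable, of f 2] by (simp add: abs_rep_aefun eq)
  then show "square_integrable leb01 (rep_aefun f)"
    by (simp add: square_integrable_def rep_aefun_measurable)
  have "Lp_norm 2 f = sqrt (LINT x|leb01. (rep_aefun f x)\<^sup>2)"
    using Lp_norm_abs_aefun[OF rep_aefun_measurable, of 2 f] by (simp add: abs_rep_aefun eq powr_half_sqrt)
  then show "L2_inner leb01 (rep_aefun f) (rep_aefun f) = (Lp_norm 2 f)\<^sup>2"
    by (simp add: L2_inner_self)
qed

section \<open>Random combinations of functions in \<open>L\<^sub>q\<close>\<close>

lemma sign_mean_integral:
  fixes F :: "(nat \<Rightarrow> real) \<Rightarrow> 'a \<Rightarrow> real"
  assumes "\<And>\<phi>. integrable M (F \<phi>)"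
  shows "integrable M (\<lambda>t. sign_mean m (\<lambda>\<phi>. F \<phi> t))"
    and "(LINT t|M. sign_mean m (\<lambda>\<phi>. F \<phi> t)) = sign_mean m (\<lambda>\<phi>. LINT t|M. F \<phi> t)"
  using assms by (induction m arbitrary: F) simp_all

lemma sign_rows_mean_integral:
  fixes F :: "(nat \<Rightarrow> real) list \<Rightarrow> 'a \<Rightarrow> real"
  assumes "\<And>l. integrable M (F l)"
  shows "integrable M (\<lambda>t. sign_rows_mean m n (\<lambda>l. F l t))"
    and "(LINT t|M. sign_rows_mean m n (\<lambda>l. F l t)) = sign_rows_mean m n (\<lambda>l. LINT t|M. F l t)"
  using assms by (induction n arbitrary: F) (simp_all add: sign_mean_integral)

text \<open>
  From \<open>\<bar>u\<bar> \<le> exp (\<bar>u\<bar> - 1)\<close>. This is how the \<open>q\<close>-th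
  moment of a sign sum is read off its exponential moments.
\<close>

lemma powr_le_exp:
  fixes u q :: real
  assumes "q > 0"
  shows "\<bar>u\<bar> powr q \<le> exp (- q) * (exp (q * u) + exp (- (q * u)))"
proof -
  have "\<bar>u\<bar> powr q \<le> exp (\<bar>u\<bar> - 1) powr q"
    using assms exp_ge_add_one_self[of "\<bar>u\<bar> - 1"] by (intro powr_mono2) auto
  also have "\<dots> = exp (- q) * exp (q * \<bar>u\<bar>)"
    by (simp add: powr_def exp_add[symmetric] algebra_simps)
  also have "\<dots> \<le> exp (- q) * (exp (q * u) + exp (- (q * u)))"
    by (cases "u \<ge> 0") (auto intro!: mult_left_mono simp: abs_if)
  finally show ?thesis .
qed

text \<open>
  For fixed \<open>t\<close> the sum is subgaussian with variance at most \<open>n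
  \<sigma>\<^sup>2\<close>. After division by \<open>S = \<surd>(q n) \<sigma>\<close> its exponential
  moments of order \<open>\<plusminus>q\<close> are at most \<open>exp (q/2)\<close>, so the mean
  \<open>q\<close>-th moment is at most \<open>2 exp (q/2 - q) \<le> 2\<close>, uniformly in
  \<open>q\<close>. The growth \<open>\<surd>q\<close> is thus the usual growth of Gaussian moments, and
  \<open>N/S \<le> 1 + (N/S)\<^sup>q\<close> passes from the norm \<open>N\<close> to its power.
\<close>

lemma sign_rows_mean_Lp_norm:
  fixes h :: "nat \<Rightarrow> real \<Rightarrow> real"
  assumes q: "q \<ge> 1" and n: "n \<ge> 1" and \<sigma>: "\<sigma> > 0"
    and h: "\<And>k. k < m \<Longrightarrow> h k \<in> borel_measurable leb01"
    and h\<sigma>: "\<And>t. t \<in> {0..1} \<Longrightarrow> (\<Sum>k<m. (h k t)\<^sup>2) \<le> \<sigma>\<^sup>2"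
  shows "sign_rows_mean m n (\<lambda>l. Lp_norm q (\<Sum>\<phi>\<leftarrow>l. \<Sum>k<m. \<phi> k *\<^sub>R abs_aefun (h k)))
    \<le> 3 * (sqrt (q * n) * \<sigma>)"
proof -
  define S where "S = sqrt (q * n) * \<sigma>"
  have S: "S > 0" using q n \<sigma> by (simp add: S_def)
  define G where "G l t = (\<Sum>\<phi>\<leftarrow>l. \<Sum>k<m. \<phi> k * h k t)" for l t
  have hb: "\<bar>h k t\<bar> \<le> \<sigma>" if "k < m" "t \<in> {0..1}" for k t
  proof -
    have "(h k t)\<^sup>2 \<le> (\<Sum>k<m. (h k t)\<^sup>2)" using that by (intro member_le_sum) auto
    then have "\<bar>h k t\<bar>\<^sup>2 \<le> \<sigma>\<^sup>2" using h\<sigma>[OF that(2)] by simp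
    then show ?thesis using \<sigma> by (simp add: power2_le_iff_abs_le)
  qed
  have Gm: "G l \<in> borel_measurable leb01" for l
    unfolding G_def using h by (induction l) auto
  have Gb: "\<exists>c. \<forall>t\<in>{0..1}. \<bar>G l t\<bar> \<le> c" for l
  proof (induction l)
    case Nil
    show ?case by (rule exI[of _ 0]) (simp add: G_def)
  next
    case (Cons \<phi> l)
    then obtain c where c: "\<And>t. t \<in> {0..1} \<Longrightarrow> \<bar>G l t\<bar> \<le> c" by blast
    have "\<bar>G (\<phi> # l) t\<bar> \<le> (\<Sum>k<m. \<bar>\<phi> k\<bar> * \<sigma>) + c" if "t \<in> {0..1}" for t
    proof -
      have "\<bar>\<Sum>k<m. \<phi> k * h k t\<bar> \<le> (\<Sum>k<m. \<bar>\<phi> k\<bar> * \<sigma>)"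
        by (rule order_trans[OF sum_abs]) (auto intro!: sum_mono mult_left_mono hb that simp: abs_mult)
      then show ?thesis
        using c[OF that] abs_triangle_ineq[of "\<Sum>k<m. \<phi> k * h k t" "G l t"] by (simp add: G_def)
    qed
    then show ?case by blast
  qed
  have Geq: "(\<Sum>\<phi>\<leftarrow>l. \<Sum>k<m. \<phi> k *\<^sub>R abs_aefun (h k)) = abs_aefun (G l)" for l
  proof (induction l)
    case Nil
    show ?case by (simp add: G_def abs_aefun_zero)
  next
    case (Cons \<phi> l)
    have "(\<Sum>k<m. \<phi> k *\<^sub>R abs_aefun (h k)) = abs_aefun (\<lambda>t. \<Sum>k<m. \<phi> k * h k t)"
      using h by (subst abs_aefun_sum[symmetric]) (simp_all add: abs_aefun_scale)
    then have "(\<Sum>\<phi>\<leftarrow>\<phi> # l. \<Sum>k<m. \<phi> k *\<^sub>R abs_aefun (h k)) = abs_aefun (\<lambda>t. \<Sum>k<m. \<phi> k * h k t) + abs_aefun (G l)"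
      using Cons by simp
    also have "\<dots> = abs_aefun (\<lambda>t. (\<Sum>k<m. \<phi> k * h k t) + G l t)"
      using h Gm[of l] by (intro abs_aefun_add) auto
    finally show ?case by (simp add: G_def)
  qed
  define E where "E c l t = exp (c * G l t)" for c l t
  have Ei: "integrable leb01 (E c l)" for c l
  proof -
    obtain b where "\<And>t. t \<in> {0..1} \<Longrightarrow> \<bar>G l t\<bar> \<le> b" using Gb[of l] by blast
    then have "c * G l t \<le> \<bar>c\<bar> * b" if "t \<in> {0..1}" for t
      using that by (intro order.trans[OF abs_ge_self[of "c * G l t"]]) (simp add: abs_mult mult_left_mono)
    then show ?thesis
      using Gm[of l] unfolding E_def by (intro integrable_leb01_bounded[where c = "exp (\<bar>c\<bar> * b)"]) auto
  qed
  have Em: "sign_rows_mean m n (\<lambda>l. LINT t|leb01. E c l t) \<le> exp (q / 2)" if c: "c\<^sup>2 = (q / S)\<^sup>2" for c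
  proof -
    have "sign_rows_mean m n (\<lambda>l. LINT t|leb01. E c l t) = (LINT t|leb01. sign_rows_mean m n (\<lambda>l. E c l t))"
      by (rule sign_rows_mean_integral(2)[OF Ei, symmetric])
    also have "\<dots> \<le> (LINT t|leb01. exp (q / 2))"
    proof (rule integral_mono)
      fix t assume "t \<in> space leb01"
      then have t: "t \<in> {0..1}" by (simp add: space_leb01)
      have "E c l t = exp (\<Sum>\<phi>\<leftarrow>l. \<Sum>k<m. \<phi> k * (c * h k t))" for l
        unfolding E_def G_def by (simp add: sum_list_const_mult[symmetric] sum_distrib_left mult.left_commute)
      then have "sign_rows_mean m n (\<lambda>l. E c l t) \<le> exp (n * (\<Sum>k<m. (c * h k t)\<^sup>2) / 2)"
        using sign_rows_mean_exp[of m n "\<lambda>k. c * h k t"] by simp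
      also have "(\<Sum>k<m. (c * h k t)\<^sup>2) = (q / S)\<^sup>2 * (\<Sum>k<m. (h k t)\<^sup>2)"
        by (simp add: power_mult_distrib sum_distrib_left c)
      also have "exp (n * ((q / S)\<^sup>2 * (\<Sum>k<m. (h k t)\<^sup>2)) / 2) \<le> exp (n * ((q / S)\<^sup>2 * \<sigma>\<^sup>2) / 2)"
        using h\<sigma>[OF t] by (simp add: divide_right_mono mult_left_mono)
      also have "n * ((q / S)\<^sup>2 * \<sigma>\<^sup>2) / 2 = q / 2"
        using q n \<sigma> by (simp add: S_def power_divide power_mult_distrib power2_eq_square[of q])
      finally show "sign_rows_mean m n (\<lambda>l. E c l t) \<le> exp (q / 2)" .
    qed (auto intro!: sign_rows_mean_integral(1) Ei integrable_leb01_bounded[where c = "exp (q / 2)"])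
    finally show ?thesis unfolding integral_leb01_const .
  qed
  have "sign_rows_mean m n (\<lambda>l. Lp_norm q (abs_aefun (G l)))
      \<le> sign_rows_mean m n (\<lambda>l. S * (1 + exp (- q) * ((LINT t|leb01. E (q / S) l t) + (LINT t|leb01. E (- (q / S)) l t))))"
  proof (rule sign_rows_mean_mono)
    fix l
    define N where "N = Lp_norm q (abs_aefun (G l))"
    define I where "I = (LINT t|leb01. \<bar>G l t\<bar> powr q)"
    have N: "N = I powr (1 / q)" "I \<ge> 0" using Gm[of l] by (simp_all add: N_def I_def Lp_norm_abs_aefun)
    have "N / S \<le> 1 + (N / S) powr q"
    proof (cases "N / S \<le> 1")
      case True
      then show ?thesis using powr_ge_zero[of "N / S" q] by linarith
    next
      case False
      then have "(N / S) powr 1 \<le> (N / S) powr q" using q by (intro powr_mono) auto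
      moreover have "(N / S) powr 1 = N / S" using False by (intro powr_one) linarith
      ultimately show ?thesis by linarith
    qed
    also have "(N / S) powr q = (LINT t|leb01. \<bar>G l t / S\<bar> powr q)"
    proof -
      have "(N / S) powr q = I / S powr q"
        using N q S by (simp add: powr_divide powr_powr)
      also have "\<dots> = (LINT t|leb01. \<bar>G l t\<bar> powr q / S powr q)" by (simp add: I_def)
      also have "\<dots> = (LINT t|leb01. \<bar>G l t / S\<bar> powr q)" using S by (simp add: abs_divide powr_divide)
      finally show ?thesis .
    qed
    also have "\<dots> \<le> (LINT t|leb01. exp (- q) * (E (q / S) l t + E (- (q / S)) l t))"
    proof (rule integral_mono')
      show "\<bar>G l t / S\<bar> powr q \<le> exp (- q) * (E (q / S) l t + E (- (q / S)) l t)" for t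
        using powr_le_exp[of q "G l t / S"] q by (simp add: E_def)
      show "integrable leb01 (\<lambda>t. exp (- q) * (E (q / S) l t + E (- (q / S)) l t))" using Ei by simp
    qed (auto simp: E_def)
    also have "\<dots> = exp (- q) * ((LINT t|leb01. E (q / S) l t) + (LINT t|leb01. E (- (q / S)) l t))"
      using Ei by simp
    finally show "N \<le> S * (1 + exp (- q) * ((LINT t|leb01. E (q / S) l t) + (LINT t|leb01. E (- (q / S)) l t)))"
      using S by (simp add: divide_le_eq mult.commute)
  qed
  also have "\<dots> = S * (1 + exp (- q) * (sign_rows_mean m n (\<lambda>l. LINT t|leb01. E (q / S) l t)
      + sign_rows_mean m n (\<lambda>l. LINT t|leb01. E (- (q / S)) l t)))"
    by (simp only: sign_rows_mean_cmult sign_rows_mean_add sign_rows_mean_const)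
  also have "\<dots> \<le> S * (1 + exp (- q) * (exp (q / 2) + exp (q / 2)))"
    using S Em[of "q / S"] Em[of "- (q / S)"] by (intro mult_left_mono add_mono) auto
  also have "\<dots> = S * (1 + 2 * exp (- (q / 2)))" by (simp add: exp_add[symmetric] distrib_left)
  also have "\<dots> \<le> S * 3" using S q by (intro mult_left_mono) auto
  finally show ?thesis by (simp add: Geq S_def)
qed

section \<open>Integral operators with a kernel that is continuous in \<open>L\<^sub>2\<close>\<close>

text \<open>
  The map \<open>t \<mapsto> K\<^sub>t\<close> into \<open>L\<^sub>2\<close> is bounded by
  \<open>S\<close> and has modulus of continuity at most \<open>\<omega>\<close>.
\<close>

locale L2_continuous_kernel =
  fixes K :: "real \<Rightarrow> real \<Rightarrow> real" and \<omega> :: "real \<Rightarrow> real" and S :: real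
  assumes sq_int: "t \<in> {0..1} \<Longrightarrow> square_integrable leb01 (K t)"
    and modulus: "s \<in> {0..1} \<Longrightarrow> t \<in> {0..1} \<Longrightarrow>
      L2_inner leb01 (\<lambda>x. K s x - K t x) (\<lambda>x. K s x - K t x) \<le> (\<omega> \<bar>s - t\<bar>)\<^sup>2"
    and bound: "t \<in> {0..1} \<Longrightarrow> L2_inner leb01 (K t) (K t) \<le> S\<^sup>2"
    and S_nonneg: "0 \<le> S"
    and modulus_mono: "0 \<le> a \<Longrightarrow> a \<le> b \<Longrightarrow> \<omega> a \<le> \<omega> b"
    and modulus_nonneg: "0 \<le> a \<Longrightarrow> 0 \<le> \<omega> a"
    and modulus_pos: "0 < a \<Longrightarrow> 0 < \<omega> a"
    and modulus_tendsto: "(\<omega> \<longlongrightarrow> 0) (at_right 0)"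
begin

abbreviation T where "T \<equiv> integral_operator K"

text \<open>
  The values of \<open>T f\<close> at every single point \<open>t\<close>, for a function
  \<open>f\<close> rather than its class. They depend continuously on \<open>t\<close>, so that sampling
  makes sense.
\<close>

definition TK :: "(real \<Rightarrow> real) \<Rightarrow> real \<Rightarrow> real" where
  "TK f t = L2_inner leb01 (K t) f"

lemma T_eq: "T f = abs_aefun (TK (rep_aefun f))"
  by (simp add: integral_operator_def TK_def[abs_def] L2_inner_def)

lemma modulus_small:
  assumes "0 < \<epsilon>"
  obtains \<delta> where "0 < \<delta>" "\<And>a. 0 \<le> a \<Longrightarrow> a < \<delta> \<Longrightarrow> \<omega> a < \<epsilon>"
proof -
  have "eventually (\<lambda>a. \<omega> a < \<epsilon>) (at_right 0)"
    using modulus_tendsto assms by (rule order_tendstoD)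
  then obtain d where d: "d > 0" "\<And>a. 0 < a \<Longrightarrow> a < d \<Longrightarrow> \<omega> a < \<epsilon>"
    by (auto simp: eventually_at_right_field)
  have "\<omega> a < \<epsilon>" if "0 \<le> a" "a < d" for a
    using d(2)[of "(a + d) / 2"] modulus_mono[of a "(a + d) / 2"] that d(1) by (simp add: field_simps)
  then show ?thesis using that d(1) by blast
qed

lemma TK_bound:
  assumes f: "square_integrable leb01 f" and N: "L2_inner leb01 f f \<le> N\<^sup>2" "0 \<le> N" and t: "t \<in> {0..1}"
  shows "\<bar>TK f t\<bar> \<le> S * N"
proof -
  have "(TK f t)\<^sup>2 \<le> L2_inner leb01 (K t) (K t) * L2_inner leb01 f f"
    unfolding TK_def by (rule L2_cauchy_schwarz[OF sq_int[OF t] f])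
  also have "\<dots> \<le> S\<^sup>2 * N\<^sup>2" using bound[OF t] N by (intro mult_mono L2_inner_self) auto
  finally have "\<bar>TK f t\<bar>\<^sup>2 \<le> (S * N)\<^sup>2" by (simp add: power_mult_distrib)
  then show ?thesis using S_nonneg N by (simp add: power2_le_iff_abs_le)
qed

lemma TK_modulus:
  assumes f: "square_integrable leb01 f" and N: "L2_inner leb01 f f \<le> N\<^sup>2" "0 \<le> N"
    and st: "s \<in> {0..1}" "t \<in> {0..1}"
  shows "\<bar>TK f s - TK f t\<bar> \<le> \<omega> \<bar>s - t\<bar> * N"
proof -
  have "TK f s - TK f t = L2_inner leb01 f (\<lambda>x. K s x - K t x)"
    using L2_inner_diff[OF f sq_int[OF st(1)] sq_int[OF st(2)]]
    by (simp add: TK_def L2_inner_commute[of leb01 "K s"] L2_inner_commute[of leb01 "K t"])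
  also have "(L2_inner leb01 f (\<lambda>x. K s x - K t x))\<^sup>2
      \<le> L2_inner leb01 f f * L2_inner leb01 (\<lambda>x. K s x - K t x) (\<lambda>x. K s x - K t x)"
    using st by (intro L2_cauchy_schwarz f square_integrable_diff sq_int)
  also have "\<dots> \<le> N\<^sup>2 * (\<omega> \<bar>s - t\<bar>)\<^sup>2"
    using modulus[OF st] N by (intro mult_mono L2_inner_self) auto
  finally have "\<bar>TK f s - TK f t\<bar>\<^sup>2 \<le> (\<omega> \<bar>s - t\<bar> * N)\<^sup>2" by (simp add: power_mult_distrib mult.commute)
  then show ?thesis using modulus_nonneg[of "\<bar>s - t\<bar>"] N by (simp add: power2_le_iff_abs_le)
qed

lemma TK_measurable:
  assumes f: "square_integrable leb01 f"
  shows "TK f \<in> borel_measurable leb01"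
proof -
  define N where "N = sqrt (L2_inner leb01 f f) + 1"
  have N: "L2_inner leb01 f f \<le> N\<^sup>2" "0 < N"
  proof -
    show "0 < N" using L2_inner_self(2)[of leb01 f] by (simp add: N_def add_nonneg_pos)
    have "(sqrt (L2_inner leb01 f f))\<^sup>2 \<le> N\<^sup>2"
      using L2_inner_self(2)[of leb01 f] by (intro power_mono) (auto simp: N_def)
    then show "L2_inner leb01 f f \<le> N\<^sup>2" using L2_inner_self(2)[of leb01 f] by simp
  qed
  have "continuous_on {0..1} (TK f)"
    unfolding continuous_on_iff
  proof (intro ballI allI impI)
    fix s e :: real assume s: "s \<in> {0..1}" and e: "0 < e"
    obtain d where d: "0 < d" "\<And>a. 0 \<le> a \<Longrightarrow> a < d \<Longrightarrow> \<omega> a < e / N"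
      using modulus_small[of "e / N"] e N by auto
    have "dist (TK f t) (TK f s) < e" if "t \<in> {0..1}" "dist t s < d" for t
    proof -
      have "\<bar>TK f t - TK f s\<bar> \<le> \<omega> \<bar>t - s\<bar> * N"
        using TK_modulus[OF f N(1) _ that(1) s] N(2) by simp
      also have "\<dots> < e" using d(2)[of "\<bar>t - s\<bar>"] that(2) N(2) by (simp add: dist_real_def field_simps)
      finally show ?thesis by (simp add: dist_real_def)
    qed
    then show "\<exists>d>0. \<forall>t\<in>{0..1}. dist t s < d \<longrightarrow> dist (TK f t) (TK f s) < e" using d(1) by blast
  qed
  then have "TK f \<in> borel_measurable (restrict_space borel {0..1})"
    by (rule borel_measurable_continuous_on_restrict)
  moreover have "borel_measurable (restrict_space borel {0..1}) = (borel_measurable leb01 :: (real \<Rightarrow> real) set)"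
    by (rule measurable_cong_sets[OF sets_restrict_space_cong[OF sets_lborel[symmetric]] refl])
  ultimately show ?thesis by simp
qed

lemma T_bounded:
  assumes q: "q \<ge> 1" and f: "f \<in> Lp 2"
  shows "T f \<in> Lp q" "Lp_norm q (T f) \<le> S * Lp_norm 2 f"
proof -
  note r = square_integrable_rep_aefun[OF f]
  have N: "0 \<le> Lp_norm 2 f" using seminorm_onD(2)[OF seminorm_on_Lp[of 2]] f by simp
  have b: "\<bar>TK (rep_aefun f) t\<bar> \<le> S * Lp_norm 2 f" if "t \<in> {0..1}" for t
    using TK_bound[OF r(1) _ N that] r(2) by simp
  show "T f \<in> Lp q" "Lp_norm q (T f) \<le> S * Lp_norm 2 f"
    unfolding T_eq using Lp_norm_le_bound[OF q TK_measurable[OF r(1)] _ b] S_nonneg N by simp_all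
qed

lemma T_bounded_operator:
  assumes q: "q \<ge> 1"
  shows "bounded_operator (Lp 2) (Lp_norm 2) (Lp q) (Lp_norm q) T"
proof -
  have eval: "T (abs_aefun h) = abs_aefun F"
    if h: "square_integrable leb01 h" and in_L2: "abs_aefun h \<in> Lp 2"
      and F: "F \<in> borel_measurable leb01" "\<And>t. t \<in> {0..1} \<Longrightarrow> TK h t = F t" for h F
  proof -
    have hm: "h \<in> borel_measurable leb01" using h by (simp add: square_integrable_def)
    have "TK (rep_aefun (abs_aefun h)) t = F t" if t: "t \<in> {0..1}" for t
      unfolding F(2)[OF t, symmetric] TK_def L2_inner_def
      using rep_abs_aefun[OF hm] sq_int[OF t] rep_aefun_measurable hm
      by (intro integral_cong_AE) (auto simp: square_integrable_def elim: eventually_mono)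
    then show ?thesis
      unfolding T_eq using TK_measurable[OF square_integrable_rep_aefun(1)[OF in_L2]] F(1)
      by (intro abs_aefun_eqI) (auto simp: space_leb01 intro!: AE_I2)
  qed
  note subsp = seminorm_onD(1)[OF seminorm_on_Lp[of 2], simplified]
  have add: "T (f + g) = T f + T g" if f: "f \<in> Lp 2" and g: "g \<in> Lp 2" for f g
  proof -
    note rf = square_integrable_rep_aefun(1)[OF f] and rg = square_integrable_rep_aefun(1)[OF g]
    have fg: "f + g = abs_aefun (\<lambda>x. rep_aefun f x + rep_aefun g x)"
      using abs_aefun_add[OF rep_aefun_measurable rep_aefun_measurable, of f g] by (simp add: abs_rep_aefun)
    have "T (f + g) = abs_aefun (\<lambda>t. TK (rep_aefun f) t + TK (rep_aefun g) t)"
    proof (unfold fg, rule eval)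
      show "square_integrable leb01 (\<lambda>x. rep_aefun f x + rep_aefun g x)"
        by (rule square_integrable_add[OF rf rg])
      show "abs_aefun (\<lambda>x. rep_aefun f x + rep_aefun g x) \<in> Lp 2"
        using subspace_add[OF subsp f g] by (simp add: fg)
      show "(\<lambda>t. TK (rep_aefun f) t + TK (rep_aefun g) t) \<in> borel_measurable leb01"
        by (intro borel_measurable_add TK_measurable rf rg)
    qed (simp add: TK_def L2_inner_add sq_int rf rg)
    then show ?thesis unfolding T_eq using TK_measurable[OF rf] TK_measurable[OF rg] by (simp add: abs_aefun_add)
  qed
  have scale: "T (a *\<^sub>R f) = a *\<^sub>R T f" if f: "f \<in> Lp 2" for f a
  proof -
    note rf = square_integrable_rep_aefun(1)[OF f]
    have fa: "a *\<^sub>R f = abs_aefun (\<lambda>x. a * rep_aefun f x)"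
      using abs_aefun_scale[OF rep_aefun_measurable, of a f] by (simp add: abs_rep_aefun)
    have "T (a *\<^sub>R f) = abs_aefun (\<lambda>t. a * TK (rep_aefun f) t)"
    proof (unfold fa, rule eval)
      show "square_integrable leb01 (\<lambda>x. a * rep_aefun f x)" by (rule square_integrable_scale[OF rf])
      show "abs_aefun (\<lambda>x. a * rep_aefun f x) \<in> Lp 2"
        using subspace_scale[OF subsp f, of a] by (simp add: fa)
      show "(\<lambda>t. a * TK (rep_aefun f) t) \<in> borel_measurable leb01" using TK_measurable[OF rf] by simp
    qed (simp add: TK_def L2_inner_scale)
    then show ?thesis unfolding T_eq using TK_measurable[OF rf] by (simp add: abs_aefun_scale)
  qed
  show ?thesis
    unfolding bounded_operator_def using T_bounded[OF q] add scale by blast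
qed

text \<open>
  The left end of the cell of length \<open>1/l\<close> that contains \<open>t\<close>.
\<close>

definition grid :: "nat \<Rightarrow> real \<Rightarrow> real" where
  "grid l t = real_of_int \<lfloor>l * t\<rfloor> / l"

lemma grid_bounds:
  assumes "l \<ge> 1" "t \<in> {0..1}"
  shows "grid l t \<in> {0..1}" "grid l t \<le> t" "t - 1 / l \<le> grid l t"
proof -
  have l: "0 < real l" using assms by simp
  have "real_of_int \<lfloor>l * t\<rfloor> \<le> l * t" "l * t - 1 \<le> real_of_int \<lfloor>l * t\<rfloor>" "0 \<le> \<lfloor>l * t\<rfloor>"
    using assms by (auto simp: mult_nonneg_nonneg)
  then have "(l * t - 1) / l \<le> grid l t" and le: "grid l t \<le> t" and "0 \<le> grid l t"
    using l unfolding grid_def by (auto intro!: divide_right_mono divide_nonneg_pos simp: divide_le_eq mult.commute)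
  then show "t - 1 / l \<le> grid l t" "grid l t \<in> {0..1}" "grid l t \<le> t"
    using l assms(2) by (auto simp: diff_divide_distrib)
qed

lemma grid_image:
  assumes "l \<ge> 1"
  shows "grid l ` {0..1} \<subseteq> (\<lambda>j. real j / l) ` {..l}"
proof
  fix y assume "y \<in> grid l ` {0..1}"
  then obtain t where t: "t \<in> {0..1}" "y = grid l t" by blast
  have "\<lfloor>l * t\<rfloor> \<le> \<lfloor>real l\<rfloor>" using t assms by (intro floor_mono) (auto simp: mult_left_le)
  then have "\<lfloor>l * t\<rfloor> \<le> int l" "0 \<le> \<lfloor>l * t\<rfloor>" using t by auto
  then show "y \<in> (\<lambda>j. real j / l) ` {..l}"
    by (intro image_eqI[of _ _ "nat \<lfloor>l * t\<rfloor>"]) (auto simp: t grid_def)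
qed

lemma grid_measurable: "(\<lambda>t. F (grid l t)) \<in> borel_measurable leb01" for F :: "real \<Rightarrow> real"
proof -
  have "(\<lambda>t::real. (\<lambda>j. F (real_of_int j / l)) \<lfloor>l * t\<rfloor>) \<in> borel_measurable borel"
    by (rule measurable_compose[of "\<lambda>t::real. \<lfloor>l * t\<rfloor>" borel "count_space UNIV"]) auto
  then show ?thesis unfolding grid_def by (intro measurable_restrict_space1) auto
qed

text \<open>
  The point \<open>t = 1\<close> is a grid point of its own, so functions of the grid point are
  combinations of \<open>l + 1\<close> step functions.
\<close>

lemma grid_step_span:
  fixes F :: "real \<Rightarrow> real"
  assumes l: "l \<ge> 1"
  shows "abs_aefun (\<lambda>t. F (grid l t)) \<in> span ((\<lambda>j. abs_aefun (\<lambda>t. if grid l t = real j / l then 1 else 0)) ` {..l})"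
proof -
  define b where "b j t = (if grid l t = real j / l then 1 else 0 :: real)" for j t
  have bm: "b j \<in> borel_measurable leb01" for j
    unfolding b_def by (rule grid_measurable[of "\<lambda>y. if y = real j / l then 1 else 0"])
  have "F (grid l t) = (\<Sum>j\<le>l. F (real j / l) * b j t)" if t: "t \<in> {0..1}" for t
  proof -
    obtain i where i: "i \<le> l" "grid l t = real i / l" using grid_image[OF l] t by blast
    have "(\<Sum>j\<le>l. F (real j / l) * b j t) = (\<Sum>j\<le>l. if j = i then F (real i / l) else 0)"
      using l i by (intro sum.cong) (auto simp: b_def)
    also have "\<dots> = F (grid l t)" using i by simp
    finally show ?thesis by simp
  qed
  then have "abs_aefun (\<lambda>t. F (grid l t)) = abs_aefun (\<lambda>t. \<Sum>j\<le>l. F (real j / l) * b j t)"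
    using bm by (intro abs_aefun_eqI grid_measurable) (auto simp: space_leb01 intro!: AE_I2)
  also have "\<dots> = (\<Sum>j\<le>l. F (real j / l) *\<^sub>R abs_aefun (b j))"
    using bm by (subst abs_aefun_sum[symmetric]) (simp_all add: abs_aefun_scale)
  also have "\<dots> \<in> span ((\<lambda>j. abs_aefun (b j)) ` {..l})"
    by (intro span_sum span_scale span_base) auto
  finally show ?thesis unfolding b_def[abs_def] .
qed

text \<open>
  \<open>T f\<close> is split into three parts: its samples on the grid of width \<open>1/l\<close>,
  which span at most \<open>l + 1\<close> dimensions; the difference between its samples on a fine grid
  of width \<open>1/N\<close> and on the coarse one; and the difference between \<open>T f\<close> and
  its fine samples, which is uniformly small for large \<open>N\<close>. The middle part involves only
  finitely many \<open>K\<^sub>s\<close>, hence an orthonormal system \<open>e\<^sub>0, \<dots>,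
  e\<^bsub>m-1\<^esub>\<close>, and it maps \<open>e\<^sub>k\<close> to \<open>h\<^sub>k\<close>.
  Bessel's inequality bounds \<open>\<Sum>h\<^sub>k(t)\<^sup>2\<close> by
  \<open>\<omega>(1/l)\<^sup>2\<close>, and the random subspace of dimension \<open>l\<close>
  approximates it with the gain \<open>\<surd>q/\<surd>l\<close>.
\<close>

theorem kolmogorov_approximation:
  assumes q: "q \<ge> 1" and l: "l \<ge> 1"
  obtains B where "finite B" "card B \<le> 2 * l + 1" "B \<subseteq> Lp q"
    "\<And>f. f \<in> unit_ball (Lp 2) (Lp_norm 2) \<Longrightarrow>
      \<exists>g\<in>span B. Lp_norm q (T f - g) \<le> 20 * (sqrt q * (\<omega> (1 / l) / sqrt l))"
proof -
  define \<sigma> where "\<sigma> = \<omega> (1 / l)"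
  have \<sigma>: "\<sigma> > 0" unfolding \<sigma>_def using l by (intro modulus_pos) simp
  define \<epsilon> where "\<epsilon> = sqrt q * (\<sigma> / sqrt l)"
  have \<epsilon>: "\<epsilon> > 0" using q l \<sigma> by (simp add: \<epsilon>_def)
  obtain \<delta> where \<delta>: "0 < \<delta>" "\<And>a. 0 \<le> a \<Longrightarrow> a < \<delta> \<Longrightarrow> \<omega> a < \<epsilon>"
    using modulus_small[OF \<epsilon>] by blast
  obtain N0 :: nat where N0: "1 / \<delta> < real N0" using reals_Archimedean2 by blast
  define N where "N = max l N0"
  have N: "N \<ge> 1" "N \<ge> l" "1 / \<delta> < real N" using l N0 by (auto simp: N_def)
  have \<omega>N: "\<omega> (1 / N) < \<epsilon>"
    using N(1,3) \<delta>(1) by (intro \<delta>(2)) (auto simp: field_simps)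
  define P where "P = grid N ` {0..1} \<union> grid l ` {0..1}"
  have finP: "finite P"
    unfolding P_def using finite_subset[OF grid_image[OF N(1)]] finite_subset[OF grid_image[OF l]] by simp
  then obtain p and M :: nat where p: "P = p ` {i. i < M}" by (auto simp: finite_conv_nat_seg_image)
  have P01: "P \<subseteq> {0..1}" unfolding P_def using grid_bounds(1)[OF N(1)] grid_bounds(1)[OF l] by blast
  obtain e and m :: nat where e: "\<And>k. k < m \<Longrightarrow> square_integrable leb01 (e k)"
    and on: "\<And>k l. k < m \<Longrightarrow> l < m \<Longrightarrow> L2_inner leb01 (e k) (e l) = (if k = l then 1 else 0)"
    and exp: "\<And>f j. square_integrable leb01 f \<Longrightarrow> j < M \<Longrightarrow>
      L2_inner leb01 f (K (p j)) = (\<Sum>k<m. L2_inner leb01 f (e k) * L2_inner leb01 (K (p j)) (e k))"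
  proof -
    have "square_integrable leb01 (K (p j))" if "j < M" for j
      using that p P01 by (intro sq_int) auto
    then show thesis using L2_gram_schmidt[of M leb01 "\<lambda>j. K (p j)"] that by blast
  qed
  define h where "h k t = L2_inner leb01 (K (grid N t)) (e k) - L2_inner leb01 (K (grid l t)) (e k)" for k t
  have hm: "h k \<in> borel_measurable leb01" for k
    unfolding h_def
    by (intro borel_measurable_diff grid_measurable[where F = "\<lambda>y. L2_inner leb01 (K y) (e k)"])
  have gd: "grid N t \<in> {0..1}" "grid l t \<in> {0..1}" "\<bar>grid N t - grid l t\<bar> \<le> 1 / l" if "t \<in> {0..1}" for t
  proof -
    have "1 / real N \<le> 1 / l" using N l by (simp add: frac_le)
    then show "grid N t \<in> {0..1}" "grid l t \<in> {0..1}" "\<bar>grid N t - grid l t\<bar> \<le> 1 / l"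
      using grid_bounds[OF N(1) that] grid_bounds[OF l that] by auto
  qed
  have h\<sigma>: "(\<Sum>k<m. (h k t)\<^sup>2) \<le> \<sigma>\<^sup>2" if t: "t \<in> {0..1}" for t
  proof -
    let ?d = "\<lambda>x. K (grid N t) x - K (grid l t) x"
    note sq = sq_int[OF gd(1)[OF t]] sq_int[OF gd(2)[OF t]]
    have "h k t = L2_inner leb01 ?d (e k)" if "k < m" for k
      unfolding h_def using L2_inner_diff[OF e[OF that] sq]
      by (simp add: L2_inner_commute[of leb01 "e k"])
    then have "(\<Sum>k<m. (h k t)\<^sup>2) = (\<Sum>k<m. (L2_inner leb01 ?d (e k))\<^sup>2)" by simp
    also have "\<dots> \<le> L2_inner leb01 ?d ?d"
      by (rule L2_bessel[where m = m, OF square_integrable_diff[OF sq] e on])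
    also have "\<dots> \<le> (\<omega> \<bar>grid N t - grid l t\<bar>)\<^sup>2" by (rule modulus[OF gd(1,2)[OF t]])
    also have "\<dots> \<le> \<sigma>\<^sup>2"
      unfolding \<sigma>_def using gd(3)[OF t] by (intro power_mono modulus_mono modulus_nonneg) auto
    finally show ?thesis .
  qed
  define H where "H k = abs_aefun (h k)" for k
  have HY: "H k \<in> Lp q" if "k < m" for k
  proof -
    have "\<bar>h k t\<bar> \<le> \<sigma>" if "t \<in> {0..1}" for t
    proof -
      have "(h k t)\<^sup>2 \<le> (\<Sum>k<m. (h k t)\<^sup>2)" using \<open>k < m\<close> by (intro member_le_sum) auto
      then have "\<bar>h k t\<bar>\<^sup>2 \<le> \<sigma>\<^sup>2" using h\<sigma>[OF that] by simp
      then show ?thesis using \<sigma> by (simp add: power2_le_iff_abs_le)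
    qed
    then show ?thesis unfolding H_def using \<sigma> by (intro Lp_norm_le_bound(1)[OF q hm, of \<sigma>]) auto
  qed
  have mean: "sign_rows_mean m l (\<lambda>r. Lp_norm q (\<Sum>\<phi>\<leftarrow>r. \<Sum>k<m. \<phi> k *\<^sub>R H k)) \<le> 3 * (sqrt (q * l) * \<sigma>)"
    unfolding H_def by (rule sign_rows_mean_Lp_norm[OF q l \<sigma> hm h\<sigma>])
  obtain B0 where B0: "finite B0" "card B0 \<le> l" "B0 \<subseteq> Lp q"
    "\<And>a. (\<Sum>k<m. (a k)\<^sup>2) \<le> 1 \<Longrightarrow>
      \<exists>g\<in>span B0. Lp_norm q ((\<Sum>k<m. a k *\<^sub>R H k) - g) \<le> 6 * (3 * (sqrt (q * l) * \<sigma>)) / l + \<epsilon>"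
    using low_dimensional_approximation[OF seminorm_on_Lp[OF q] HY l \<epsilon> mean] by blast
  have err: "6 * (3 * (sqrt (q * l) * \<sigma>)) / l = 18 * \<epsilon>"
  proof -
    have "sqrt (q * l) * \<sigma> / l = sqrt q * \<sigma> * (sqrt l / l)" by (simp add: real_sqrt_mult)
    also have "sqrt l / l = 1 / sqrt l" by (simp add: sqrt_divide_self_eq inverse_eq_divide)
    also have "sqrt q * \<sigma> * (1 / sqrt l) = \<epsilon>" by (simp add: \<epsilon>_def)
    finally show ?thesis by simp
  qed
  define B1 where "B1 = (\<lambda>j. abs_aefun (\<lambda>t. if grid l t = real j / l then 1 else 0)) ` {..l}"
  have B1Y: "B1 \<subseteq> Lp q"
    unfolding B1_def
    by (auto intro!: Lp_norm_le_bound(1)[OF q _ zero_le_one] grid_measurable[of "\<lambda>y. if y = real _ / l then 1 else 0"])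
  show ?thesis
  proof
    show "finite (B0 \<union> B1)" using B0(1) by (simp add: B1_def)
    have "card B1 \<le> l + 1" unfolding B1_def using card_image_le[of "{..l}"] by simp
    then show "card (B0 \<union> B1) \<le> 2 * l + 1" using B0(2) card_Un_le[of B0 B1] by linarith
    show "B0 \<union> B1 \<subseteq> Lp q" using B0(3) B1Y by simp
    fix f assume "f \<in> unit_ball (Lp 2) (Lp_norm 2)"
    then have f: "f \<in> Lp 2" "Lp_norm 2 f \<le> 1" by (auto simp: unit_ball_def)
    define \<phi> where "\<phi> = rep_aefun f"
    have \<phi>: "square_integrable leb01 \<phi>" unfolding \<phi>_def by (rule square_integrable_rep_aefun(1)[OF f(1)])
    have \<phi>1: "L2_inner leb01 \<phi> \<phi> \<le> 1\<^sup>2"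
      using square_integrable_rep_aefun(2)[OF f(1)] f(2) seminorm_onD(2)[OF seminorm_on_Lp[of 2]] f(1)
      by (simp add: \<phi>_def power_le_one)
    define a where "a k = L2_inner leb01 \<phi> (e k)" for k
    have "(\<Sum>k<m. (a k)\<^sup>2) \<le> 1" using L2_bessel[where m = m, OF \<phi> e on] \<phi>1 by (simp add: a_def)
    then obtain g where g: "g \<in> span B0" "Lp_norm q ((\<Sum>k<m. a k *\<^sub>R H k) - g) \<le> 18 * \<epsilon> + \<epsilon>"
      using B0(4) unfolding err by blast
    have TKP: "TK \<phi> s = (\<Sum>k<m. a k * L2_inner leb01 (K s) (e k))" if "s \<in> P" for s
    proof -
      obtain j where "j < M" "s = p j" using \<open>s \<in> P\<close> p by blast
      then show ?thesis using exp[OF \<phi>, of j] by (simp add: TK_def a_def L2_inner_commute[of leb01 "K (p j)" \<phi>])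
    qed
    define A where "A = abs_aefun (\<lambda>t. TK \<phi> t - TK \<phi> (grid N t))"
    have Am: "(\<lambda>t. TK \<phi> t - TK \<phi> (grid N t)) \<in> borel_measurable leb01"
      by (intro borel_measurable_diff TK_measurable[OF \<phi>] grid_measurable)
    have "\<bar>TK \<phi> t - TK \<phi> (grid N t)\<bar> \<le> \<epsilon>" if t: "t \<in> {0..1}" for t
    proof -
      have "\<bar>TK \<phi> t - TK \<phi> (grid N t)\<bar> \<le> \<omega> \<bar>t - grid N t\<bar> * 1"
        using \<phi>1 by (intro TK_modulus[OF \<phi>] t gd(1)) auto
      also have "\<omega> \<bar>t - grid N t\<bar> \<le> \<omega> (1 / N)"
        using grid_bounds[OF N(1) t] by (intro modulus_mono) auto
      finally show ?thesis using \<omega>N by simp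
    qed
    then have A: "A \<in> Lp q" "Lp_norm q A \<le> \<epsilon>"
      unfolding A_def using Lp_norm_le_bound[OF q Am, of \<epsilon>] \<epsilon> by auto
    have split: "T f = A + (\<Sum>k<m. a k *\<^sub>R H k) + abs_aefun (\<lambda>t. TK \<phi> (grid l t))"
    proof -
      have "(\<Sum>k<m. a k *\<^sub>R H k) = abs_aefun (\<lambda>t. \<Sum>k<m. a k * h k t)"
        unfolding H_def using hm by (subst abs_aefun_sum[symmetric]) (simp_all add: abs_aefun_scale)
      moreover have "(\<lambda>t. \<Sum>k<m. a k * h k t) \<in> borel_measurable leb01" using hm by simp
      moreover have "(\<lambda>t. TK \<phi> (grid l t)) \<in> borel_measurable leb01" by (rule grid_measurable)
      ultimately have "A + (\<Sum>k<m. a k *\<^sub>R H k) + abs_aefun (\<lambda>t. TK \<phi> (grid l t))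
          = abs_aefun (\<lambda>t. (TK \<phi> t - TK \<phi> (grid N t)) + (\<Sum>k<m. a k * h k t) + TK \<phi> (grid l t))"
        using Am by (simp add: A_def abs_aefun_add)
      also have "\<dots> = abs_aefun (TK \<phi>)"
      proof (rule abs_aefun_eqI)
        show "(\<lambda>t. (TK \<phi> t - TK \<phi> (grid N t)) + (\<Sum>k<m. a k * h k t) + TK \<phi> (grid l t)) \<in> borel_measurable leb01"
          using Am hm grid_measurable[of "TK \<phi>" l] by simp
        show "AE t in leb01. TK \<phi> t - TK \<phi> (grid N t) + (\<Sum>k<m. a k * h k t) + TK \<phi> (grid l t) = TK \<phi> t"
        proof (rule AE_I2)
          fix t assume "t \<in> space leb01"
          then have "grid N t \<in> P" "grid l t \<in> P" by (auto simp: P_def space_leb01)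
          then show "TK \<phi> t - TK \<phi> (grid N t) + (\<Sum>k<m. a k * h k t) + TK \<phi> (grid l t) = TK \<phi> t"
            by (simp add: TKP h_def right_diff_distrib sum_subtractf)
        qed
      qed (rule TK_measurable[OF \<phi>])
      finally show ?thesis by (simp add: T_eq \<phi>_def)
    qed
    let ?g = "abs_aefun (\<lambda>t. TK \<phi> (grid l t)) + g"
    note Y = seminorm_onD[OF seminorm_on_Lp[OF q]]
    have "T f - ?g = A + ((\<Sum>k<m. a k *\<^sub>R H k) - g)" by (simp add: split)
    also have "Lp_norm q \<dots> \<le> Lp_norm q A + Lp_norm q ((\<Sum>k<m. a k *\<^sub>R H k) - g)"
    proof (rule Y(3)[OF A(1)])
      have "g \<in> Lp q" using g(1) B0(3) Y(1) span_minimal by blast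
      then show "(\<Sum>k<m. a k *\<^sub>R H k) - g \<in> Lp q"
        using HY by (intro subspace_diff subspace_sum subspace_scale Y(1)) auto
    qed
    also have "\<dots> \<le> 20 * \<epsilon>" using A(2) g(2) by simp
    finally have "Lp_norm q (T f - ?g) \<le> 20 * \<epsilon>" .
    moreover have "?g \<in> span (B0 \<union> B1)"
    proof (rule span_add)
      show "abs_aefun (\<lambda>t. TK \<phi> (grid l t)) \<in> span (B0 \<union> B1)"
        using grid_step_span[OF l, of "TK \<phi>"] span_mono[of B1 "B0 \<union> B1"] unfolding B1_def by blast
      show "g \<in> span (B0 \<union> B1)" using g(1) span_mono[of B0 "B0 \<union> B1"] by blast
    qed
    ultimately show "\<exists>g\<in>span (B0 \<union> B1). Lp_norm q (T f - g) \<le> 20 * (sqrt q * (\<omega> (1 / l) / sqrt l))"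
      unfolding \<epsilon>_def \<sigma>_def by blast
  qed
qed

end

section \<open>Packing and covering in finite dimensional spaces\<close>

text \<open>
  A finite expansion in base \<open>1/s\<close> with the vectors \<open>x i\<close> as digits.
\<close>

primrec digit_sum :: "real \<Rightarrow> (nat \<Rightarrow> 'b::real_vector) \<Rightarrow> nat list \<Rightarrow> 'b" where
  "digit_sum s x [] = 0"
| "digit_sum s x (i # w) = x i + s *\<^sub>R digit_sum s x w"

text \<open>
  The usual comparison of volumes is replaced by counting. With \<open>s = t/4\<close> the
  \<open>M\<^sup>k\<close> digit sums of length \<open>k\<close> are separated by \<open>s\<^sup>k
  t/3\<close>, because the tail of a digit sum after its first digit has norm at most \<open>s \<cdot>
  4/3\<close>. Their coordinates stay in a fixed bounded region, so by the pigeonhole principle there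
  are at most \<open>(A / s\<^sup>k)\<^sup>d\<close> of them for a constant \<open>A\<close> that
  depends on the points but not on \<open>k\<close>. Letting \<open>k\<close> grow gives \<open>M \<le>
  (1/s)\<^sup>d\<close>; the constant disappears.
\<close>

lemma packing_bound:
  fixes x :: "nat \<Rightarrow> 'b::real_vector" and b :: "nat \<Rightarrow> 'b"
  assumes N: "seminorm_on Y nY" and b: "\<And>r. r < d \<Longrightarrow> b r \<in> Y"
    and x: "\<And>i. i < M \<Longrightarrow> x i = (\<Sum>r<d. c i r *\<^sub>R b r)"
    and ball: "\<And>i. i < M \<Longrightarrow> nY (x i) \<le> 1"
    and sep: "\<And>i j. i < M \<Longrightarrow> j < M \<Longrightarrow> i \<noteq> j \<Longrightarrow> t \<le> nY (x i - x j)"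
    and t: "0 < t" "t \<le> 1"
  shows "real M \<le> (4 / t) ^ d"
proof -
  note Y = seminorm_onD[OF N]
  define s where "s = t / 4"
  have s: "0 < s" "s \<le> 1 / 4" using t by (simp_all add: s_def)
  define C where "C = 1 + (\<Sum>i<M. \<Sum>r<d. \<bar>c i r\<bar>)"
  have C: "C \<ge> 1" by (simp add: C_def sum_nonneg)
  have cC: "\<bar>c i r\<bar> \<le> C" if "i < M" "r < d" for i r
  proof -
    have "\<bar>c i r\<bar> \<le> (\<Sum>r<d. \<bar>c i r\<bar>)" using that by (intro member_le_sum) auto
    also have "\<dots> \<le> (\<Sum>i<M. \<Sum>r<d. \<bar>c i r\<bar>)" using that by (intro member_le_sum) (auto intro: sum_nonneg)
    finally show ?thesis by (simp add: C_def)
  qed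
  define \<beta> where "\<beta> = 1 + (\<Sum>r<d. nY (b r))"
  have \<beta>: "(\<Sum>r<d. nY (b r)) < \<beta>" "\<beta> > 0"
    using b Y(2) by (auto simp: \<beta>_def intro!: add_pos_nonneg sum_nonneg)
  define y where "y = digit_sum s x"
  define cc where "cc w r = digit_sum s (\<lambda>i. c i r) w" for w r
  have y_simps: "y [] = 0" "y (i # w) = x i + s *\<^sub>R y w" for i w by (simp_all add: y_def)
  have cc_simps: "cc [] r = 0" "cc (i # w) r = c i r + s * cc w r" for i w r by (simp_all add: cc_def)
  have xY: "x i \<in> Y" if "i < M" for i
    using x[OF that] b by (auto intro!: subspace_sum subspace_scale Y(1))
  have y: "y w \<in> Y \<and> nY (y w) \<le> 4 / 3 \<and> y w = (\<Sum>r<d. cc w r *\<^sub>R b r)" if "set w \<subseteq> {..<M}" for w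
    using that
  proof (induction w)
    case Nil
    then show ?case using Y(1,5) by (simp add: y_simps cc_simps subspace_0)
  next
    case (Cons i w)
    then have i: "i < M" and w: "y w \<in> Y" "nY (y w) \<le> 4 / 3" "y w = (\<Sum>r<d. cc w r *\<^sub>R b r)" by auto
    have "nY (y (i # w)) \<le> nY (x i) + nY (s *\<^sub>R y w)"
      unfolding y_simps using xY[OF i] w(1) by (intro Y(3) subspace_scale Y(1))
    also have "nY (s *\<^sub>R y w) = s * nY (y w)" using Y(4)[OF w(1)] s by simp
    also have "nY (x i) + s * nY (y w) \<le> 1 + (1 / 4) * (4 / 3)"
      using ball[OF i] w s Y(2) by (intro add_mono mult_mono) auto
    finally have "nY (y (i # w)) \<le> 4 / 3" by simp
    moreover have "y (i # w) = (\<Sum>r<d. cc (i # w) r *\<^sub>R b r)"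
      unfolding y_simps cc_simps x[OF i] w(3)
      by (simp add: scaleR_add_left sum.distrib scaleR_sum_right)
    moreover have "y (i # w) \<in> Y"
      unfolding y_simps using xY[OF i] w(1) by (intro subspace_add subspace_scale Y(1))
    ultimately show ?case by simp
  qed
  have cc_bound: "\<bar>cc w r\<bar> \<le> 2 * C" if "set w \<subseteq> {..<M}" "r < d" for w r
    using that(1)
  proof (induction w)
    case Nil
    then show ?case using C by (simp add: cc_simps)
  next
    case (Cons i w)
    have "\<bar>cc (i # w) r\<bar> \<le> \<bar>c i r\<bar> + s * \<bar>cc w r\<bar>"
      unfolding cc_simps using abs_triangle_ineq[of "c i r" "s * cc w r"] s by (simp add: abs_mult)
    also have "\<dots> \<le> C + (1 / 4) * (2 * C)"
      using Cons cC[of i r] that(2) s C by (intro add_mono mult_mono) auto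
    finally show ?case using C by simp
  qed
  have y_sep: "s ^ k * (t / 3) \<le> nY (y w - y w')"
    if "set w \<subseteq> {..<M}" "set w' \<subseteq> {..<M}" "length w = k" "length w' = k" "w \<noteq> w'" for k w w'
    using that
  proof (induction k arbitrary: w w')
    case 0
    then show ?case by simp
  next
    case (Suc k)
    obtain i v where w: "w = i # v" using Suc.prems(3) by (cases w) auto
    obtain i' v' where w': "w' = i' # v'" using Suc.prems(4) by (cases w') auto
    have v: "set v \<subseteq> {..<M}" "set v' \<subseteq> {..<M}" "i < M" "i' < M" using Suc.prems w w' by auto
    note yv = y[OF v(1)] and yv' = y[OF v(2)]
    have dY: "y v - y v' \<in> Y" using yv yv' by (intro subspace_diff Y(1)) auto
    show ?case
    proof (cases "i = i'")
      case True
      have "s ^ k * (t / 3) \<le> nY (y v - y v')"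
        using Suc.prems w w' True v by (intro Suc.IH) auto
      then have "s * (s ^ k * (t / 3)) \<le> s * nY (y v - y v')" using s by (intro mult_left_mono) auto
      also have "\<dots> = nY (s *\<^sub>R (y v - y v'))" using Y(4)[OF dY] s by simp
      also have "s *\<^sub>R (y v - y v') = y w - y w'" by (simp add: w w' True y_simps scaleR_diff_right)
      finally show ?thesis by (simp add: mult.assoc)
    next
      case False
      have d: "nY (y v - y v') \<le> 8 / 3"
      proof -
        have v: "y v \<in> Y" "nY (y v) \<le> 4 / 3" "y v' \<in> Y" "nY (y v') \<le> 4 / 3" using yv yv' by blast+
        then show ?thesis
          using Y(3)[of "y v" "- y v'"] Y(6)[of "y v'"] subspace_neg[OF Y(1), of "y v'"] by simp
      qed
      have "t \<le> nY (x i - x i')" using sep v False by blast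
      also have "x i - x i' = (y w - y w') + (- s) *\<^sub>R (y v - y v')"
        by (simp add: w w' y_simps algebra_simps)
      also have "nY \<dots> \<le> nY (y w - y w') + nY ((- s) *\<^sub>R (y v - y v'))"
      proof (intro Y(3) subspace_diff subspace_scale Y(1) dY)
        show "y v \<in> Y" "y v' \<in> Y" using yv yv' by blast+
        show "y w \<in> Y" "y w' \<in> Y" using y[OF Suc.prems(1)] y[OF Suc.prems(2)] by blast+
      qed
      also have "nY ((- s) *\<^sub>R (y v - y v')) = s * nY (y v - y v')" unfolding Y(4)[OF dY] using s by simp
      also have "\<dots> \<le> s * (8 / 3)" using d s by (intro mult_left_mono) auto
      finally have "t / 3 \<le> nY (y w - y w')" by (simp add: s_def)
      moreover have "s ^ Suc k * (t / 3) \<le> 1 * (t / 3)"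
        using s t by (intro mult_right_mono power_le_one) auto
      ultimately show ?thesis by simp
    qed
  qed
  define A where "A = 12 * C * \<beta> / t + 5"
  have key: "(real M * s ^ d) ^ k \<le> A ^ d" for k
  proof -
    define W where "W = {w. set w \<subseteq> {..<M} \<and> length w = k}"
    \<comment> \<open>Cells of side \<open>\<eta>\<close> in coordinate space are too small to contain two of the sums.\<close>
    define \<eta> where "\<eta> = s ^ k * (t / 3) / \<beta>"
    have \<eta>: "\<eta> > 0" using s t \<beta> by (simp add: \<eta>_def)
    define L where "L = \<lceil>2 * C / \<eta>\<rceil>"
    have L0: "L \<ge> 0" 
    proof -
      have "0 \<le> 2 * C / \<eta>" using C \<eta> by (intro divide_nonneg_pos) auto
      then show ?thesis using ceiling_mono[of 0 "2 * C / \<eta>"] by (simp add: L_def)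
    qed
    define \<Phi> where "\<Phi> w = restrict (\<lambda>r. \<lfloor>cc w r / \<eta>\<rfloor>) {..<d}" for w
    have "\<Phi> ` W \<subseteq> PiE {..<d} (\<lambda>_. {-L..L})"
    proof
      fix z assume "z \<in> \<Phi> ` W"
      then obtain w where w: "w \<in> W" "z = \<Phi> w" by blast
      have "\<lfloor>cc w r / \<eta>\<rfloor> \<in> {-L..L}" if r: "r < d" for r
      proof -
        have "\<bar>cc w r / \<eta>\<bar> \<le> 2 * C / \<eta>"
          using cc_bound[of w r] w r \<eta> by (auto simp: W_def divide_right_mono)
        also have "\<dots> \<le> of_int L" by (simp add: L_def)
        finally have "- of_int L \<le> cc w r / \<eta>" "cc w r / \<eta> \<le> of_int L" by linarith+
        then show ?thesis by (simp add: le_floor_iff floor_le_iff)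
      qed
      then show "z \<in> PiE {..<d} (\<lambda>_. {-L..L})" by (auto simp: w \<Phi>_def)
    qed
    moreover have "inj_on \<Phi> W"
    proof (rule inj_onI, rule ccontr)
      fix w w' assume w: "w \<in> W" "w' \<in> W" "\<Phi> w = \<Phi> w'" "w \<noteq> w'"
      have yw: "y w = (\<Sum>r<d. cc w r *\<^sub>R b r)" "y w' = (\<Sum>r<d. cc w' r *\<^sub>R b r)"
        using y w by (auto simp: W_def)
      have close: "\<bar>cc w r - cc w' r\<bar> \<le> \<eta>" if "r < d" for r
      proof -
        have "\<lfloor>cc w r / \<eta>\<rfloor> = \<lfloor>cc w' r / \<eta>\<rfloor>"
          using fun_cong[OF w(3), of r] that by (simp add: \<Phi>_def)
        then have "\<bar>cc w r / \<eta> - cc w' r / \<eta>\<bar> \<le> 1" by linarith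
        then have "\<bar>(cc w r - cc w' r) / \<eta>\<bar> \<le> 1" by (simp add: diff_divide_distrib)
        then show ?thesis using \<eta> by (simp add: abs_divide divide_le_eq)
      qed
      have nsum: "nY (\<Sum>r\<in>R. a r *\<^sub>R b r) \<le> (\<Sum>r\<in>R. \<bar>a r\<bar> * nY (b r))" if "finite R" "R \<subseteq> {..<d}" for a R
        using that
      proof (induction R rule: finite_induct)
        case empty
        show ?case using Y(5) by simp
      next
        case (insert r R)
        have "nY (a r *\<^sub>R b r + (\<Sum>r\<in>R. a r *\<^sub>R b r)) \<le> nY (a r *\<^sub>R b r) + nY (\<Sum>r\<in>R. a r *\<^sub>R b r)"
          using insert.prems b by (intro Y(3) subspace_sum subspace_scale Y(1)) auto
        then show ?case using insert b Y(4)[of "b r" "a r"] by simp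
      qed
      have "s ^ k * (t / 3) \<le> nY (y w - y w')" using y_sep w by (auto simp: W_def)
      also have "y w - y w' = (\<Sum>r<d. (cc w r - cc w' r) *\<^sub>R b r)"
        unfolding yw by (simp add: scaleR_diff_left sum_subtractf)
      also have "nY \<dots> \<le> (\<Sum>r<d. \<bar>cc w r - cc w' r\<bar> * nY (b r))" by (rule nsum) auto
      also have "\<dots> \<le> (\<Sum>r<d. \<eta> * nY (b r))"
        using close b Y(2) by (intro sum_mono mult_right_mono) auto
      also have "\<dots> < \<eta> * \<beta>" unfolding sum_distrib_left[symmetric] using \<beta> \<eta> by (intro mult_strict_left_mono)
      also have "\<dots> = s ^ k * (t / 3)" using \<beta> by (simp add: \<eta>_def)
      finally show False by simp
    qed
    ultimately have "card W \<le> card (PiE {..<d} (\<lambda>_. {-L..L}))"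
      by (intro card_inj_on_le[of \<Phi>] finite_PiE) auto
    then have "M ^ k \<le> nat (2 * L + 1) ^ d"
      using card_lists_length_eq[of "{..<M}" k] by (simp add: W_def card_PiE)
    then have "real M ^ k \<le> real (nat (2 * L + 1)) ^ d" using of_nat_le_iff[where ?'a = real] by (metis of_nat_power)
    also have "real (nat (2 * L + 1)) = 2 * of_int L + 1" using L0 by simp
    also have "(2 * of_int L + 1) ^ d \<le> (A / s ^ k) ^ d"
    proof (rule power_mono)
      have sk: "0 < s ^ k" "s ^ k \<le> 1" using s by (auto intro: power_le_one)
      have "of_int L \<le> 2 * C / \<eta> + 1" by (simp add: L_def)
      then have "2 * of_int L + 1 \<le> 4 * C / \<eta> + 3 * 1" by simp
      also have "4 * C / \<eta> = 12 * C * \<beta> / t / s ^ k" using t \<beta> sk by (simp add: \<eta>_def mult_ac)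
      also have "12 * C * \<beta> / t / s ^ k + 3 * 1 \<le> 12 * C * \<beta> / t / s ^ k + 5 / s ^ k"
        using sk by (simp add: pos_le_divide_eq)
      also have "\<dots> = A / s ^ k" by (simp add: A_def add_divide_distrib)
      finally show "2 * real_of_int L + 1 \<le> A / s ^ k" .
    qed (use L0 in simp)
    finally have "real M ^ k * (s ^ k) ^ d \<le> A ^ d" using s by (simp add: power_divide field_simps)
    then show ?thesis by (simp add: power_mult_distrib power_mult[symmetric] mult.commute)
  qed
  have "real M * s ^ d \<le> 1"
  proof (rule ccontr)
    assume "\<not> ?thesis"
    then obtain k where "A ^ d < (real M * s ^ d) ^ k" using real_arch_pow by fastforce
    then show False using key[of k] by simp
  qed
  then show ?thesis using s t by (simp add: s_def power_divide field_simps)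
qed

lemma separated_set_card:
  assumes N: "seminorm_on Y nY" and B: "finite B" "B \<subseteq> Y"
    and S: "finite S" "S \<subseteq> span B" "\<And>v. v \<in> S \<Longrightarrow> nY v \<le> 1"
    and sep: "\<And>v w. v \<in> S \<Longrightarrow> w \<in> S \<Longrightarrow> v \<noteq> w \<Longrightarrow> t \<le> nY (v - w)"
    and t: "0 < t" "t \<le> 1"
  shows "real (card S) \<le> (4 / t) ^ card B"
proof -
  obtain b where b: "bij_betw b {..<card B} B" using ex_bij_betw_nat_finite[OF B(1)] by (auto simp: atLeast0LessThan)
  obtain x where x: "bij_betw x {..<card S} S" using ex_bij_betw_nat_finite[OF S(1)] by (auto simp: atLeast0LessThan)
  have xS: "x i \<in> S" if "i < card S" for i using x that by (auto simp: bij_betw_def)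
  have "\<exists>c. x i = (\<Sum>r<card B. c r *\<^sub>R b r)" if "i < card S" for i
  proof -
    have "x i \<in> span B" using xS[OF that] S(2) by blast
    then obtain u where "x i = (\<Sum>v\<in>B. u v *\<^sub>R v)" using B(1) by (auto simp: span_finite)
    also have "\<dots> = (\<Sum>r<card B. u (b r) *\<^sub>R b r)" by (rule sum.reindex_bij_betw[OF b, symmetric])
    finally show ?thesis by (intro exI[of _ "\<lambda>r. u (b r)"])
  qed
  then obtain c where c: "\<And>i. i < card S \<Longrightarrow> x i = (\<Sum>r<card B. c i r *\<^sub>R b r)" by metis
  show ?thesis
  proof (rule packing_bound[OF N _ c])
    show "b r \<in> Y" if "r < card B" for r using b that B(2) by (auto simp: bij_betw_def)
    show "nY (x i) \<le> 1" if "i < card S" for i using S(3) xS that by blast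
    show "t \<le> nY (x i - x j)" if "i < card S" "j < card S" "i \<noteq> j" for i j
    proof -
      have "x i \<noteq> x j" using x that unfolding bij_betw_def inj_on_def by blast
      then show ?thesis by (rule sep[OF xS[OF that(1)] xS[OF that(2)]])
    qed
  qed (use t in auto)
qed

text \<open>
  A separated set of maximal size is a net.
\<close>

lemma finite_dimensional_net:
  assumes N: "seminorm_on Y nY" and B: "finite B" "B \<subseteq> Y" "card B \<le> d"
    and t: "0 < t" "t \<le> 1" and R: "R > 0"
  obtains C where "finite C" "C \<subseteq> span B" "real (card C) \<le> (4 / t) ^ d"
    "\<And>y. y \<in> span B \<Longrightarrow> nY y \<le> R \<Longrightarrow> \<exists>c\<in>C. nY (y - c) \<le> t * R"
proof -
  note Y = seminorm_onD[OF N]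
  have spanY: "span B \<subseteq> Y" using B(2) Y(1) by (rule span_minimal)
  define P where "P S \<longleftrightarrow> finite S \<and> S \<subseteq> span B \<and> (\<forall>v\<in>S. nY v \<le> 1) \<and>
    (\<forall>v\<in>S. \<forall>w\<in>S. v \<noteq> w \<longrightarrow> t \<le> nY (v - w))" for S
  have cardP: "real (card S) \<le> (4 / t) ^ d" if "P S" for S
  proof -
    have "real (card S) \<le> (4 / t) ^ card B"
      using that unfolding P_def by (intro separated_set_card[OF N B(1,2) _ _ _ _ t]) auto
    also have "\<dots> \<le> (4 / t) ^ d" using t B(3) by (intro power_increasing) auto
    finally show ?thesis .
  qed
  have "\<exists>S. P S \<and> (\<forall>S'. P S' \<longrightarrow> card S' \<le> card S)"
  proof -
    have "card S \<le> nat \<lceil>(4 / t) ^ d\<rceil>" if "P S" for S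
      using cardP[OF that] real_nat_ceiling_ge[of "(4 / t) ^ d"] by linarith
    moreover have "P {}" by (simp add: P_def)
    ultimately show ?thesis using ex_has_greatest_nat[of P "{}" card "Suc (nat \<lceil>(4 / t) ^ d\<rceil>)"] by (simp add: less_Suc_eq_le)
  qed
  then obtain S where S: "P S" "\<And>S'. P S' \<Longrightarrow> card S' \<le> card S" by blast
  have net: "\<exists>c\<in>S. nY (y - c) \<le> t" if y: "y \<in> span B" "nY y \<le> 1" for y
  proof (rule ccontr)
    assume "\<not> ?thesis"
    then have far: "t < nY (y - c)" if "c \<in> S" for c using that by auto
    have far': "t < nY (c - y)" if "c \<in> S" for c
    proof -
      have "y - c \<in> Y" using that S(1) y spanY by (intro subspace_diff Y(1)) (auto simp: P_def)
      then show ?thesis using far[OF that] Y(6)[of "y - c"] by simp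
    qed
    have "y \<notin> S" using far[of y] t Y(5) by auto
    moreover have "P (insert y S)"
      using S(1) y far far' unfolding P_def by (auto intro: less_imp_le)
    ultimately show False using S(2)[of "insert y S"] S(1) by (simp add: P_def)
  qed
  show ?thesis
  proof
    show "finite ((\<lambda>c. R *\<^sub>R c) ` S)" "(\<lambda>c. R *\<^sub>R c) ` S \<subseteq> span B"
      using S(1) by (auto simp: P_def intro: span_scale)
    have "card ((\<lambda>c. R *\<^sub>R c) ` S) \<le> card S" using S(1) by (intro card_image_le) (simp add: P_def)
    then show "real (card ((\<lambda>c. R *\<^sub>R c) ` S)) \<le> (4 / t) ^ d" using cardP[OF S(1)] by linarith
    fix y assume y: "y \<in> span B" "nY y \<le> R"
    have yY: "y \<in> Y" using y spanY by blast
    have "nY ((1 / R) *\<^sub>R y) \<le> 1" using Y(4)[OF yY, of "1 / R"] y R by simp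
    then obtain c where c: "c \<in> S" "nY ((1 / R) *\<^sub>R y - c) \<le> t"
      using net[of "(1 / R) *\<^sub>R y"] y span_scale by blast
    have cY: "(1 / R) *\<^sub>R y - c \<in> Y"
      using c S(1) yY spanY by (intro subspace_diff subspace_scale Y(1)) (auto simp: P_def)
    have "y - R *\<^sub>R c = R *\<^sub>R ((1 / R) *\<^sub>R y - c)" using R by (simp add: scaleR_diff_right)
    then have "nY (y - R *\<^sub>R c) = R * nY ((1 / R) *\<^sub>R y - c)" using Y(4)[OF cY, of R] R by simp
    also have "\<dots> \<le> t * R" using c R by (simp add: mult.commute)
    finally show "\<exists>c\<in>(\<lambda>c. R *\<^sub>R c) ` S. nY (y - c) \<le> t * R" using c by blast
  qed
qed

text \<open>
  Let \<open>G y j\<close> approximate \<open>y\<close> from the span of \<open>B j\<close>. The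
  difference \<open>G y (j + 1) - G y j\<close> lies in a ball of radius \<open>3 D 2\<^sup>q\<close>,
  where \<open>q = m - j - 1\<close>, of a space of dimension at most
  \<open>2\<^bsup>j+2\<^esup>\<close>. A net of relative width \<open>1/4\<^sup>q\<close> for it leaves
  the error \<open>3 D / 2\<^sup>q\<close> and costs the factor \<open>(4 \<cdot> 4\<^sup>q)\<close> to
  the power of the dimension. Summing over \<open>j < m\<close>, both the errors and the exponents of
  \<open>2\<close> are dominated by the last term: the errors add up to at most \<open>6 D\<close> and
  the exponents to at most \<open>16 \<cdot> 2\<^sup>m\<close>. The bounds in the induction are chosen
  so that each step gives exactly the next one.
\<close>

theorem carl_covering:
  fixes nY :: "'b::real_vector \<Rightarrow> real"
  assumes N: "seminorm_on Y nY" and A: "A \<subseteq> Y" and D: "D > 0"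
    and B: "\<And>j. j \<le> m \<Longrightarrow> finite (B j)" "\<And>j. j \<le> m \<Longrightarrow> B j \<subseteq> Y" "\<And>j. j \<le> m \<Longrightarrow> card (B j) \<le> 2 ^ j"
    and B0: "B 0 = {}"
    and approx: "\<And>y j. y \<in> A \<Longrightarrow> j \<le> m \<Longrightarrow> \<exists>g\<in>span (B j). nY (y - g) \<le> D * 2 ^ (m - j)"
  obtains C where "finite C" "C \<subseteq> Y" "card C \<le> 2 ^ (16 * 2 ^ m)"
    "\<And>y. y \<in> A \<Longrightarrow> \<exists>c\<in>C. nY (y - c) \<le> 7 * D"
proof -
  note Y = seminorm_onD[OF N]
  have spanY: "span (B j) \<subseteq> Y" if "j \<le> m" for j using B(2)[OF that] Y(1) by (rule span_minimal)
  define G where "G y j = (SOME g. g \<in> span (B j) \<and> nY (y - g) \<le> D * 2 ^ (m - j))" for y j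
  have G: "G y j \<in> span (B j)" "nY (y - G y j) \<le> D * 2 ^ (m - j)" if "y \<in> A" "j \<le> m" for y j
    using someI_ex[of "\<lambda>g. g \<in> span (B j) \<and> nY (y - g) \<le> D * 2 ^ (m - j)"] approx[OF that]
    unfolding G_def by blast+
  have GY: "G y j \<in> Y" if "y \<in> A" "j \<le> m" for y j using G(1)[OF that] spanY[OF that(2)] by blast
  have "\<exists>C. finite C \<and> C \<subseteq> Y \<and> card C \<le> 2 ^ (2 ^ p * (8 * (m - p) + 16)) \<and>
      (\<forall>y\<in>A. \<exists>c\<in>C. nY (G y p - c) \<le> 6 * D * 2 ^ p / 2 ^ m)" if "p \<le> m" for p
    using that
  proof (induction p)
    case 0
    have "G y 0 = 0" if "y \<in> A" for y using G(1)[OF that, of 0] B0 by simp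
    then show ?case using Y(1,5) D by (intro exI[of _ "{0}"]) (auto simp: subspace_0)
  next
    case (Suc p)
    then have p: "p \<le> m" "Suc p \<le> m" by auto
    obtain C where C: "finite C" "C \<subseteq> Y" "card C \<le> 2 ^ (2 ^ p * (8 * (m - p) + 16))"
      "\<And>y. y \<in> A \<Longrightarrow> \<exists>c\<in>C. nY (G y p - c) \<le> 6 * D * 2 ^ p / 2 ^ m"
      using Suc p by blast
    define q where "q = m - Suc p"
    have q: "m - p = Suc q" using p by (simp add: q_def)
    let ?B = "B (Suc p) \<union> B p"
    have cardB: "card ?B \<le> 2 ^ (p + 2)"
      using card_Un_le[of "B (Suc p)" "B p"] B(3)[OF p(1)] B(3)[OF p(2)] by simp
    obtain V where V: "finite V" "V \<subseteq> span ?B" "real (card V) \<le> (4 / (1 / 4 ^ q)) ^ (2 ^ (p + 2))"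
      "\<And>y. y \<in> span ?B \<Longrightarrow> nY y \<le> 3 * D * 2 ^ q \<Longrightarrow> \<exists>c\<in>V. nY (y - c) \<le> 1 / 4 ^ q * (3 * D * 2 ^ q)"
    proof (rule finite_dimensional_net[OF N _ _ cardB, of "1 / 4 ^ q" "3 * D * 2 ^ q"])
      show "finite ?B" "?B \<subseteq> Y" using B(1,2) p by auto
    qed (use D in auto)
    have VY: "V \<subseteq> Y" using V(2) span_minimal[of ?B Y] B(2) p Y(1) by blast
    have cardV: "card V \<le> 2 ^ ((2 + 2 * q) * 2 ^ (p + 2))"
    proof -
      have "4 / (1 / 4 ^ q) = (2 ^ (2 + 2 * q) :: real)" by (simp add: power_add power_mult)
      then have "(4 / (1 / 4 ^ q)) ^ (2 ^ (p + 2)) = (2 ^ ((2 + 2 * q) * 2 ^ (p + 2)) :: real)"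
        by (simp only: power_mult)
      then have "real (card V) \<le> real (2 ^ ((2 + 2 * q) * 2 ^ (p + 2)))" using V(3) by simp
      then show ?thesis by (simp only: of_nat_le_iff)
    qed
    define C' where "C' = (\<lambda>(c, v). c + v) ` (C \<times> V)"
    have "card C' \<le> card (C \<times> V)" unfolding C'_def using C(1) V(1) by (intro card_image_le) auto
    also have "\<dots> \<le> 2 ^ (2 ^ p * (8 * (m - p) + 16)) * 2 ^ ((2 + 2 * q) * 2 ^ (p + 2))"
      using C(3) cardV by (simp add: card_cartesian_product mult_mono)
    also have "\<dots> = 2 ^ (2 ^ p * (8 * (m - p) + 16) + (2 + 2 * q) * 2 ^ (p + 2))" by (simp only: power_add)
    also have "2 ^ p * (8 * (m - p) + 16) + (2 + 2 * q) * 2 ^ (p + 2) = 2 ^ Suc p * (8 * (m - Suc p) + 16)"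
      unfolding q q_def[symmetric] by (simp add: algebra_simps)
    finally have card: "card C' \<le> 2 ^ (2 ^ Suc p * (8 * (m - Suc p) + 16))" .
    have "\<exists>c\<in>C'. nY (G y (Suc p) - c) \<le> 6 * D * 2 ^ Suc p / 2 ^ m" if y: "y \<in> A" for y
    proof -
      let ?w = "G y (Suc p) - G y p"
      have yY: "y \<in> Y" using y A by blast
      note g = G[OF y p(1)] G[OF y p(2)] and gY = GY[OF y p(1)] GY[OF y p(2)]
      have "?w \<in> span ?B"
        using g span_mono[of "B p" ?B] span_mono[of "B (Suc p)" ?B] by (intro span_diff) auto
      moreover have "nY ?w \<le> 3 * D * 2 ^ q"
      proof -
        have "?w = (y - G y p) + - (y - G y (Suc p))" by simp
        also have "nY \<dots> \<le> nY (y - G y p) + nY (- (y - G y (Suc p)))"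
          using yY gY by (intro Y(3) subspace_diff subspace_neg Y(1))
        also have "nY (- (y - G y (Suc p))) = nY (y - G y (Suc p))"
          using yY gY by (intro Y(6) subspace_diff Y(1))
        finally show ?thesis using g(2,4) unfolding q q_def[symmetric] by simp
      qed
      ultimately obtain v where v: "v \<in> V" "nY (?w - v) \<le> 1 / 4 ^ q * (3 * D * 2 ^ q)" using V(4) by blast
      obtain c where c: "c \<in> C" "nY (G y p - c) \<le> 6 * D * 2 ^ p / 2 ^ m" using C(4)[OF y] by blast
      have cvY: "c \<in> Y" "v \<in> Y" using c v C(2) VY by auto
      have "G y (Suc p) - (c + v) = (G y p - c) + (?w - v)" by simp
      also have "nY \<dots> \<le> nY (G y p - c) + nY (?w - v)"
        using cvY gY by (intro Y(3) subspace_diff Y(1))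
      also have "\<dots> \<le> 6 * D * 2 ^ p / 2 ^ m + 1 / 4 ^ q * (3 * D * 2 ^ q)" using c v by simp
      also have "1 / 4 ^ q * (3 * D * 2 ^ q) = 6 * D * 2 ^ p / 2 ^ m"
      proof -
        have m: "m = Suc p + q" using p by (simp add: q_def)
        have "(4::real) ^ q = 2 ^ q * 2 ^ q" by (simp add: power_mult_distrib[symmetric])
        then show ?thesis by (simp add: m power_add)
      qed
      finally have "nY (G y (Suc p) - (c + v)) \<le> 6 * D * 2 ^ Suc p / 2 ^ m" by simp
      moreover have "c + v \<in> C'" using c v by (auto simp: C'_def)
      ultimately show ?thesis by blast
    qed
    moreover have "finite C'" using C(1) V(1) by (simp add: C'_def)
    moreover have "C' \<subseteq> Y" using C(2) VY Y(1) by (auto simp: C'_def intro!: subspace_add)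
    ultimately show ?case using card by blast
  qed
  from this[OF order_refl] obtain C where C: "finite C" "C \<subseteq> Y" "card C \<le> 2 ^ (2 ^ m * 16)"
    "\<And>y. y \<in> A \<Longrightarrow> \<exists>c\<in>C. nY (G y m - c) \<le> 6 * D"
    by (auto simp: power_mult)
  show ?thesis
  proof
    show "finite C" "C \<subseteq> Y" "card C \<le> 2 ^ (16 * 2 ^ m)" using C by (simp_all add: mult.commute)
    fix y assume y: "y \<in> A"
    then obtain c where c: "c \<in> C" "nY (G y m - c) \<le> 6 * D" using C(4) by blast
    have "y - c = (y - G y m) + (G y m - c)" by simp
    also have "nY \<dots> \<le> nY (y - G y m) + nY (G y m - c)"
      using y A c C(2) GY[OF y] by (intro Y(3) subspace_diff Y(1)) auto
    also have "\<dots> \<le> 7 * D" using c G(2)[OF y, of m] by simp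
    finally show "\<exists>c\<in>C. nY (y - c) \<le> 7 * D" using c by blast
  qed
qed

section \<open>Entropy and Kolmogorov numbers from coverings and approximations\<close>

text \<open>
  The definition asks for exactly \<open>n\<close> centres; superfluous indices are sent to
  \<open>z\<close>.
\<close>

lemma entropy_eps_le:
  assumes M: "Metric_space Y d" and A: "A \<subseteq> Y" and z: "z \<in> Y" and \<epsilon>: "0 \<le> \<epsilon>"
    and C: "finite C" "C \<subseteq> Y" "card C \<le> n" "\<And>y. y \<in> A \<Longrightarrow> \<exists>c\<in>C. d y c \<le> \<epsilon>"
  shows "entropy_eps Y d n A \<le> \<epsilon>"
  unfolding entropy_eps_def
proof (rule cInf_lower)
  obtain h where h: "bij_betw h {1..card C} C" using ex_bij_betw_nat_finite_1[OF C(1)] by blast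
  define x where "x i = (if i \<le> card C then h i else z)" for i
  have hC: "h i \<in> C" if "i \<in> {1..card C}" for i using h that by (auto simp: bij_betw_def)
  have "x i \<in> Y" if "i \<in> {1..n}" for i using hC[of i] that C(2) z by (auto simp: x_def)
  moreover have "A \<subseteq> (\<Union>i\<in>{1..n}. Metric_space.mcball Y d (x i) \<epsilon>)"
  proof
    fix y assume y: "y \<in> A"
    then obtain c where c: "c \<in> C" "d y c \<le> \<epsilon>" using C(4) by blast
    obtain i where i: "i \<in> {1..card C}" "h i = c" using h c(1) unfolding bij_betw_def by (metis imageE)
    have "y \<in> Metric_space.mcball Y d (x i) \<epsilon>"
      using c i y A C(2) Metric_space.commute[OF M]
      by (auto simp: Metric_space.in_mcball[OF M] x_def)
    then show "y \<in> (\<Union>i\<in>{1..n}. Metric_space.mcball Y d (x i) \<epsilon>)" using i C(3) by auto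
  qed
  ultimately show "\<epsilon> \<in> {\<epsilon>. 0 \<le> \<epsilon> \<and> (\<exists>x. (\<forall>i\<in>{1..n}. x i \<in> Y) \<and> A \<subseteq> (\<Union>i\<in>{1..n}. Metric_space.mcball Y d (x i) \<epsilon>))}"
    using \<epsilon> by blast
qed (auto intro: bdd_belowI[of _ 0])

lemma kolmogorov_number_le:
  assumes N: "seminorm_on Y nY" and X: "unit_ball X nX \<noteq> {}"
    and T: "\<And>f. f \<in> unit_ball X nX \<Longrightarrow> T f \<in> Y" "\<And>f. f \<in> unit_ball X nX \<Longrightarrow> nY (T f) \<le> S"
    and B: "finite B" "B \<subseteq> Y" "card B < n"
    and approx: "\<And>f. f \<in> unit_ball X nX \<Longrightarrow> \<exists>g\<in>span B. nY (T f - g) \<le> \<epsilon>"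
  shows "kolmogorov_number X nX Y nY T n \<le> \<epsilon>"
proof -
  note Y = seminorm_onD[OF N]
  define Q where "Q F f = quotient_norm nY ((quotient_map F \<circ> T) f)" for F f
  have Q: "Q F f = (INF g\<in>F. nY (T f + g))" for F f
    by (simp add: Q_def quotient_norm_def quotient_map_def image_image)
  have TgY: "T f + g \<in> Y" if "f \<in> unit_ball X nX" "F \<subseteq> Y" "g \<in> F" for F f g
    using T(1)[OF that(1)] that by (intro subspace_add Y(1)) auto
  have bdd: "bdd_below ((\<lambda>g. nY (T f + g)) ` F)" if "f \<in> unit_ball X nX" "F \<subseteq> Y" for F f
    using TgY[OF that] Y(2) by (intro bdd_belowI2[of _ 0]) blast
  have Q_ge: "0 \<le> Q F f" if "f \<in> unit_ball X nX" "subspace F" "F \<subseteq> Y" for F f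
    unfolding Q using that TgY Y(2) subspace_0[of F] by (intro cINF_greatest) auto
  have Q_le: "Q F f \<le> nY (T f + g)" if "f \<in> unit_ball X nX" "F \<subseteq> Y" "g \<in> F" for F f g
    unfolding Q using that bdd by (intro cINF_lower) auto
  \<comment> \<open>This bounds the set of competing norms from below; the bound \<open>S\<close> makes the supremum meaningful.\<close>
  have nonneg: "0 \<le> operator_norm X nX (quotient_norm nY) (quotient_map F \<circ> T)"
    if F: "subspace F" "F \<subseteq> Y" for F
  proof -
    obtain f where f: "f \<in> unit_ball X nX" using X by blast
    have "bdd_above (Q F ` unit_ball X nX)"
    proof (rule bdd_aboveI2)
      fix f assume f: "f \<in> unit_ball X nX"
      show "Q F f \<le> S" using Q_le[OF f F(2) subspace_0[OF F(1)]] T(2)[OF f] by simp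
    qed
    then have "Q F f \<le> (SUP f\<in>unit_ball X nX. Q F f)" using f by (rule cSUP_upper[rotated])
    then show ?thesis using Q_ge[OF f F] by (simp add: operator_norm_def Q_def)
  qed
  let ?S = "{operator_norm X nX (quotient_norm nY) (quotient_map F \<circ> T) | F.
            subspace F \<and> F \<subseteq> Y \<and> (\<exists>B. finite B \<and> F = span B) \<and> dim F < n}"
  have spanY: "span B \<subseteq> Y" using B(2) Y(1) by (rule span_minimal)
  have "dim (span B) < n" using dim_le_card[of "span B" B] B by simp
  then have "operator_norm X nX (quotient_norm nY) (quotient_map (span B) \<circ> T) \<in> ?S"
    using B spanY subspace_span by blast
  moreover have "bdd_below ?S" using nonneg by (intro bdd_belowI[of _ 0]) auto
  ultimately have "kolmogorov_number X nX Y nY T n \<le> operator_norm X nX (quotient_norm nY) (quotient_map (span B) \<circ> T)"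
    unfolding kolmogorov_number_def by (rule cInf_lower)
  also have "\<dots> = (SUP f\<in>unit_ball X nX. Q (span B) f)" by (simp add: operator_norm_def Q_def)
  also have "\<dots> \<le> \<epsilon>"
  proof (rule cSUP_least[OF X])
    fix f assume f: "f \<in> unit_ball X nX"
    obtain g where g: "g \<in> span B" "nY (T f - g) \<le> \<epsilon>" using approx[OF f] by blast
    show "Q (span B) f \<le> \<epsilon>" using Q_le[OF f spanY span_neg[OF g(1)]] g(2) by simp
  qed
  finally show ?thesis .
qed

section \<open>Kolmogorov and entropy numbers of the integral operator\<close>

context L2_continuous_kernel
begin

text \<open>
  Put \<open>\<psi>(n) = \<omega>(1/n) / \<surd>n\<close>. The growth condition says that \<open>n
  \<psi>(n)\<close> increases, so \<open>\<psi>(l)\<close> exceeds \<open>\<psi>(n)\<close> at most by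
  the factor \<open>n/l\<close>. Hence it suffices to approximate with some \<open>l\<close>
  proportional to \<open>n\<close>, and the dyadic errors grow at most like
  \<open>2\<^bsup>m-j\<^esup>\<close>, as Carl's argument requires. For small \<open>n\<close> both
  numbers are at most the norm of \<open>T\<close>, which is at most \<open>\<omega>(1) = \<psi>(1)
  \<le> n \<psi>(n)\<close>.
\<close>

theorem kolmogorov_and_entropy_bound:
  fixes q :: real and n :: nat
  assumes q: "q \<ge> 1" and n: "n \<ge> 1" and s: "s \<in> {kolmogorov_number, entropy_number}"
    and S: "S \<le> \<omega> 1"
    and growth: "\<And>l n. 1 \<le> l \<Longrightarrow> l \<le> n \<Longrightarrow> sqrt (real l) * \<omega> (1 / real l) \<le> sqrt (real n) * \<omega> (1 / real n)"
  shows "s (Lp 2) (Lp_norm 2) (Lp q) (Lp_norm q) T n \<le> 20000 * sqrt q * (\<omega> (1 / n) / sqrt n)"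
proof -
  define \<psi> where "\<psi> l = \<omega> (1 / real l) / sqrt (real l)" for l :: nat
  have \<psi>_pos: "0 < \<psi> l" if "l \<ge> 1" for l using that by (simp add: \<psi>_def modulus_pos)
  have grow: "\<psi> l \<le> real n / real l * \<psi> n" if "1 \<le> l" "l \<le> n" for l n
  proof -
    have l: "0 < real l" "0 < real n" using that by auto
    have a: "real l * \<psi> l = sqrt (real l) * \<omega> (1 / real l)" if "l \<ge> 1" for l
    proof -
      have "real l * \<psi> l = (real l / sqrt (real l)) * \<omega> (1 / real l)" by (simp add: \<psi>_def)
      then show ?thesis by (simp add: real_div_sqrt)
    qed
    have "real l * \<psi> l \<le> real n * \<psi> n" using growth[OF that] a that by simp
    then show ?thesis using l by (simp add: field_simps)
  qed
  have S\<psi>: "S \<le> real l * \<psi> l" if "l \<ge> 1" for l using grow[of 1 l] that S by (simp add: \<psi>_def)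
  have sq: "1 \<le> sqrt q" using q by simp
  let ?U = "unit_ball (Lp 2) (Lp_norm 2)"
  note N = seminorm_on_Lp[OF q]
  note Y = seminorm_onD[OF N]
  have TU: "T f \<in> Lp q" "Lp_norm q (T f) \<le> S" if "f \<in> ?U" for f
  proof -
    have f: "f \<in> Lp 2" "Lp_norm 2 f \<le> 1" using that by (auto simp: unit_ball_def)
    show "T f \<in> Lp q" using T_bounded(1)[OF q f(1)] .
    have "Lp_norm q (T f) \<le> S * Lp_norm 2 f" using T_bounded(2)[OF q f(1)] .
    also have "\<dots> \<le> S * 1" using f(2) S_nonneg by (intro mult_left_mono)
    finally show "Lp_norm q (T f) \<le> S" by simp
  qed
  have U: "?U \<noteq> {}"
    using seminorm_onD(1,5)[OF seminorm_on_Lp[of 2]] by (auto simp: unit_ball_def subspace_0 intro!: exI[of _ 0])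
  have trivial: "\<exists>g\<in>span {}. Lp_norm q (T f - g) \<le> S" if "f \<in> ?U" for f using TU[OF that] by simp
  have "kolmogorov_number (Lp 2) (Lp_norm 2) (Lp q) (Lp_norm q) T n \<le> 20000 * sqrt q * \<psi> n"
  proof (cases "n < 4")
    case True
    have "kolmogorov_number (Lp 2) (Lp_norm 2) (Lp q) (Lp_norm q) T n \<le> S"
      by (rule kolmogorov_number_le[where T = T and B = "{}", OF N U TU]) (use n trivial in auto)
    also have "\<dots> \<le> real n * \<psi> n" by (rule S\<psi>[OF n])
    also have "\<dots> \<le> (20000 * sqrt q) * \<psi> n"
    proof (rule mult_right_mono)
      have "real n < 17" using True by simp
      then show "real n \<le> 20000 * sqrt q" using sq by linarith
    qed (use \<psi>_pos[OF n] in simp)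
    finally show ?thesis .
  next
    case False
    \<comment> \<open>The subspace has dimension at most \<open>2 l + 1\<close>, which must be less than \<open>n\<close>.\<close>
    define l where "l = (n - 2) div 2"
    have l: "1 \<le> l" "2 * l + 1 < n" "l \<le> n" "n \<le> 8 * l" using False by (auto simp: l_def)
    obtain B where B: "finite B" "card B \<le> 2 * l + 1" "B \<subseteq> Lp q"
      "\<And>f. f \<in> ?U \<Longrightarrow> \<exists>g\<in>span B. Lp_norm q (T f - g) \<le> 20 * (sqrt q * (\<omega> (1 / l) / sqrt l))"
      using kolmogorov_approximation[OF q l(1)] by blast
    have "kolmogorov_number (Lp 2) (Lp_norm 2) (Lp q) (Lp_norm q) T n \<le> 20 * (sqrt q * (\<omega> (1 / l) / sqrt l))"
      by (rule kolmogorov_number_le[where T = T and B = B, OF N U TU B(1,3) _ B(4)]) (use B(2) l in auto)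
    also have "\<dots> = 20 * sqrt q * \<psi> l" by (simp add: \<psi>_def)
    also have "\<dots> \<le> 20 * sqrt q * (8 * \<psi> n)"
    proof (intro mult_left_mono)
      have "real n / real l \<le> 8" using l by (simp add: divide_le_eq)
      then have "real n / real l * \<psi> n \<le> 8 * \<psi> n" using \<psi>_pos[OF n] by (intro mult_right_mono) auto
      then show "\<psi> l \<le> 8 * \<psi> n" using grow[OF l(1,3)] by simp
    qed (use q in auto)
    also have "\<dots> \<le> 20000 * sqrt q * \<psi> n" using sq \<psi>_pos[OF n] by simp
    finally show ?thesis .
  qed
  moreover have "entropy_number (Lp 2) (Lp_norm 2) (Lp q) (Lp_norm q) T n \<le> 20000 * sqrt q * \<psi> n"
  proof (cases "n < 17")
    case True
    have "entropy_number (Lp 2) (Lp_norm 2) (Lp q) (Lp_norm q) T n \<le> S"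
      unfolding entropy_number_def
      by (rule entropy_eps_le[OF Metric_space_Lp[OF q], where z = 0 and C = "{0}"])
        (use TU Y(1) S_nonneg in \<open>auto simp: subspace_0\<close>)
    also have "\<dots> \<le> real n * \<psi> n" by (rule S\<psi>[OF n])
    also have "\<dots> \<le> (20000 * sqrt q) * \<psi> n"
    proof (rule mult_right_mono)
      have "real n < 17" using True by simp
      then show "real n \<le> 20000 * sqrt q" using sq by linarith
    qed (use \<psi>_pos[OF n] in simp)
    finally show ?thesis .
  next
    case False
    \<comment> \<open>The covering has at most \<open>2\<close> to the power \<open>16 \<cdot> 2\<^sup>m\<close> balls, and \<open>2\<^bsup>n-1\<^esup>\<close> are allowed.\<close>
    have "\<exists>m. 16 * 2 ^ m \<le> n - 1 \<and> (\<forall>m'. 16 * 2 ^ m' \<le> n - 1 \<longrightarrow> m' \<le> m)"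
    proof -
      have "m < n" if "16 * 2 ^ m \<le> n - 1" for m :: nat
        using that less_exp[of m] by linarith
      then show ?thesis
        using ex_has_greatest_nat[of "\<lambda>m. 16 * 2 ^ m \<le> n - 1" 0 "\<lambda>m. m" n] False by auto
    qed
    then obtain m where m: "16 * 2 ^ m \<le> n - 1" "\<not> 16 * 2 ^ Suc m \<le> n - 1"
      using Suc_n_not_le_n by blast
    define M :: nat where "M = 2 ^ m"
    have M: "1 \<le> M" "M \<le> n" "n \<le> 32 * M" using m n by (auto simp: M_def)
    define D where "D = 80 * (sqrt q * \<psi> M)"
    have D: "D > 0" using q \<psi>_pos[OF M(1)] by (simp add: D_def)
    have "\<exists>B. finite B \<and> B \<subseteq> Lp q \<and> card B \<le> 2 ^ j \<and> (j = 0 \<longrightarrow> B = {}) \<and>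
      (\<forall>f\<in>?U. \<exists>g\<in>span B. Lp_norm q (T f - g) \<le> D * 2 ^ (m - j))" if "j \<le> m" for j
    \<comment> \<open>Dimension \<open>2\<^sup>j\<close> accommodates \<open>2 l + 1\<close> with \<open>l = 2\<^bsup>j-2\<^esup>\<close>; for \<open>j < 2\<close> the zero subspace is used.\<close>
    proof (cases "j < 2")
      case True
      have "S \<le> real M * \<psi> M" by (rule S\<psi>[OF M(1)])
      also have "real M \<le> 2 * 2 ^ (m - j)"
      proof -
        have "(2::real) ^ m \<le> 2 ^ Suc (m - j)" using True by (intro power_increasing) auto
        then show ?thesis by (simp add: M_def)
      qed
      also have "2 * 2 ^ (m - j) * \<psi> M = (2 * \<psi> M) * 2 ^ (m - j)" by simp
      also have "\<dots> \<le> D * 2 ^ (m - j)"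
      proof (rule mult_right_mono)
        have "1 * \<psi> M \<le> sqrt q * \<psi> M" using sq \<psi>_pos[OF M(1)] by (intro mult_right_mono) auto
        then show "2 * \<psi> M \<le> D" unfolding D_def using \<psi>_pos[OF M(1)] by linarith
      qed simp
      finally have "S \<le> D * 2 ^ (m - j)" using \<psi>_pos[OF M(1)] by simp
      then show ?thesis using TU by (intro exI[of _ "{}"]) force
    next
      case False
      define l :: nat where "l = 2 ^ (j - 2)"
      have l: "1 \<le> l" "l \<le> M" using that by (auto simp: l_def M_def)
      obtain B where B: "finite B" "card B \<le> 2 * l + 1" "B \<subseteq> Lp q"
        "\<And>f. f \<in> ?U \<Longrightarrow> \<exists>g\<in>span B. Lp_norm q (T f - g) \<le> 20 * (sqrt q * (\<omega> (1 / l) / sqrt l))"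
        using kolmogorov_approximation[OF q l(1)] by blast
      have j: "(2::nat) ^ j = 4 * l"
      proof -
        have "j = 2 + (j - 2)" using False by simp
        then have "(2::nat) ^ j = 2 ^ 2 * 2 ^ (j - 2)" by (metis power_add)
        then show ?thesis by (simp add: l_def)
      qed
      have "20 * (sqrt q * (\<omega> (1 / l) / sqrt l)) = 20 * sqrt q * \<psi> l" by (simp add: \<psi>_def)
      also have "\<dots> \<le> 20 * sqrt q * (real M / real l * \<psi> M)"
        using q by (intro mult_left_mono grow l) auto
      also have "real M / real l = 4 * 2 ^ (m - j)"
      proof -
        have "m = (m - j) + 2 + (j - 2)" using False that by simp
        then have "(2::nat) ^ m = 2 ^ (m - j) * 2 ^ 2 * 2 ^ (j - 2)" by (metis power_add)
        then have "real M = 2 ^ (m - j) * 4 * real l" unfolding M_def l_def by simp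
        then show ?thesis using l(1) by simp
      qed
      also have "20 * sqrt q * (4 * 2 ^ (m - j) * \<psi> M) = D * 2 ^ (m - j)" by (simp add: D_def)
      finally have le: "20 * (sqrt q * (\<omega> (1 / l) / sqrt l)) \<le> D * 2 ^ (m - j)" .
      have "\<exists>g\<in>span B. Lp_norm q (T f - g) \<le> D * 2 ^ (m - j)" if "f \<in> ?U" for f
        using B(4)[OF that] le order_trans by blast
      moreover have "card B \<le> 2 ^ j" using B(2) l(1) j by linarith
      ultimately show ?thesis using B(1,3) False by (intro exI[of _ B]) auto
    qed
    then obtain B where B: "\<And>j. j \<le> m \<Longrightarrow> finite (B j)" "\<And>j. j \<le> m \<Longrightarrow> B j \<subseteq> Lp q"
      "\<And>j. j \<le> m \<Longrightarrow> card (B j) \<le> 2 ^ j" "B 0 = {}"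
      "\<And>j f. j \<le> m \<Longrightarrow> f \<in> ?U \<Longrightarrow> \<exists>g\<in>span (B j). Lp_norm q (T f - g) \<le> D * 2 ^ (m - j)"
      by (metis zero_le)
    have sub: "T ` ?U \<subseteq> Lp q" using TU(1) by blast
    have near: "\<exists>g\<in>span (B j). Lp_norm q (y - g) \<le> D * 2 ^ (m - j)" if "y \<in> T ` ?U" "j \<le> m" for y j
      using B(5) that by blast
    obtain C where C: "finite C" "C \<subseteq> Lp q" "card C \<le> 2 ^ (16 * 2 ^ m)"
      "\<And>y. y \<in> T ` ?U \<Longrightarrow> \<exists>c\<in>C. Lp_norm q (y - c) \<le> 7 * D"
      using carl_covering[OF N sub D B(1,2,3,4) near] by blast
    have "card C \<le> 2 ^ (n - 1)"
      by (rule order_trans[OF C(3) power_increasing[OF m(1)]]) simp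
    then have "entropy_number (Lp 2) (Lp_norm 2) (Lp q) (Lp_norm q) T n \<le> 7 * D"
      unfolding entropy_number_def
      by (intro entropy_eps_le[OF Metric_space_Lp[OF q], where z = 0 and C = C])
        (use TU Y(1) D C in \<open>auto simp: subspace_0\<close>)
    also have "\<dots> = 560 * sqrt q * \<psi> M" by (simp add: D_def)
    also have "\<dots> \<le> 560 * sqrt q * (32 * \<psi> n)"
    proof (intro mult_left_mono)
      have "real n \<le> 32 * real M" using M(3) by linarith
      then have "real n / real M \<le> 32" using M(1) by (simp add: divide_le_eq)
      then have "real n / real M * \<psi> n \<le> 32 * \<psi> n" using \<psi>_pos[OF n] by (intro mult_right_mono) auto
      then show "\<psi> M \<le> 32 * \<psi> n" using grow[OF M(1,2)] by simp
    qed (use q in auto)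
    also have "\<dots> \<le> 20000 * sqrt q * \<psi> n" using sq \<psi>_pos[OF n] by simp
    finally show ?thesis .
  qed
  ultimately show ?thesis using s by (auto simp: \<psi>_def)
qed

end

section \<open>Translates of a decreasing square integrable function\<close>

text \<open>
  The kernel function, extended by \<open>0\<close> to the whole line. The translation invariance of
  Lebesgue measure then applies, and \<open>g(t - x)\<close> vanishes by itself for \<open>x \<ge>
  t\<close>.
\<close>

locale L2_decreasing =
  fixes g :: "real \<Rightarrow> real"
  assumes meas [measurable]: "g \<in> borel_measurable borel"
    and sq_int: "integrable lborel (\<lambda>u. (g u)\<^sup>2)"
    and zero: "u \<le> 0 \<Longrightarrow> g u = 0" "1 < u \<Longrightarrow> g u = 0"
    and nonneg: "0 \<le> g u"
    and decreasing: "0 < u \<Longrightarrow> u \<le> v \<Longrightarrow> g v \<le> g u"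
    and pos: "0 < u \<Longrightarrow> u < 1 \<Longrightarrow> 0 < g u"
begin

definition \<Psi> :: "real \<Rightarrow> real" where
  "\<Psi> a = (LINT u|lborel. (g u)\<^sup>2 * indicator {..a} u)"

lemma integrable_cut: "integrable lborel (\<lambda>u. (g u)\<^sup>2 * indicator {..a} u)"
  using integrable_mult_indicator[OF _ sq_int, of "{..a}"] by (simp add: mult.commute)

lemma \<Psi>_mono: "a \<le> b \<Longrightarrow> \<Psi> a \<le> \<Psi> b"
  unfolding \<Psi>_def by (intro integral_mono integrable_cut) (auto split: split_indicator)

lemma \<Psi>_nonneg: "0 \<le> \<Psi> a"
  unfolding \<Psi>_def by (intro integral_nonneg_AE AE_I2) auto

lemma \<Psi>_1: "\<Psi> 1 = (LINT u|lborel. (g u)\<^sup>2)"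
  unfolding \<Psi>_def by (intro Bochner_Integration.integral_cong) (auto simp: zero split: split_indicator)

lemma \<Psi>_pos:
  assumes "0 < a"
  shows "0 < \<Psi> a"
proof -
  define b where "b = min a (1 / 2)"
  have b: "0 < b" "b < 1" "b \<le> a" using assms by (auto simp: b_def)
  have "0 < (g b)\<^sup>2 * b" using pos[OF b(1,2)] b by simp
  also have "\<dots> = (LINT u|lborel. (g b)\<^sup>2 * indicator {0<..b} u)" using b by simp
  also have "\<dots> \<le> \<Psi> a"
    unfolding \<Psi>_def
  proof (intro integral_mono integrable_cut)
    show "integrable lborel (\<lambda>u. (g b)\<^sup>2 * indicator {0<..b} u)"
      by (intro integrable_mult_right integrable_real_indicator) (use b in auto)
    show "(g b)\<^sup>2 * indicator {0<..b} u \<le> (g u)\<^sup>2 * indicator {..a} u" for u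
      using b decreasing[of u b] nonneg[of b] by (auto split: split_indicator intro!: power_mono)
  qed
  finally show ?thesis .
qed

text \<open>
  Substitution and \<open>g(c u) \<le> g(u)\<close>: since \<open>g\<^sup>2\<close> decreases, the mean
  of \<open>g\<^sup>2\<close> over \<open>[0, a]\<close> decreases in \<open>a\<close>.
\<close>

lemma \<Psi>_scale:
  assumes "1 \<le> c"
  shows "\<Psi> (c * a) \<le> c * \<Psi> a"
proof -
  have "\<Psi> (c * a) = \<bar>c\<bar> *\<^sub>R (LINT u|lborel. (g (0 + c * u))\<^sup>2 * indicator {..c * a} (0 + c * u))"
    unfolding \<Psi>_def using assms by (intro lborel_integral_real_affine) auto
  also have "\<dots> = c * (LINT u|lborel. (g (c * u))\<^sup>2 * indicator {..c * a} (c * u))" using assms by simp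
  also have "\<dots> \<le> c * \<Psi> a"
  proof (intro mult_left_mono)
    show "(LINT u|lborel. (g (c * u))\<^sup>2 * indicator {..c * a} (c * u)) \<le> \<Psi> a"
      unfolding \<Psi>_def
    proof (rule integral_mono')
      show "(g (c * u))\<^sup>2 * indicator {..c * a} (c * u) \<le> (g u)\<^sup>2 * indicator {..a} u" for u
      proof (cases "0 < u")
        case True
        then have "u \<le> c * u" using assms by simp
        then have "(g (c * u))\<^sup>2 \<le> (g u)\<^sup>2" using True decreasing nonneg by (intro power_mono) auto
        then show ?thesis using assms by (auto split: split_indicator)
      next
        case False
        then have "c * u \<le> 0" using assms by (simp add: mult_nonneg_nonpos)
        then show ?thesis by (simp add: zero)
      qed
    qed (auto intro: integrable_cut)
  qed (use assms in simp)
  finally show ?thesis .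
qed

lemma \<Psi>_tendsto: "(\<Psi> \<longlongrightarrow> 0) (at_right 0)"
proof -
  have "(\<lambda>n. \<Psi> (1 / Suc n)) \<longlonglongrightarrow> (LINT u::real|lborel. 0)"
    unfolding \<Psi>_def
  proof (rule integral_dominated_convergence[where w = "\<lambda>u. (g u)\<^sup>2"])
    show "AE u in lborel. (\<lambda>n. (g u)\<^sup>2 * indicator {..1 / Suc n} u) \<longlonglongrightarrow> 0"
    proof (rule AE_I2)
      fix u :: real
      show "(\<lambda>n. (g u)\<^sup>2 * indicator {..1 / Suc n} u) \<longlonglongrightarrow> 0"
      proof (cases "u \<le> 0")
        case True
        then show ?thesis by (simp add: zero)
      next
        case False
        have "(\<lambda>n. 1 / real (Suc n)) \<longlonglongrightarrow> 0" using LIMSEQ_inverse_real_of_nat by (simp add: inverse_eq_divide)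
        then have "eventually (\<lambda>n. 1 / real (Suc n) < u) sequentially" using False by (intro order_tendstoD) auto
        then have "eventually (\<lambda>n. (g u)\<^sup>2 * indicator {..1 / Suc n} u = 0) sequentially"
          by eventually_elim (auto split: split_indicator)
        then show ?thesis by (rule tendsto_eventually)
      qed
    qed
  qed (auto intro: sq_int simp: abs_mult split: split_indicator)
  then have lim: "(\<lambda>n. \<Psi> (1 / Suc n)) \<longlonglongrightarrow> 0" by simp
  show ?thesis
  proof (rule order_tendstoI)
    fix e :: real assume "e < 0"
    then show "eventually (\<lambda>a. e < \<Psi> a) (at_right 0)"
      by (intro always_eventually allI less_le_trans[OF _ \<Psi>_nonneg])
  next
    fix e :: real assume "0 < e"
    then have "eventually (\<lambda>n. \<Psi> (1 / Suc n) < e) sequentially" using lim by (intro order_tendstoD) auto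
    then obtain n where n: "\<Psi> (1 / Suc n) < e" by (auto simp: eventually_sequentially)
    have "\<Psi> a < e" if "a < 1 / Suc n" for a using \<Psi>_mono[of a "1 / Suc n"] that n by simp
    then show "eventually (\<lambda>a. \<Psi> a < e) (at_right 0)"
      by (intro eventually_at_rightI[of 0 "1 / Suc n"]) auto
  qed
qed

text \<open>
  The pointwise estimate is \<open>(a - b)\<^sup>2 \<le> a\<^sup>2 - b\<^sup>2\<close> for \<open>a =
  g(u) \<ge> b = g(u + h) \<ge> 0\<close>, where \<open>u > 0\<close>. For \<open>u \<le> 0\<close>,
  where \<open>g(u) = 0\<close>, the difference \<open>a\<^sup>2 - b\<^sup>2\<close> has to be corrected
  by \<open>2 b\<^sup>2\<close>. The integrals of \<open>a\<^sup>2\<close> and \<open>b\<^sup>2\<close>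
  cancel, and the correction contributes \<open>2 \<Psi>(h)\<close>.
\<close>

lemma translation_estimate:
  assumes h: "0 \<le> h"
  shows "integrable lborel (\<lambda>u. (g (u + h) - g u)\<^sup>2)"
    and "(LINT u|lborel. (g (u + h) - g u)\<^sup>2) \<le> 2 * \<Psi> h"
proof -
  have shift: "integrable lborel (\<lambda>u. f (u + h))" "(LINT u|lborel. f (u + h)) = (LINT u|lborel. f u)"
    if "integrable lborel f" for f :: "real \<Rightarrow> real"
    using lborel_integrable_real_affine[OF that, of 1 h] lborel_integral_real_affine[of 1 f h]
    by (simp_all add: add.commute)
  note i1 = shift[OF sq_int] and i2 = shift[OF integrable_cut[of h]]
  have pt: "(g (u + h) - g u)\<^sup>2 \<le> (g u)\<^sup>2 - (g (u + h))\<^sup>2 + 2 * ((g (u + h))\<^sup>2 * indicator {..h} (u + h))" for u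
  proof (cases "u \<le> 0")
    case True
    then show ?thesis by (simp add: zero)
  next
    case False
    then have "g (u + h) \<le> g u" "0 \<le> g (u + h)" using h decreasing nonneg by auto
    then have "g (u + h) * g (u + h) \<le> g (u + h) * g u" by (intro mult_left_mono)
    then show ?thesis using False by (simp add: power2_eq_square algebra_simps)
  qed
  have int: "integrable lborel (\<lambda>u. (g u)\<^sup>2 - (g (u + h))\<^sup>2 + 2 * ((g (u + h))\<^sup>2 * indicator {..h} (u + h)))"
    using sq_int i1(1) i2(1) by (intro Bochner_Integration.integrable_add Bochner_Integration.integrable_diff integrable_mult_right)
  show i: "integrable lborel (\<lambda>u. (g (u + h) - g u)\<^sup>2)"
  proof (rule Bochner_Integration.integrable_bound[OF int])
    show "AE u in lborel. norm ((g (u + h) - g u)\<^sup>2) \<le> norm ((g u)\<^sup>2 - (g (u + h))\<^sup>2 + 2 * ((g (u + h))\<^sup>2 * indicator {..h} (u + h)))"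
    proof (rule AE_I2)
      fix u
      show "norm ((g (u + h) - g u)\<^sup>2) \<le> norm ((g u)\<^sup>2 - (g (u + h))\<^sup>2 + 2 * ((g (u + h))\<^sup>2 * indicator {..h} (u + h)))"
        using order_trans[OF pt[of u] abs_ge_self] by simp
    qed
  qed simp
  have "(LINT u|lborel. (g (u + h) - g u)\<^sup>2)
      \<le> (LINT u|lborel. (g u)\<^sup>2 - (g (u + h))\<^sup>2 + 2 * ((g (u + h))\<^sup>2 * indicator {..h} (u + h)))"
    by (rule integral_mono[OF i int pt])
  also have "\<dots> = (LINT u|lborel. (g u)\<^sup>2) - (LINT u|lborel. (g (u + h))\<^sup>2)
      + 2 * (LINT u|lborel. (g (u + h))\<^sup>2 * indicator {..h} (u + h))"
    using sq_int i1(1) i2(1) by simp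
  also have "\<dots> = 2 * \<Psi> h" unfolding i1(2) i2(2) by (simp add: \<Psi>_def)
  finally show "(LINT u|lborel. (g (u + h) - g u)\<^sup>2) \<le> 2 * \<Psi> h" .
qed

lemma kernel_translation:
  fixes s t :: real
  shows "integrable lborel (\<lambda>x. (g (s - x) - g (t - x))\<^sup>2)"
    and "(LINT x|lborel. (g (s - x) - g (t - x))\<^sup>2) \<le> 2 * \<Psi> \<bar>s - t\<bar>"
    and "integrable lborel (\<lambda>x. (g (x - s) - g (x - t))\<^sup>2)"
    and "(LINT x|lborel. (g (x - s) - g (x - t))\<^sup>2) \<le> 2 * \<Psi> \<bar>s - t\<bar>"
proof -
  define a where "a = min s t"
  define b where "b = max s t"
  define h where "h = \<bar>s - t\<bar>"
  define F where "F u = (g (u + h) - g u)\<^sup>2" for u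
  have h: "0 \<le> h" and ab: "b = a + h" by (auto simp: h_def a_def b_def)
  note F = translation_estimate[OF h, folded F_def]
  have 1: "(g (s - x) - g (t - x))\<^sup>2 = F (a + (-1) * x)" for x
    by (cases "s \<le> t") (auto simp: F_def a_def h_def power2_commute algebra_simps)
  have 2: "(g (x - s) - g (x - t))\<^sup>2 = F (- b + 1 * x)" for x
    by (cases "s \<le> t") (auto simp: F_def b_def h_def power2_commute algebra_simps)
  show "integrable lborel (\<lambda>x. (g (s - x) - g (t - x))\<^sup>2)"
    unfolding 1 by (intro lborel_integrable_real_affine F) simp
  show "integrable lborel (\<lambda>x. (g (x - s) - g (x - t))\<^sup>2)"
    unfolding 2 by (intro lborel_integrable_real_affine F) simp
  show "(LINT x|lborel. (g (s - x) - g (t - x))\<^sup>2) \<le> 2 * \<Psi> \<bar>s - t\<bar>"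
    unfolding 1 using lborel_integral_real_affine[of "-1" F a] F(2) by (simp add: h_def)
  show "(LINT x|lborel. (g (x - s) - g (x - t))\<^sup>2) \<le> 2 * \<Psi> \<bar>s - t\<bar>"
    unfolding 2 using lborel_integral_real_affine[of 1 F "- b"] F(2) by (simp add: h_def)
qed

lemma kernel_size:
  fixes t :: real
  shows "integrable lborel (\<lambda>x. (g (t - x))\<^sup>2)" "(LINT x|lborel. (g (t - x))\<^sup>2) = \<Psi> 1"
    and "integrable lborel (\<lambda>x. (g (x - t))\<^sup>2)" "(LINT x|lborel. (g (x - t))\<^sup>2) = \<Psi> 1"
  using lborel_integrable_real_affine[OF sq_int, of "-1" t] lborel_integral_real_affine[of "-1" "\<lambda>u. (g u)\<^sup>2" t]
    lborel_integrable_real_affine[OF sq_int, of 1 "- t"] lborel_integral_real_affine[of 1 "\<lambda>u. (g u)\<^sup>2" "- t"]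
  by (simp_all add: \<Psi>_1)

lemma leb01_integral_le:
  fixes F :: "real \<Rightarrow> real"
  assumes F: "integrable lborel F" "\<And>x. 0 \<le> F x"
  shows "integrable leb01 F" "(LINT x|leb01. F x) \<le> (LINT x|lborel. F x)"
proof -
  have i: "integrable lborel (\<lambda>x. indicator {0..1} x *\<^sub>R F x)"
    using F(1) by (intro integrable_mult_indicator) auto
  then show "integrable leb01 F" by (subst integrable_restrict_space) auto
  have "(LINT x|leb01. F x) = (LINT x|lborel. indicator {0..1} x *\<^sub>R F x)"
    by (rule integral_restrict_space) simp
  also have "\<dots> \<le> (LINT x|lborel. F x)"
    using F i by (intro integral_mono) (auto split: split_indicator)
  finally show "(LINT x|leb01. F x) \<le> (LINT x|lborel. F x)" .
qed

text \<open>
  Away from the diagonal, \<open>c = 1\<close> gives the kernel (WS) and \<open>c = 0\<close> gives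
  (VO). The left and the reflected part each contribute \<open>2 \<Psi>\<close> by
  \<open>translation_estimate\<close>, and squaring their sum doubles this.
\<close>

lemma L2_continuous_kernel_convolution:
  fixes K :: "real \<Rightarrow> real \<Rightarrow> real"
  assumes c: "\<bar>c\<bar> \<le> 1"
    and K: "\<And>t x. t \<in> {0..1} \<Longrightarrow> x \<in> {0..1} \<Longrightarrow> x \<noteq> t \<Longrightarrow> K t x = g (t - x) + c * g (x - t)"
  shows "L2_continuous_kernel K (\<lambda>h. sqrt (8 * \<Psi> h)) (sqrt (8 * \<Psi> 1))"
proof -
  define G where "G t x = g (t - x) + c * g (x - t)" for t x
  have sq: "(x + c * y)\<^sup>2 \<le> 2 * x\<^sup>2 + 2 * y\<^sup>2" for x y :: real
  proof -
    have "c\<^sup>2 \<le> 1" using c by (simp add: abs_square_le_1)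
    then have "c\<^sup>2 * y\<^sup>2 \<le> 1 * y\<^sup>2" by (intro mult_right_mono) auto
    moreover have "(x + c * y)\<^sup>2 \<le> 2 * x\<^sup>2 + 2 * (c\<^sup>2 * y\<^sup>2)"
      using sum_squares_bound[of x "c * y"] by (simp add: power2_eq_square algebra_simps)
    ultimately show ?thesis by simp
  qed
  have Gm: "G t \<in> borel_measurable leb01" for t
    unfolding G_def by (intro measurable_restrict_space1) simp
  have Km: "K t \<in> borel_measurable leb01" if t: "t \<in> {0..1}" for t
  proof -
    have "(\<lambda>x. if x = t then K t t else G t x) \<in> borel_measurable leb01"
      unfolding G_def by (intro measurable_restrict_space1) simp
    then show ?thesis
      by (subst measurable_cong[where g = "\<lambda>x. if x = t then K t t else G t x"])
        (use K[OF t] in \<open>auto simp: space_leb01 G_def\<close>)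
  qed
  have AE: "AE x in leb01. K t x = G t x" if t: "t \<in> {0..1}" for t
  proof -
    have "AE x in lborel. x \<noteq> t" by (rule AE_lborel_singleton)
    then have "AE x in leb01. x \<noteq> t" by (subst AE_restrict_space_iff) (auto elim: eventually_mono)
    moreover have "AE x in leb01. x \<in> {0..1}" using AE_space[of leb01] by (simp add: space_leb01)
    ultimately show ?thesis by eventually_elim (use K[OF t] in \<open>auto simp: G_def\<close>)
  qed
  have size: "integrable leb01 (\<lambda>x. (G t x)\<^sup>2)" "(LINT x|leb01. (G t x)\<^sup>2) \<le> 8 * \<Psi> 1" for t
  proof -
    let ?F = "\<lambda>x. 2 * (g (t - x))\<^sup>2 + 2 * (g (x - t))\<^sup>2"
    have F: "integrable lborel ?F" "(LINT x|lborel. ?F x) = 4 * \<Psi> 1" using kernel_size[of t] by simp_all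
    have F0: "0 \<le> ?F x" for x by simp
    note F' = leb01_integral_le[OF F(1) F0]
    show i: "integrable leb01 (\<lambda>x. (G t x)\<^sup>2)"
    proof (rule Bochner_Integration.integrable_bound[OF F'(1)])
      show "(\<lambda>x. (G t x)\<^sup>2) \<in> borel_measurable leb01" using Gm by simp
      show "AE x in leb01. norm ((G t x)\<^sup>2) \<le> norm (?F x)"
      proof (rule AE_I2)
        fix x
        show "norm ((G t x)\<^sup>2) \<le> norm (?F x)"
          using order_trans[OF sq[of "g (t - x)" "g (x - t)"] abs_ge_self] by (simp add: G_def)
      qed
    qed
    have "(LINT x|leb01. (G t x)\<^sup>2) \<le> (LINT x|leb01. ?F x)"
      using i F' sq by (intro integral_mono) (auto simp: G_def)
    then show "(LINT x|leb01. (G t x)\<^sup>2) \<le> 8 * \<Psi> 1" using F' F(2) \<Psi>_nonneg[of 1] by simp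
  qed
  have diff: "(LINT x|leb01. (G s x - G t x)\<^sup>2) \<le> 8 * \<Psi> \<bar>s - t\<bar>" for s t
  proof -
    let ?F = "\<lambda>x. 2 * (g (s - x) - g (t - x))\<^sup>2 + 2 * (g (x - s) - g (x - t))\<^sup>2"
    have F: "integrable lborel ?F" "(LINT x|lborel. ?F x) \<le> 8 * \<Psi> \<bar>s - t\<bar>"
      using kernel_translation[of s t] by simp_all
    have F0: "0 \<le> ?F x" for x by simp
    note F' = leb01_integral_le[OF F(1) F0]
    have "(LINT x|leb01. (G s x - G t x)\<^sup>2) \<le> (LINT x|leb01. ?F x)"
    proof (rule integral_mono')
      show "(G s x - G t x)\<^sup>2 \<le> ?F x" for x
        using sq[of "g (s - x) - g (t - x)" "g (x - s) - g (x - t)"] by (simp add: G_def algebra_simps)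
    qed (use F' in auto)
    then show ?thesis using F' F(2) by simp
  qed
  show ?thesis
  proof
    show K2: "square_integrable leb01 (K t)" if t: "t \<in> {0..1}" for t
    proof -
      have "integrable leb01 (\<lambda>x. (K t x)\<^sup>2) \<longleftrightarrow> integrable leb01 (\<lambda>x. (G t x)\<^sup>2)"
        using AE[OF t] Km[OF t] Gm[of t] by (intro integrable_cong_AE) (auto elim: eventually_mono)
      then show ?thesis using size(1) Km[OF t] by (simp add: square_integrable_def)
    qed
    show "L2_inner leb01 (\<lambda>x. K s x - K t x) (\<lambda>x. K s x - K t x) \<le> (sqrt (8 * \<Psi> \<bar>s - t\<bar>))\<^sup>2"
      if st: "s \<in> {0..1}" "t \<in> {0..1}" for s t
    proof -
      have "L2_inner leb01 (\<lambda>x. K s x - K t x) (\<lambda>x. K s x - K t x) = (LINT x|leb01. (G s x - G t x)\<^sup>2)"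
        unfolding L2_inner_self(1)
      proof (rule integral_cong_AE)
        show "AE x in leb01. (K s x - K t x)\<^sup>2 = (G s x - G t x)\<^sup>2"
          using AE[OF st(1)] AE[OF st(2)] by eventually_elim simp
      qed (use Km[OF st(1)] Km[OF st(2)] Gm in auto)
      then show ?thesis using diff[of s t] \<Psi>_nonneg by simp
    qed
    show "L2_inner leb01 (K t) (K t) \<le> (sqrt (8 * \<Psi> 1))\<^sup>2" if t: "t \<in> {0..1}" for t
    proof -
      have "L2_inner leb01 (K t) (K t) = (LINT x|leb01. (G t x)\<^sup>2)"
        unfolding L2_inner_self(1) using AE[OF t] Km[OF t] Gm[of t]
        by (intro integral_cong_AE) (auto elim: eventually_mono)
      then show ?thesis using size(2)[of t] \<Psi>_nonneg by simp
    qed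
    show "((\<lambda>h. sqrt (8 * \<Psi> h)) \<longlongrightarrow> 0) (at_right 0)"
      using tendsto_real_sqrt[OF tendsto_mult_left[OF \<Psi>_tendsto, of 8]] by simp
  qed (use \<Psi>_mono \<Psi>_nonneg \<Psi>_pos in auto)
qed

text \<open>
  That \<open>n \<Psi>(1/n)\<close> increases is \<open>\<Psi>_scale\<close> with \<open>c =
  n/l\<close>.
\<close>

lemma \<Psi>_growth:
  assumes "1 \<le> l" "l \<le> n"
  shows "sqrt (real l) * sqrt (8 * \<Psi> (1 / real l)) \<le> sqrt (real n) * sqrt (8 * \<Psi> (1 / real n))"
proof -
  have "\<Psi> ((n / l) * (1 / n)) \<le> (n / l) * \<Psi> (1 / n)"
    using assms by (intro \<Psi>_scale) simp
  then have "real l * \<Psi> (1 / l) \<le> n * \<Psi> (1 / n)" using assms by (simp add: field_simps)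
  then show ?thesis by (simp add: real_sqrt_mult[symmetric] mult.left_commute)
qed

end

section \<open>Estimating \<open>\<Psi>\<close> by antiderivatives\<close>

context L2_decreasing
begin

lemma \<Psi>_has_integral:
  assumes "0 < \<epsilon>" "\<epsilon> \<le> \<delta>"
  shows "((\<lambda>u. (g u)\<^sup>2) has_integral (\<Psi> \<delta> - \<Psi> \<epsilon>)) {\<epsilon>..\<delta>}"
proof -
  have s: "set_integrable lborel {\<epsilon>..\<delta>} (\<lambda>u. (g u)\<^sup>2)"
    unfolding set_integrable_def using sq_int by (intro integrable_mult_indicator) auto
  have "\<Psi> \<delta> - \<Psi> \<epsilon> = (LINT u|lborel. (g u)\<^sup>2 * indicator {..\<delta>} u - (g u)\<^sup>2 * indicator {..\<epsilon>} u)"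
    unfolding \<Psi>_def using integrable_cut by simp
  also have "\<dots> = (LINT u:{\<epsilon>..\<delta>}|lborel. (g u)\<^sup>2)"
    unfolding set_lebesgue_integral_def
  proof (rule integral_cong_AE)
    have "AE u in lborel. u \<noteq> \<epsilon>" by (rule AE_lborel_singleton)
    then show "AE u in lborel. (g u)\<^sup>2 * indicator {..\<delta>} u - (g u)\<^sup>2 * indicator {..\<epsilon>} u = indicator {\<epsilon>..\<delta>} u *\<^sub>R (g u)\<^sup>2"
      by eventually_elim (use assms in \<open>auto split: split_indicator\<close>)
  qed auto
  also have "\<dots> = integral {\<epsilon>..\<delta>} (\<lambda>u. (g u)\<^sup>2)" by (rule set_borel_integral_eq_integral(2)[OF s])
  finally show ?thesis using set_borel_integral_eq_integral(1)[OF s] by (simp add: integrable_integral)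
qed

text \<open>
  Integrate over \<open>[\<epsilon>, \<delta>]\<close> and let \<open>\<epsilon>\<close> tend to
  \<open>0\<close>; the boundary term \<open>- G(\<epsilon>)\<close> has the right sign.
\<close>

lemma \<Psi>_le_antiderivative:
  assumes G: "\<And>x. 0 < x \<Longrightarrow> x \<le> \<delta> \<Longrightarrow> (G has_real_derivative G' x) (at x)"
    and le: "\<And>x. 0 < x \<Longrightarrow> x \<le> \<delta> \<Longrightarrow> \<kappa> * (g x)\<^sup>2 \<le> G' x"
    and G0: "\<And>x. 0 < x \<Longrightarrow> x \<le> \<delta> \<Longrightarrow> 0 \<le> G x" and \<delta>: "0 < \<delta>"
  shows "\<kappa> * \<Psi> \<delta> \<le> G \<delta>"
proof -
  have 1: "\<kappa> * (\<Psi> \<delta> - \<Psi> \<epsilon>) \<le> G \<delta>" if "0 < \<epsilon>" "\<epsilon> < \<delta>" for \<epsilon>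
  proof -
    have G_int: "(G' has_integral (G \<delta> - G \<epsilon>)) {\<epsilon>..\<delta>}"
      using that G by (intro fundamental_theorem_of_calculus)
        (auto simp: has_real_derivative_iff_has_vector_derivative[symmetric] intro: has_field_derivative_at_within)
    have g_int: "((\<lambda>u. \<kappa> * (g u)\<^sup>2) has_integral \<kappa> * (\<Psi> \<delta> - \<Psi> \<epsilon>)) {\<epsilon>..\<delta>}"
      using that by (intro has_integral_mult_right \<Psi>_has_integral) auto
    have "\<kappa> * (\<Psi> \<delta> - \<Psi> \<epsilon>) \<le> G \<delta> - G \<epsilon>"
      using that le by (intro has_integral_le[OF g_int G_int]) auto
    then show ?thesis using G0[of \<epsilon>] that by simp
  qed
  have "((\<lambda>\<epsilon>. \<kappa> * (\<Psi> \<delta> - \<Psi> \<epsilon>)) \<longlongrightarrow> \<kappa> * (\<Psi> \<delta> - 0)) (at_right 0)"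
    by (intro tendsto_intros \<Psi>_tendsto)
  moreover have "eventually (\<lambda>\<epsilon>. \<kappa> * (\<Psi> \<delta> - \<Psi> \<epsilon>) \<le> G \<delta>) (at_right 0)"
    using 1 \<delta> by (intro eventually_at_rightI[of 0 \<delta>]) auto
  ultimately have "\<kappa> * (\<Psi> \<delta> - 0) \<le> G \<delta>"
    by (rule tendsto_upperbound) simp
  then show ?thesis by simp
qed

lemma antiderivative_le_\<Psi>:
  assumes G: "\<And>x. 0 < x \<Longrightarrow> x \<le> \<delta> \<Longrightarrow> (G has_real_derivative G' x) (at x)"
    and le: "\<And>x. 0 < x \<Longrightarrow> x \<le> \<delta> \<Longrightarrow> G' x \<le> (g x)\<^sup>2"
    and \<epsilon>: "0 < \<epsilon>" "\<epsilon> < \<delta>"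
  shows "G \<delta> - G \<epsilon> \<le> \<Psi> \<delta>"
proof -
  have G_int: "(G' has_integral (G \<delta> - G \<epsilon>)) {\<epsilon>..\<delta>}"
    using \<epsilon> G by (intro fundamental_theorem_of_calculus)
      (auto simp: has_real_derivative_iff_has_vector_derivative[symmetric] intro: has_field_derivative_at_within)
  have g_int: "((\<lambda>u. (g u)\<^sup>2) has_integral (\<Psi> \<delta> - \<Psi> \<epsilon>)) {\<epsilon>..\<delta>}"
    using \<epsilon> by (intro \<Psi>_has_integral) auto
  have "G \<delta> - G \<epsilon> \<le> \<Psi> \<delta> - \<Psi> \<epsilon>"
    using \<epsilon> le by (intro has_integral_le[OF G_int g_int]) auto
  then show ?thesis using \<Psi>_nonneg[of \<epsilon>] by simp
qed

end

section \<open>Logarithmic scales\<close>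

text \<open>
  Products of powers of \<open>x\<close>, \<open>v = c\<^sub>0 - ln x\<close> and \<open>w = c\<^sub>0 +
  ln v\<close>. The square of the kernel function is of this form near \<open>0\<close>, and so are the
  antiderivatives with which it is compared. Differentiation lowers the exponent of \<open>x\<close> by
  one and multiplies by \<open>log_slope\<close>. The value at \<open>1/n\<close> divided by
  \<open>n\<close> is of the order of the square of \<open>scale_rate\<close>.
\<close>

definition log_scale :: "real \<Rightarrow> real \<Rightarrow> real \<Rightarrow> real \<Rightarrow> real \<Rightarrow> real" where
  "log_scale c0 a b c x = x powr a * (c0 - ln x) powr b * (c0 + ln (c0 - ln x)) powr c"

abbreviation log_slope :: "real \<Rightarrow> real \<Rightarrow> real \<Rightarrow> real \<Rightarrow> real \<Rightarrow> real" where
  "log_slope c0 a b c x \<equiv> a - b / (c0 - ln x) - c / ((c0 - ln x) * (c0 + ln (c0 - ln x)))"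

abbreviation scale_rate :: "real \<Rightarrow> real \<Rightarrow> real \<Rightarrow> nat \<Rightarrow> real" where
  "scale_rate a b c n \<equiv> real n powr (- (a + 1) / 2) * log 2 (real n + 1) powr (b / 2) * log 2 (log 2 (real n + 3)) powr (c / 2)"

lemma log_scale_deriv:
  assumes "0 < x" "0 < c0 - ln x" "0 < c0 + ln (c0 - ln x)"
  shows "(log_scale c0 a b c has_real_derivative
    log_scale c0 (a - 1) b c x * log_slope c0 a b c x) (at x)"
proof -
  define v w where "v = c0 - ln x" and "w = c0 + ln (c0 - ln x)"
  have vw: "v > 0" "w > 0" using assms by (simp_all add: v_def w_def)
  have dv: "((\<lambda>x. c0 - ln x) has_real_derivative - (1 / x)) (at x)"
    using assms by (auto intro!: derivative_eq_intros)
  have dw: "((\<lambda>x. c0 + ln (c0 - ln x)) has_real_derivative - (1 / (x * v))) (at x)"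
    using assms by (auto intro!: derivative_eq_intros simp: v_def field_simps)
  have d1: "((\<lambda>x. x powr a) has_real_derivative a * x powr (a - 1)) (at x)"
    using assms by (intro has_real_derivative_powr)
  have d2: "((\<lambda>x. (c0 - ln x) powr b) has_real_derivative (b * v powr (b - 1)) * - (1 / x)) (at x)"
    using DERIV_chain2[OF has_real_derivative_powr[of "c0 - ln x" b] dv] assms by (simp add: v_def)
  have d3: "((\<lambda>x. (c0 + ln (c0 - ln x)) powr c) has_real_derivative (c * w powr (c - 1)) * - (1 / (x * v))) (at x)"
    using DERIV_chain2[OF has_real_derivative_powr[of "c0 + ln (c0 - ln x)" c] dw] assms by (simp add: w_def)
  have "(log_scale c0 a b c has_real_derivative
      (a * x powr (a - 1) * v powr b + (b * v powr (b - 1)) * - (1 / x) * x powr a) * w powr c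
      + ((c * w powr (c - 1)) * - (1 / (x * v))) * (x powr a * v powr b)) (at x)"
    unfolding log_scale_def[abs_def]
    using DERIV_mult[OF DERIV_mult[OF d1 d2] d3] by (simp add: v_def w_def)
  moreover have "(a * x powr (a - 1) * v powr b + (b * v powr (b - 1)) * - (1 / x) * x powr a) * w powr c
      + ((c * w powr (c - 1)) * - (1 / (x * v))) * (x powr a * v powr b)
    = x powr (a - 1) * v powr b * w powr c * (a - b / v - c / (v * w))"
  proof -
    have p: "x powr (a - 1) = x powr a / x" "v powr (b - 1) = v powr b / v" "w powr (c - 1) = w powr c / w"
      using assms vw by (simp_all add: powr_diff)
    show ?thesis unfolding p using assms(1) vw by (simp add: field_simps)
  qed
  ultimately show ?thesis by (simp add: log_scale_def v_def w_def)
qed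

text \<open>
  At \<open>x = 1/n\<close> the two logarithms are \<open>c\<^sub>0 + ln n\<close> and \<open>c\<^sub>0
  + ln (c\<^sub>0 + ln n)\<close>; their quotients by the binary logarithms in the rate tend to
  \<open>ln 2\<close>, so that powers of the quotients converge for exponents of either sign.
\<close>

lemma log_scale_ratio_bounded:
  fixes c0 a b c :: real
  shows "\<exists>C. eventually (\<lambda>n. sqrt (log_scale c0 a b c (1 / real n)) / sqrt (real n)
    \<le> C * scale_rate a b c n) sequentially"
proof -
  define V where "V n = c0 + ln (real n)" for n :: nat
  define W where "W n = c0 + ln (V n)" for n
  define V' where "V' n = log 2 (real n + 1)" for n :: nat
  define W' where "W' n = log 2 (log 2 (real n + 3))" for n :: nat
  have V: "(\<lambda>n. V n / V' n) \<longlonglongrightarrow> ln 2" unfolding V_def V'_def by real_asymp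
  have W: "(\<lambda>n. W n / W' n) \<longlonglongrightarrow> ln 2" unfolding W_def V_def W'_def by real_asymp
  have pos: "eventually (\<lambda>n. 0 < V n \<and> 0 < W n \<and> 0 < V' n \<and> 0 < W' n \<and> 0 < n) sequentially"
  proof -
    have "eventually (\<lambda>n. 0 < V n) sequentially" unfolding V_def by real_asymp
    moreover have "eventually (\<lambda>n. 0 < W n) sequentially" unfolding W_def V_def by real_asymp
    moreover have "eventually (\<lambda>n. 0 < V' n) sequentially" unfolding V'_def by real_asymp
    moreover have "eventually (\<lambda>n. 0 < W' n) sequentially" unfolding W'_def by real_asymp
    ultimately show ?thesis using eventually_gt_at_top[of 0] by eventually_elim auto
  qed
  have "(\<lambda>n. (V n / V' n) powr (b / 2) * (W n / W' n) powr (c / 2)) \<longlonglongrightarrow> (ln 2) powr (b / 2) * (ln 2) powr (c / 2)"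
    using V W by (intro tendsto_intros) auto
  then have "eventually (\<lambda>n. (V n / V' n) powr (b / 2) * (W n / W' n) powr (c / 2)
      < (ln 2) powr (b / 2) * (ln 2) powr (c / 2) + 1) sequentially"
    by (rule order_tendstoD) simp
  then have "eventually (\<lambda>n. sqrt (log_scale c0 a b c (1 / real n)) / sqrt (real n)
    \<le> ((ln 2) powr (b / 2) * (ln 2) powr (c / 2) + 1) * (real n powr (- (a + 1) / 2) * V' n powr (b / 2) * W' n powr (c / 2))) sequentially"
    using pos
  proof eventually_elim
    case (elim n)
    have n: "0 < real n" using elim by simp
    have "log_scale c0 a b c (1 / real n) = real n powr (- a) * V n powr b * W n powr c"
      using n by (simp add: log_scale_def V_def W_def ln_div powr_divide powr_minus_divide)
    moreover have "sqrt (y powr e) = y powr (e / 2)" for y e :: real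
      by (simp add: powr_half_sqrt[symmetric] powr_powr)
    moreover have "1 / sqrt (real n) = real n powr (- 1 / 2)"
      using n by (simp add: powr_half_sqrt[symmetric] powr_minus_divide)
    ultimately have "sqrt (log_scale c0 a b c (1 / real n)) * (1 / sqrt (real n))
        = real n powr (- a / 2) * V n powr (b / 2) * W n powr (c / 2) * real n powr (- 1 / 2)"
      by (simp only: real_sqrt_mult)
    then have "sqrt (log_scale c0 a b c (1 / real n)) / sqrt (real n)
        = real n powr (- a / 2) * V n powr (b / 2) * W n powr (c / 2) * real n powr (- 1 / 2)"
      by simp
    also have "\<dots> = real n powr (- (a + 1) / 2) * (V n powr (b / 2) * W n powr (c / 2))"
      by (simp add: powr_add[symmetric] add_divide_distrib diff_divide_distrib algebra_simps)
    also have "V n powr (b / 2) * W n powr (c / 2)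
        = ((V n / V' n) powr (b / 2) * (W n / W' n) powr (c / 2)) * (V' n powr (b / 2) * W' n powr (c / 2))"
      using elim by (simp add: powr_divide)
    also have "real n powr (- (a + 1) / 2) * \<dots>
        \<le> real n powr (- (a + 1) / 2) * (((ln 2) powr (b / 2) * (ln 2) powr (c / 2) + 1) * (V' n powr (b / 2) * W' n powr (c / 2)))"
      using elim by (intro mult_left_mono mult_right_mono) auto
    finally show ?case by (simp add: mult_ac)
  qed
  then show ?thesis unfolding V'_def W'_def by blast
qed

lemma eventually_uniform_bound:
  fixes f h :: "nat \<Rightarrow> real"
  assumes "eventually (\<lambda>n. f n \<le> C * h n) sequentially" "\<And>n. n \<ge> 1 \<Longrightarrow> 0 < h n"
  shows "\<exists>C>0. \<forall>n\<ge>1. f n \<le> C * h n"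
proof -
  obtain N where N: "\<And>n. n \<ge> N \<Longrightarrow> f n \<le> C * h n" using assms(1) by (auto simp: eventually_sequentially)
  define C' where "C' = 1 + \<bar>C\<bar> + (\<Sum>n\<in>{1..N}. \<bar>f n\<bar> / h n)"
  have s: "0 \<le> (\<Sum>n\<in>{1..N}. \<bar>f n\<bar> / h n)" using assms(2) by (intro sum_nonneg) (auto intro: divide_nonneg_pos)
  have "f n \<le> C' * h n" if n: "n \<ge> 1" for n
  proof (cases "n \<ge> N")
    case True
    have "f n \<le> C * h n" by (rule N[OF True])
    also have "\<dots> \<le> C' * h n" using assms(2)[OF n] s by (intro mult_right_mono) (auto simp: C'_def)
    finally show ?thesis .
  next
    case False
    have "\<bar>f n\<bar> / h n \<le> (\<Sum>n\<in>{1..N}. \<bar>f n\<bar> / h n)"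
      using False n assms(2) by (intro member_le_sum) (auto intro: divide_nonneg_pos)
    also have "\<dots> \<le> C'" by (simp add: C'_def)
    finally have "\<bar>f n\<bar> \<le> C' * h n" using assms(2)[OF n] by (simp add: divide_le_eq)
    then show ?thesis by simp
  qed
  moreover have "0 < C'" using s by (simp add: C'_def)
  ultimately show ?thesis by blast
qed

lemma loglog_pos:
  assumes "n \<ge> 1"
  shows "0 < log 2 (real n + 1)" "0 < log 2 (log 2 (real n + 3))"
proof -
  show "0 < log 2 (real n + 1)" using assms by simp
  have "log 2 (2 powr 2) \<le> log 2 (real n + 3)" using assms by (intro log_mono) auto
  then have "1 < log 2 (real n + 3)" by simp
  then show "0 < log 2 (log 2 (real n + 3))" by simp
qed

section \<open>The kernel function\<close>

locale kern_setting = L2_decreasing g for g :: "real \<Rightarrow> real" +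
  fixes \<tau> \<beta> \<gamma> c0 :: real
  assumes g_eq: "0 < x \<Longrightarrow> x \<le> 1 \<Longrightarrow> g x = kern \<tau> c0 \<beta> \<gamma> x"
    and \<tau>: "0 < \<tau>" "\<tau> \<le> 1 / 2"
begin

lemma eventually_large:
  "eventually (\<lambda>x. M < c0 - ln x \<and> M < c0 + ln (c0 - ln x) \<and> 0 < x \<and> x \<le> 1) (at_right (0::real))"
proof -
  have "filterlim (\<lambda>x::real. c0 - ln x) at_top (at_right 0)" by real_asymp
  then have "eventually (\<lambda>x. M < c0 - ln x) (at_right 0)" by (simp add: filterlim_at_top_dense)
  moreover have "filterlim (\<lambda>x::real. c0 + ln (c0 - ln x)) at_top (at_right 0)" by real_asymp
  then have "eventually (\<lambda>x. M < c0 + ln (c0 - ln x)) (at_right 0)" by (simp add: filterlim_at_top_dense)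
  moreover have "eventually (\<lambda>x::real. 0 < x \<and> x \<le> 1) (at_right 0)"
    by (intro eventually_at_rightI[of 0 1]) auto
  ultimately show ?thesis by eventually_elim auto
qed

lemma g_square:
  assumes "0 < x" "x \<le> 1" "0 < c0 - ln x" "0 < c0 + ln (c0 - ln x)"
  shows "(g x)\<^sup>2 = log_scale c0 (- 2 * \<tau>) (- 2 * \<beta>) (- 2 * \<gamma>) x"
proof -
  have sq: "(y powr e)\<^sup>2 = y powr (2 * e)" for y e :: real
    by (simp add: power2_eq_square powr_add[symmetric])
  have "g x = x powr (- \<tau>) * (c0 - ln x) powr (- \<beta>) * (c0 + ln (c0 - ln x)) powr (- \<gamma>)"
    using assms by (simp add: g_eq kern_def rpow_def)
  then show ?thesis by (simp add: power_mult_distrib sq log_scale_def)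
qed

text \<open>
  \<open>\<Psi>\<close> is compared with \<open>log_scale c\<^sub>0 a b c / \<kappa>\<close> near
  \<open>0\<close>. This settles all large \<open>n\<close>; the finitely many others are absorbed by
  the constant.
\<close>

lemma \<Psi>_bound_by_scale:
  assumes \<kappa>: "0 < \<kappa>"
    and le: "eventually (\<lambda>x. \<kappa> * (g x)\<^sup>2 \<le> log_scale c0 (a - 1) b c x *
      log_slope c0 a b c x) (at_right 0)"
  shows "\<exists>C>0. \<forall>n\<ge>1. sqrt (8 * \<Psi> (1 / real n)) / sqrt (real n)
    \<le> C * scale_rate a b c n"
proof -
  have "eventually (\<lambda>x. (\<kappa> * (g x)\<^sup>2 \<le> log_scale c0 (a - 1) b c x *
      log_slope c0 a b c x) \<and>
      0 < c0 - ln x \<and> 0 < c0 + ln (c0 - ln x)) (at_right 0)"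
    using le eventually_large[of 0] by eventually_elim auto
  then obtain d where d: "0 < d" and P: "\<And>x. 0 < x \<Longrightarrow> x < d \<Longrightarrow> \<kappa> * (g x)\<^sup>2 \<le> log_scale c0 (a - 1) b c x *
      log_slope c0 a b c x"
      "\<And>x. 0 < x \<Longrightarrow> x < d \<Longrightarrow> 0 < c0 - ln x" "\<And>x. 0 < x \<Longrightarrow> x < d \<Longrightarrow> 0 < c0 + ln (c0 - ln x)"
    unfolding eventually_at_right_field by blast
  have \<Psi>: "\<Psi> \<delta> \<le> log_scale c0 a b c \<delta> / \<kappa>" if "0 < \<delta>" "\<delta> < d" for \<delta>
  proof -
    have "\<kappa> * \<Psi> \<delta> \<le> log_scale c0 a b c \<delta>"
      by (rule \<Psi>_le_antiderivative[OF log_scale_deriv P(1)])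
        (use that P in \<open>auto simp: log_scale_def\<close>)
    then show ?thesis using \<kappa> by (simp add: field_simps)
  qed
  obtain C where C: "eventually (\<lambda>n. sqrt (log_scale c0 a b c (1 / real n)) / sqrt (real n)
    \<le> C * scale_rate a b c n) sequentially"
    using log_scale_ratio_bounded by blast
  have "eventually (\<lambda>n. 1 / real n < d) sequentially" using d by real_asymp
  then have "eventually (\<lambda>n. sqrt (8 * \<Psi> (1 / real n)) / sqrt (real n)
    \<le> (sqrt (8 / \<kappa>) * C) * scale_rate a b c n) sequentially"
    using C eventually_gt_at_top[of 0]
  proof eventually_elim
    case (elim n)
    have "sqrt (8 * \<Psi> (1 / real n)) \<le> sqrt (8 / \<kappa> * log_scale c0 a b c (1 / real n))"
      using \<Psi>[of "1 / real n"] elim \<kappa> by (simp add: field_simps)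
    also have "\<dots> = sqrt (8 / \<kappa>) * sqrt (log_scale c0 a b c (1 / real n))" by (rule real_sqrt_mult)
    finally have "sqrt (8 * \<Psi> (1 / real n)) / sqrt (real n)
        \<le> sqrt (8 / \<kappa>) * sqrt (log_scale c0 a b c (1 / real n)) / sqrt (real n)"
      by (intro divide_right_mono) auto
    also have "\<dots> = sqrt (8 / \<kappa>) * (sqrt (log_scale c0 a b c (1 / real n)) / sqrt (real n))" by simp
    also have "\<dots> \<le> sqrt (8 / \<kappa>) * (C * scale_rate a b c n)"
      using elim(2) \<kappa> by (intro mult_left_mono) auto
    finally show ?case by (simp add: mult.assoc)
  qed
  then show ?thesis
  proof (rule eventually_uniform_bound)
    fix n :: nat assume n: "n \<ge> 1"
    have ne: "log 2 (real n + 1) \<noteq> 0" "log 2 (log 2 (real n + 3)) \<noteq> 0"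
      using loglog_pos[OF n] by linarith+
    show "0 < scale_rate a b c n"
      using n ne by (intro mult_pos_pos) auto
  qed
qed

text \<open>
  For \<open>\<tau> = 1/2\<close> and all other exponents, \<open>g\<^sup>2\<close> dominates
  \<open>1/(x v w)\<close> near \<open>0\<close>. This is the derivative of \<open>- ln w\<close>, which
  is unbounded, so that \<open>g\<close> would not be square integrable.
\<close>

lemma exponents_square_integrable:
  assumes "\<tau> = 1 / 2"
  shows "1 / 2 < \<beta> \<or> (\<beta> = 1 / 2 \<and> 1 / 2 < \<gamma>)"
proof (rule ccontr)
  assume "\<not> ?thesis"
  then have *: "\<beta> < 1 / 2 \<or> (\<beta> = 1 / 2 \<and> \<gamma> \<le> 1 / 2)" by auto
  define v where "v x = c0 - ln x" for x :: real
  define w where "w x = c0 + ln (v x)" for x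
  have v: "filterlim v at_top (at_right 0)" unfolding v_def by real_asymp
  have "eventually (\<lambda>y. 1 \<le> y powr (1 - 2 * \<beta>) * (c0 + ln y) powr (1 - 2 * \<gamma>)) at_top"
  proof (cases "\<beta> < 1 / 2")
    case True
    define p where "p = 1 - 2 * \<beta>"
    define r where "r = 1 - 2 * \<gamma>"
    have "p > 0" using True by (simp add: p_def)
    then have "filterlim (\<lambda>y. y powr p * (c0 + ln y) powr r) at_top at_top" by real_asymp
    then show ?thesis by (simp add: filterlim_at_top p_def r_def)
  next
    case False
    then have "1 - 2 * \<beta> = 0" "0 \<le> 1 - 2 * \<gamma>" using * by auto
    moreover have "eventually (\<lambda>y. 1 \<le> c0 + ln y \<and> 0 < y) at_top"
      by (intro eventually_conj) real_asymp+
    ultimately show ?thesis by (auto elim!: eventually_mono intro: ge_one_powr_ge_zero)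
  qed
  then have "eventually (\<lambda>x. 1 \<le> v x powr (1 - 2 * \<beta>) * w x powr (1 - 2 * \<gamma>)) (at_right 0)"
    unfolding w_def using v by (rule eventually_compose_filterlim)
  then have "eventually (\<lambda>x. 1 / (x * (v x * w x)) \<le> (g x)\<^sup>2 \<and> 0 < v x \<and> 0 < w x) (at_right 0)"
    using eventually_large[of 0]
  proof eventually_elim
    case (elim x)
    then have x: "0 < x" "x \<le> 1" "0 < v x" "0 < w x" by (auto simp: v_def w_def)
    have "1 / (x * (v x * w x)) \<le> (v x powr (1 - 2 * \<beta>) * w x powr (1 - 2 * \<gamma>)) / (x * (v x * w x))"
      using elim x by (intro divide_right_mono) auto
    also have "\<dots> = (g x)\<^sup>2"
      using x g_square[of x] assms by (simp add: v_def[symmetric] w_def[symmetric] log_scale_def powr_diff powr_minus_divide)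
    finally show ?case using x by simp
  qed
  then obtain d where d: "0 < d" and P: "\<And>x. 0 < x \<Longrightarrow> x < d \<Longrightarrow> 1 / (x * (v x * w x)) \<le> (g x)\<^sup>2"
    "\<And>x. 0 < x \<Longrightarrow> x < d \<Longrightarrow> 0 < v x" "\<And>x. 0 < x \<Longrightarrow> x < d \<Longrightarrow> 0 < w x"
    unfolding eventually_at_right_field by blast
  define \<delta> where "\<delta> = d / 2"
  have \<delta>: "0 < \<delta>" "\<delta> < d" using d by (simp_all add: \<delta>_def)
  have der: "((\<lambda>x. - ln (w x)) has_real_derivative 1 / (x * (v x * w x))) (at x)" if "0 < x" "x \<le> \<delta>" for x
  proof -
    have pos: "0 < x" "0 < v x" "0 < w x" using that \<delta> P(2,3)[of x] by auto
    have dv: "(v has_real_derivative - (1 / x)) (at x)"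
      unfolding v_def[abs_def] using pos by (auto intro!: derivative_eq_intros)
    have dw: "(w has_real_derivative - (1 / x) / v x) (at x)"
      unfolding w_def[abs_def] using pos dv by (auto intro!: derivative_eq_intros)
    show ?thesis using pos dw by (auto intro!: derivative_eq_intros)
  qed
  have bnd: "ln (w \<epsilon>) \<le> \<Psi> \<delta> + ln (w \<delta>)" if "0 < \<epsilon>" "\<epsilon> < \<delta>" for \<epsilon>
    using antiderivative_le_\<Psi>[OF der P(1) that] \<delta> by simp
  have "filterlim (\<lambda>x. ln (w x)) at_top (at_right 0)" unfolding w_def v_def by real_asymp
  then have "eventually (\<lambda>x. \<Psi> \<delta> + ln (w \<delta>) < ln (w x)) (at_right 0)"
    by (simp add: filterlim_at_top_dense)
  moreover have "eventually (\<lambda>x. 0 < x \<and> x < \<delta>) (at_right 0)"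
    using \<delta> by (intro eventually_at_rightI[of 0 \<delta>]) auto
  ultimately have "eventually (\<lambda>x::real. False) (at_right 0)"
    by eventually_elim (use bnd in force)
  then show False by simp
qed

text \<open>
  In each case the exponents \<open>a, b, c\<close> are those for which \<open>log_scale c\<^sub>0 (a -
  1) b c\<close> times the leading term of \<open>log_slope\<close> is a multiple of
  \<open>g\<^sup>2\<close>. The leading term is \<open>a = 1 - 2 \<tau>\<close> in the first case,
  \<open>- b/v\<close> with \<open>b = 1 - 2 \<beta>\<close> in the second, and \<open>- c/(v w)\<close>
  with \<open>c = 1 - 2 \<gamma>\<close> in the third. Further terms of the slope are of lower order and
  are absorbed by halving the constant.
\<close>

lemma modulus_le_rate:
  "\<exists>C>0. \<forall>n\<ge>1. sqrt (8 * \<Psi> (1 / real n)) / sqrt (real n) \<le> C * rate n \<tau> \<beta> \<gamma>"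
proof -
  consider (1) "\<tau> < 1 / 2" | (2) "\<tau> = 1 / 2" "1 / 2 < \<beta>" | (3) "\<tau> = 1 / 2" "\<beta> = 1 / 2" "1 / 2 < \<gamma>"
    using \<tau> exponents_square_integrable by force
  then show ?thesis
  proof cases
    case 1
    define \<kappa> where "\<kappa> = (1 - 2 * \<tau>) / 2"
    have \<kappa>: "0 < \<kappa>" using 1 by (simp add: \<kappa>_def)
    have "((\<lambda>x. 2 * \<beta> / (c0 - ln x) + 2 * \<gamma> / ((c0 - ln x) * (c0 + ln (c0 - ln x)))) \<longlongrightarrow> 0) (at_right 0)"
      by real_asymp
    then have "eventually (\<lambda>x. - \<kappa> < 2 * \<beta> / (c0 - ln x) + 2 * \<gamma> / ((c0 - ln x) * (c0 + ln (c0 - ln x)))) (at_right 0)"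
      using \<kappa> by (intro order_tendstoD) auto
    then have "eventually (\<lambda>x. \<kappa> * (g x)\<^sup>2 \<le> log_scale c0 ((1 - 2 * \<tau>) - 1) (- 2 * \<beta>) (- 2 * \<gamma>) x *
      log_slope c0 (1 - 2 * \<tau>) (- 2 * \<beta>) (- 2 * \<gamma>) x) (at_right 0)"
      using eventually_large[of 0]
    proof eventually_elim
      case (elim x)
      have "\<kappa> * (g x)\<^sup>2 = log_scale c0 (- 2 * \<tau>) (- 2 * \<beta>) (- 2 * \<gamma>) x * \<kappa>"
        using elim g_square[of x] by simp
      also have "\<dots> \<le> log_scale c0 (- 2 * \<tau>) (- 2 * \<beta>) (- 2 * \<gamma>) x *
        log_slope c0 (1 - 2 * \<tau>) (- 2 * \<beta>) (- 2 * \<gamma>) x"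
        using elim by (intro mult_left_mono) (auto simp: \<kappa>_def log_scale_def field_simps)
      finally show ?case by simp
    qed
    from \<Psi>_bound_by_scale[OF \<kappa> this] show ?thesis
      using 1 \<tau> by (simp add: rate_def diff_divide_distrib)
  next
    case 2
    define \<kappa> where "\<kappa> = (2 * \<beta> - 1) / 2"
    have \<kappa>: "0 < \<kappa>" using 2 by (simp add: \<kappa>_def)
    have "((\<lambda>x. 2 * \<gamma> / (c0 + ln (c0 - ln x))) \<longlongrightarrow> 0) (at_right 0)"
      by real_asymp
    then have "eventually (\<lambda>x. - \<kappa> < 2 * \<gamma> / (c0 + ln (c0 - ln x))) (at_right 0)"
      using \<kappa> by (intro order_tendstoD) auto
    then have "eventually (\<lambda>x. \<kappa> * (g x)\<^sup>2 \<le> log_scale c0 (0 - 1) (1 - 2 * \<beta>) (- 2 * \<gamma>) x *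
      log_slope c0 0 (1 - 2 * \<beta>) (- 2 * \<gamma>) x) (at_right 0)"
      using eventually_large[of 0]
    proof eventually_elim
      case (elim x)
      define v w where "v = c0 - ln x" and "w = c0 + ln (c0 - ln x)"
      have vw: "0 < v" "0 < w" using elim by (auto simp: v_def w_def)
      have "\<kappa> * (g x)\<^sup>2 = log_scale c0 (- 1) (- 2 * \<beta>) (- 2 * \<gamma>) x * \<kappa>"
        using elim g_square[of x] 2 by simp
      also have "\<dots> \<le> log_scale c0 (- 1) (- 2 * \<beta>) (- 2 * \<gamma>) x * ((2 * \<beta> - 1) + 2 * \<gamma> / w)"
        using elim by (intro mult_left_mono) (auto simp: \<kappa>_def w_def log_scale_def field_simps)
      also have "(2 * \<beta> - 1) + 2 * \<gamma> / w = v * (0 - (1 - 2 * \<beta>) / v - (- 2 * \<gamma>) / (v * w))"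
        using vw by (simp add: field_simps)
      also have "log_scale c0 (- 1) (- 2 * \<beta>) (- 2 * \<gamma>) x * (v * (0 - (1 - 2 * \<beta>) / v - (- 2 * \<gamma>) / (v * w)))
          = (log_scale c0 (- 1) (- 2 * \<beta>) (- 2 * \<gamma>) x * v) * (0 - (1 - 2 * \<beta>) / v - (- 2 * \<gamma>) / (v * w))"
        by (simp only: mult.assoc)
      also have "log_scale c0 (- 1) (- 2 * \<beta>) (- 2 * \<gamma>) x * v = log_scale c0 (0 - 1) (1 - 2 * \<beta>) (- 2 * \<gamma>) x"
        using vw by (simp add: log_scale_def v_def[symmetric] powr_diff powr_minus_divide)
      finally show ?case by (simp only: v_def w_def)
    qed
    from \<Psi>_bound_by_scale[OF \<kappa> this] show ?thesis
      using 2 by (simp add: rate_def diff_divide_distrib)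
  next
    case 3
    define \<kappa> where "\<kappa> = 2 * \<gamma> - 1"
    have \<kappa>: "0 < \<kappa>" using 3 by (simp add: \<kappa>_def)
    have "eventually (\<lambda>x. \<kappa> * (g x)\<^sup>2 \<le> log_scale c0 (0 - 1) 0 (1 - 2 * \<gamma>) x *
      log_slope c0 0 0 (1 - 2 * \<gamma>) x) (at_right 0)"
      using eventually_large[of 0]
    proof eventually_elim
      case (elim x)
      define v w where "v = c0 - ln x" and "w = c0 + ln (c0 - ln x)"
      have vw: "0 < x" "0 < v" "0 < w" using elim by (auto simp: v_def w_def)
      have scale: "log_scale c0 a b c x = x powr a * v powr b * w powr c" for a b c
        by (simp add: log_scale_def v_def w_def)
      have "\<kappa> * (g x)\<^sup>2 = log_scale c0 (- 1) (- 1) (- 2 * \<gamma>) x * \<kappa>"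
        using elim g_square[of x] 3 by simp
      also have "\<dots> = log_scale c0 (0 - 1) 0 (1 - 2 * \<gamma>) x * (0 - 0 / v - (1 - 2 * \<gamma>) / (v * w))"
      proof -
        have "v powr (- 1) = 1 / v" "v powr 0 = 1" "w powr (1 - 2 * \<gamma>) = w * w powr (- 2 * \<gamma>)"
          using vw by (simp_all add: powr_minus_divide powr_diff)
        then show ?thesis unfolding scale \<kappa>_def using vw by (simp add: field_simps)
      qed
      finally show ?case by (simp add: v_def w_def)
    qed
    from \<Psi>_bound_by_scale[OF \<kappa> this] obtain C where "C > 0" and C: "\<forall>n\<ge>1. sqrt (8 * \<Psi> (1 / real n)) / sqrt (real n)
      \<le> C * scale_rate 0 0 (1 - 2 * \<gamma>) n"
      by blast
    have "log 2 (real n + 1) powr (0 / 2) = 1" if "n \<ge> 1" for n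
    proof -
      have "log 2 (real n + 1) \<noteq> 0" using loglog_pos(1)[OF that] by linarith
      then show ?thesis by simp
    qed
    then have "sqrt (8 * \<Psi> (1 / real n)) / sqrt (real n) \<le> C * rate n \<tau> \<beta> \<gamma>" if "n \<ge> 1" for n
      using C[rule_format, OF that] 3 that by (simp add: rate_def diff_divide_distrib)
    then show ?thesis using \<open>C > 0\<close> by blast
  qed
qed

end

section \<open>The theorem\<close>

theorem theorem5p18:
  fixes \<tau> \<beta> \<gamma> c0 :: real and k :: "real \<Rightarrow> real"
  defines "k \<equiv> kern \<tau> c0 \<beta> \<gamma>"
  assumes "0 < \<tau>" and "\<tau> \<le> 1/2" and "0 < c0"
    and well_defined: "\<forall>x\<in>{0<..1}. rpow_defined (c0 + ln (c0 - ln x)) (- \<gamma>)"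
    and nonneg: "\<forall>x\<in>{0<..1}. 0 \<le> k x"
    and cont: "continuous_on {0<..1} k"
    and decr: "strict_antimono_on {0<..1} k"
    and lim: "filterlim k at_top (at_right 0)"
    and square_integrable: "abs_aefun k \<in> Lp 2"
  shows "\<exists>c>0. \<forall>K\<in>{kernel_WS k, kernel_VO k}. \<forall>q::real. 1 \<le> q \<longrightarrow>
    bounded_operator (Lp 2) (Lp_norm 2) (Lp q) (Lp_norm q) (integral_operator K) \<and>
    (\<forall>s\<in>{kolmogorov_number, entropy_number}. \<forall>n\<ge>1.
       s (Lp 2) (Lp_norm 2) (Lp q) (Lp_norm q) (integral_operator K) n
         \<le> c * sqrt q * rate n \<tau> \<beta> \<gamma>)"
proof -
  define g where "g u = (if 0 < u \<and> u \<le> 1 then k u else 0)" for u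
  have k_meas: "k \<in> borel_measurable borel"
    unfolding k_def kern_def[abs_def] rpow_def by measurable
  have k_less: "k y < k x" if "0 < x" "x < y" "y \<le> 1" for x y
    using decr that by (auto simp: monotone_on_def)
  have k_nonneg: "0 \<le> k x" if "0 < x" "x \<le> 1" for x
    using nonneg that by auto
  interpret kern_setting g \<tau> \<beta> \<gamma> c0
  proof
    show "g \<in> borel_measurable borel" unfolding g_def[abs_def] using k_meas by measurable
    have "k \<in> borel_measurable leb01" using k_meas by (intro measurable_restrict_space1) simp
    then have "integrable leb01 (\<lambda>x. \<bar>k x\<bar> powr 2)"
      using square_integrable by (simp add: abs_aefun_in_Lp_iff)
    then have "integrable lborel (\<lambda>x. indicator {0..1} x *\<^sub>R \<bar>k x\<bar> powr 2)"
      by (subst (asm) integrable_restrict_space) auto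
    moreover have "indicator {0..1} x *\<^sub>R \<bar>k x\<bar> powr 2 = (g x)\<^sup>2" for x
    proof (cases "x = 0")
      \<comment> \<open>At \<open>0\<close> the function \<open>k\<close> vanishes, because \<open>0\<close> to any power is \<open>0\<close> for \<^const>\<open>powr\<close>.\<close>
      case True
      then show ?thesis by (simp add: g_def k_def kern_def)
    next
      case False
      have "\<bar>y\<bar> powr 2 = y\<^sup>2" for y :: real by (cases "y = 0") (auto simp: powr_numeral)
      then show ?thesis using False by (auto simp: g_def split: split_indicator)
    qed
    ultimately show "integrable lborel (\<lambda>u. (g u)\<^sup>2)" by simp
    show "g v \<le> g u" if "0 < u" "u \<le> v" for u v
      using that k_nonneg[of u] k_less[of u v] by (cases "u = v") (auto simp: g_def)
    show "0 < g u" if "0 < u" "u < 1" for u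
      using k_less[of u 1] k_nonneg[of 1] that by (simp add: g_def)
    show "g x = kern \<tau> c0 \<beta> \<gamma> x" if "0 < x" "x \<le> 1" for x
      using that by (simp add: g_def k_def)
  qed (use k_nonneg assms in \<open>auto simp: g_def\<close>)
  obtain C where C: "0 < C" "\<And>n. 1 \<le> n \<Longrightarrow> sqrt (8 * \<Psi> (1 / real n)) / sqrt (real n) \<le> C * rate n \<tau> \<beta> \<gamma>"
    using modulus_le_rate by blast
  have kernels: "L2_continuous_kernel K (\<lambda>h. sqrt (8 * \<Psi> h)) (sqrt (8 * \<Psi> 1))"
    if "K \<in> {kernel_WS k, kernel_VO k}" for K
  proof -
    have "L2_continuous_kernel (kernel_WS k) (\<lambda>h. sqrt (8 * \<Psi> h)) (sqrt (8 * \<Psi> 1))"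
      by (rule L2_continuous_kernel_convolution[where c = 1]) (auto simp: kernel_WS_def g_def abs_if)
    moreover have "L2_continuous_kernel (kernel_VO k) (\<lambda>h. sqrt (8 * \<Psi> h)) (sqrt (8 * \<Psi> 1))"
      by (rule L2_continuous_kernel_convolution[where c = 0]) (auto simp: kernel_VO_def g_def)
    ultimately show ?thesis using that by blast
  qed
  have bound: "s (Lp 2) (Lp_norm 2) (Lp q) (Lp_norm q) (integral_operator K) n
      \<le> 20000 * C * sqrt q * rate n \<tau> \<beta> \<gamma>"
    if K: "K \<in> {kernel_WS k, kernel_VO k}" and q: "1 \<le> q" and s: "s \<in> {kolmogorov_number, entropy_number}"
      and n: "1 \<le> n" for K q s n
  proof -
    have "s (Lp 2) (Lp_norm 2) (Lp q) (Lp_norm q) (integral_operator K) n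
        \<le> 20000 * sqrt q * (sqrt (8 * \<Psi> (1 / real n)) / sqrt (real n))"
      by (rule L2_continuous_kernel.kolmogorov_and_entropy_bound[OF kernels[OF K] q n s _ \<Psi>_growth]) auto
    also have "\<dots> \<le> 20000 * sqrt q * (C * rate n \<tau> \<beta> \<gamma>)"
      using q C(2)[OF n] by (intro mult_left_mono) auto
    finally show ?thesis by (simp add: mult_ac)
  qed
  show ?thesis
    using C(1) bound L2_continuous_kernel.T_bounded_operator[OF kernels]
    by (intro exI[of _ "20000 * C"]) auto
qed

end
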